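(* Let $\approx$ be an SCER on $\Sigma^*$ with prefix encoding $f$ and let $\mathcal{D}$ be a dictionary. Then $\mathrm{SCERA}(\mathcal{D})$ (its goto, failure and output functions) can be constructed in $O(E(m) + m\cdot(R(\ell)+\log\pi))$ time, where $m$ is the total length of the patterns, $\ell$ is the length of the longest pattern in $\mathcal{D}$, $E(m)$ is the time required to encode $\mathcal{D}$, $R(\ell)$ is the time required to re-encode the last symbol of a substring of some $P_k\in\mathcal{D}$, and $\pi$ is the maximum number of outgoing transitions from any state.
   Context: Model: word RAM; $\Sigma,\Pi$ are integer alphabets, symbols have constant size and two symbols can be compared in constant time. Strings are 1-indexed; $X[i:j]$ is the substring from $i$ to $j$ ($=\varepsilon$ if $j<i$), $X[:j]=X[1:j]$. An equivalence relation $\approx\subseteq\Sigma^*\times\Sigma^*$ is a substring consistent equivalence relation (SCER) if $X\approx Y$ implies $|X|=|Y|$ and $X[i:j]\approx Y[i:j]$ for all $1\le i\le j\le|X|$. A prefix encoding w.r.t. $\approx$ is a map $f:\Sigma^*\to\Pi^*$ with $|f(X)|=|X|$, $f(X[:i])=f(X)[:i]$, and $f(X)=f(Y)$ iff $X\approx Y$. For a string $X$, $f(X)$ is computable in $E(|X|)$ time; once $f(X)$ is computed, the last symbol $f(X[i:j])[j-i+1]$ can be computed in $R(|X[i:j]|)$ time. Dictionary $\mathcal{D}=\{P_1,\dots,P_d\}$ of nonempty strings over $\Sigma$, $m=\sum_k|P_k|$, $\ell=\max_k|P_k|$. $\mathrm{Pref}(f(\mathcal{D}))$ is the set of all prefixes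 of $f(P_1),\dots,f(P_d)$. $\mathrm{SCERA}(\mathcal{D})$: states are the elements of $\mathrm{Pref}(f(\mathcal{D}))$ (root $=\varepsilon$). Goto: $\mathrm{goto}(S,c)=Sc$ if $Sc$ is a state, else $\mathrm{Null}$; $\pi$ is the maximum number of $c$ with $\mathrm{goto}(S,c)\neq\mathrm{Null}$ over all states $S$. Failure: $\mathrm{Fail}(\varepsilon)=\mathrm{Null}$ and for $1\le j\le|P_k|$, $\mathrm{Fail}(f(P_k)[:j])=f(P_k[i:j])$ where $i=\min\{l\mid l>1,\ f(P_k[l:j])\in\mathrm{Pref}(f(\mathcal{D}))\}$. Output: $\mathrm{Out}(f(P_k)[:j])=\{P\in\mathcal{D}\mid P\approx P_k[i:j]\text{ for some }1\le i\le j\}$. *)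

theory Defs
  imports Complex_Main "HOL-Library.Sublist"
begin

section \<open>Substring consistent equivalence relations and prefix encodings\<close>

text \<open>The substring \<open>X[i:j]\<close>, with 1-based inclusive positions; it is empty if \<open>j < i\<close>.
  The prefix \<open>X[:i]\<close> is \<open>take i X\<close>.\<close>

definition substr :: "'a list \<Rightarrow> nat \<Rightarrow> nat \<Rightarrow> 'a list" where
  "substr X i j = drop (i - 1) (take j X)"

definition scer :: "'a set \<Rightarrow> ('a list \<times> 'a list) set \<Rightarrow> bool" where
  "scer \<Sigma> r \<longleftrightarrow> equiv (lists \<Sigma>) r \<and>
     (\<forall>X Y. (X, Y) \<in> r \<longrightarrow> length X = length Y \<and>
        (\<forall>i j. 1 \<le> i \<and> i \<le> j \<and> j \<le> length X \<longrightarrow> (substr X i j, substr Y i j) \<in> r))"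

definition prefix_encoding ::
  "'a set \<Rightarrow> 'b set \<Rightarrow> ('a list \<times> 'a list) set \<Rightarrow> ('a list \<Rightarrow> 'b list) \<Rightarrow> bool" where
  "prefix_encoding \<Sigma> \<Pi> r f \<longleftrightarrow>
     (\<forall>X \<in> lists \<Sigma>. f X \<in> lists \<Pi> \<and> length (f X) = length X \<and>
        (\<forall>i \<le> length X. f (take i X) = take i (f X))) \<and>
     (\<forall>X \<in> lists \<Sigma>. \<forall>Y \<in> lists \<Sigma>. f X = f Y \<longleftrightarrow> (X, Y) \<in> r)"

definition dictionary :: "'a set \<Rightarrow> 'a list list \<Rightarrow> bool" where
  "dictionary \<Sigma> D \<longleftrightarrow> D \<noteq> [] \<and> distinct D \<and> set D \<subseteq> lists \<Sigma> - {[]}"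

definition total_length :: "'a list list \<Rightarrow> nat" where
  "total_length D = (\<Sum>P\<leftarrow>D. length P)"

definition max_length :: "'a list list \<Rightarrow> nat" where
  "max_length D = Max (length ` set D)"


section \<open>The automaton\<close>

definition Pref :: "('a list \<Rightarrow> 'b list) \<Rightarrow> 'a list list \<Rightarrow> 'b list set" where
  "Pref f D = {S. \<exists>P \<in> set D. prefix S (f P)}"

text \<open>\<open>None\<close> plays the role of Null.\<close>

definition goto :: "('a list \<Rightarrow> 'b list) \<Rightarrow> 'a list list \<Rightarrow> 'b list \<Rightarrow> 'b \<Rightarrow> 'b list option" where
  "goto f D S c = (if S @ [c] \<in> Pref f D then Some (S @ [c]) else None)"

definition max_out_degree :: "('a list \<Rightarrow> 'b list) \<Rightarrow> 'a list list \<Rightarrow> nat" where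
  "max_out_degree f D = Max ((\<lambda>S. card {c. goto f D S c \<noteq> None}) ` Pref f D)"

text \<open>\<open>Fail\<close> and \<open>Out\<close> are given on a state \<open>S\<close> through a representation \<open>S = f(P)[:j]\<close>. The
  value does not depend on the choice of \<open>P\<close> (see \<open>Fail_take\<close>, \<open>Out_take\<close> below), so that the
  definite descriptions are meaningful.\<close>

definition fail_pos :: "('a list \<Rightarrow> 'b list) \<Rightarrow> 'a list list \<Rightarrow> 'a list \<Rightarrow> nat \<Rightarrow> nat" where
  "fail_pos f D P j = (LEAST l. l > 1 \<and> f (substr P l j) \<in> Pref f D)"

definition Fail :: "('a list \<Rightarrow> 'b list) \<Rightarrow> 'a list list \<Rightarrow> 'b list \<Rightarrow> 'b list option" where
  "Fail f D S =
     (if S = [] then None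
      else Some (THE T. \<exists>P \<in> set D. \<exists>j. 1 \<le> j \<and> j \<le> length P \<and> S = take j (f P) \<and>
                   T = f (substr P (fail_pos f D P j) j)))"

definition out_patterns ::
  "('a list \<times> 'a list) set \<Rightarrow> 'a list list \<Rightarrow> 'a list \<Rightarrow> nat \<Rightarrow> 'a list set" where
  "out_patterns r D P j = {Q \<in> set D. \<exists>i. 1 \<le> i \<and> i \<le> j \<and> (Q, substr P i j) \<in> r}"

definition Out :: "('a list \<times> 'a list) set \<Rightarrow> ('a list \<Rightarrow> 'b list) \<Rightarrow> 'a list list \<Rightarrow> 'b list
    \<Rightarrow> 'a list set" where
  "Out r f D S = (THE A. \<exists>P \<in> set D. \<exists>j \<le> length P. S = take j (f P) \<and> A = out_patterns r D P j)"

lemma substr_in_lists: "X \<in> lists \<Sigma> \<Longrightarrow> substr X i j \<in> lists \<Sigma>"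
  unfolding substr_def in_lists_conv_set by (meson in_set_dropD in_set_takeD)

lemma substr_take: "j \<le> n \<Longrightarrow> substr (take n X) i j = substr X i j"
  by (simp add: substr_def min_def)

lemma same_state_substr:
  assumes r: "scer \<Sigma> r" and f: "prefix_encoding \<Sigma> \<Pi> r f" and D: "dictionary \<Sigma> D"
    and P: "P \<in> set D" "j \<le> length P" and Q: "Q \<in> set D" "j' \<le> length Q"
    and eq: "take j (f P) = take j' (f Q)"
  shows "j' = j" and "1 \<le> i \<Longrightarrow> (substr P i j, substr Q i j) \<in> r"
proof -
  have PQ: "P \<in> lists \<Sigma>" "Q \<in> lists \<Sigma>"
    using D P Q by (auto simp: dictionary_def)
  have len: "length (f P) = length P" "length (f Q) = length Q"
    using f PQ by (auto simp: prefix_encoding_def)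
  show j: "j' = j"
    using arg_cong[OF eq, of length] len P Q by simp
  have tk: "take j P \<in> lists \<Sigma>" "take j Q \<in> lists \<Sigma>"
    using PQ by (auto dest: in_set_takeD)
  have "f (take j P) = f (take j Q)"
    using f PQ P Q eq j by (simp add: prefix_encoding_def)
  then have rel: "(take j P, take j Q) \<in> r"
    using f tk by (simp add: prefix_encoding_def)
  show "(substr P i j, substr Q i j) \<in> r" if "1 \<le> i"
  proof (cases "i \<le> j")
    case True
    then have "(substr (take j P) i j, substr (take j Q) i j) \<in> r"
      using r rel that P unfolding scer_def by (metis length_take min.absorb2 order_refl)
    then show ?thesis by (simp add: substr_take)
  next
    case False
    then have "substr P i j = []" "substr Q i j = []"
      by (auto simp: substr_def)
    moreover have "([], []) \<in> r"
      using r by (auto simp: scer_def equiv_def refl_on_def)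
    ultimately show ?thesis by simp
  qed
qed

lemma fail_pos:
  assumes f: "prefix_encoding \<Sigma> \<Pi> r f" and D: "dictionary \<Sigma> D"
    and P: "P \<in> set D" "1 \<le> j" "j \<le> length P"
  shows "1 < fail_pos f D P j" and "f (substr P (fail_pos f D P j) j) \<in> Pref f D"
    and "fail_pos f D P j \<le> j + 1"
proof -
  have "f [] = []"
    using f unfolding prefix_encoding_def by (metis length_0_conv lists.Nil)
  then have ex: "j + 1 > 1 \<and> f (substr P (j + 1) j) \<in> Pref f D"
    using P by (auto simp: substr_def Pref_def)
  show "1 < fail_pos f D P j" "f (substr P (fail_pos f D P j) j) \<in> Pref f D"
    using LeastI[of "\<lambda>l. l > 1 \<and> f (substr P l j) \<in> Pref f D", OF ex]
    by (auto simp: fail_pos_def)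
  show "fail_pos f D P j \<le> j + 1"
    unfolding fail_pos_def by (rule Least_le) (rule ex)
qed

lemma Fail_take:
  assumes r: "scer \<Sigma> r" and f: "prefix_encoding \<Sigma> \<Pi> r f" and D: "dictionary \<Sigma> D"
    and P: "P \<in> set D" "1 \<le> j" "j \<le> length P"
  shows "Fail f D (take j (f P)) = Some (f (substr P (fail_pos f D P j) j))"
proof -
  have indep: "f (substr Q l j') = f (substr P l j)"
    if Q: "Q \<in> set D" "j' \<le> length Q" "take j (f P) = take j' (f Q)" "1 \<le> l" for Q j' l
  proof -
    have lists: "substr P l j \<in> lists \<Sigma>" "substr Q l j \<in> lists \<Sigma>"
      using D P Q by (auto intro!: substr_in_lists simp: dictionary_def)
    have "j' = j" "(substr P l j, substr Q l j) \<in> r"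
      using same_state_substr[OF r f D P(1) P(3) Q(1-3)] Q(4) by auto
    then have "f (substr P l j) = f (substr Q l j)"
      using f lists by (simp add: prefix_encoding_def)
    with \<open>j' = j\<close> show ?thesis by simp
  qed
  have pos: "fail_pos f D Q j' = fail_pos f D P j"
    if Q: "Q \<in> set D" "j' \<le> length Q" "take j (f P) = take j' (f Q)" for Q j'
  proof -
    have "(\<lambda>l. l > 1 \<and> f (substr Q l j') \<in> Pref f D) = (\<lambda>l. l > 1 \<and> f (substr P l j) \<in> Pref f D)"
      using indep[OF Q] by auto
    then show ?thesis by (simp add: fail_pos_def)
  qed
  have "take j (f P) \<noteq> []"
  proof -
    have "P \<in> lists \<Sigma>" using D P by (auto simp: dictionary_def)
    then have "length (f P) = length P" using f by (simp add: prefix_encoding_def)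
    then show ?thesis using P by auto
  qed
  moreover have "(THE T. \<exists>Q \<in> set D. \<exists>j'. 1 \<le> j' \<and> j' \<le> length Q \<and> take j (f P) = take j' (f Q) \<and>
      T = f (substr Q (fail_pos f D Q j') j')) = f (substr P (fail_pos f D P j) j)"
  proof (rule the_equality)
    show "\<exists>Q \<in> set D. \<exists>j'. 1 \<le> j' \<and> j' \<le> length Q \<and> take j (f P) = take j' (f Q) \<and>
        f (substr P (fail_pos f D P j) j) = f (substr Q (fail_pos f D Q j') j')"
      using P by blast
  next
    fix T
    assume "\<exists>Q \<in> set D. \<exists>j'. 1 \<le> j' \<and> j' \<le> length Q \<and> take j (f P) = take j' (f Q) \<and>
        T = f (substr Q (fail_pos f D Q j') j')"
    then show "T = f (substr P (fail_pos f D P j) j)"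
      using indep pos fail_pos(1)[OF f D P] by (metis less_imp_le)
  qed
  ultimately show ?thesis by (simp add: Fail_def)
qed

lemma Out_take:
  assumes r: "scer \<Sigma> r" and f: "prefix_encoding \<Sigma> \<Pi> r f" and D: "dictionary \<Sigma> D"
    and P: "P \<in> set D" "j \<le> length P"
  shows "Out r f D (take j (f P)) = out_patterns r D P j"
  unfolding Out_def
proof (rule the_equality)
  show "\<exists>Q \<in> set D. \<exists>j' \<le> length Q. take j (f P) = take j' (f Q) \<and>
      out_patterns r D P j = out_patterns r D Q j'"
    using P by blast
next
  fix A
  assume "\<exists>Q \<in> set D. \<exists>j' \<le> length Q. take j (f P) = take j' (f Q) \<and> A = out_patterns r D Q j'"
  then obtain Q j' where Q: "Q \<in> set D" "j' \<le> length Q" "take j (f P) = take j' (f Q)"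
    and A: "A = out_patterns r D Q j'" by blast
  have eqv: "sym r" "trans r"
    using r by (auto simp: scer_def equiv_def)
  have j: "j' = j" and rel: "\<And>i. 1 \<le> i \<Longrightarrow> (substr P i j, substr Q i j) \<in> r"
    using same_state_substr[OF r f D P Q] by auto
  have "(R, substr Q i j) \<in> r \<longleftrightarrow> (R, substr P i j) \<in> r" if "1 \<le> i" for R i
    using rel[OF that] eqv by (meson symD transD)
  then show "A = out_patterns r D P j"
    unfolding A j out_patterns_def by blast
qed


section \<open>Word RAM\<close>

text \<open>Structured programs over a word RAM: finitely many registers are used by a program, and the
  memory is addressed by words. A word is a signed integer of \<open>w + 1\<close> bits. An operation whose
  result is not a word has no value, and then the program has no execution: programs must never
  overflow. Each operation takes one step.

  The encoding is accessed through two black boxes. \<open>Encode a n b\<close> computes \<open>f(X)\<close> for the string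
  \<open>X\<close> of length \<open>n\<close> stored from address \<open>a\<close> on, stores it from address \<open>b\<close> on, and charges
  \<open>E n\<close>. From then on \<open>X\<close> is known under the number of previous calls of \<open>Encode\<close>.
  \<open>Reencode x h i j\<close>, for \<open>X\<close> known under the number \<open>h\<close>, computes the last symbol of
  \<open>f(X[i:j])\<close> and charges \<open>R (j - i + 1)\<close>. A reencoding is thus only available once \<open>f(X)\<close> has
  been computed.\<close>

definition words :: "nat \<Rightarrow> int set" where
  "words w = {- (2 ^ w) ..< 2 ^ w}"

record state =
  reg :: "nat \<Rightarrow> int"
  mem :: "int \<Rightarrow> int"
  encoded :: "int list list"

datatype binop = Add | Sub | Mul | Div | Mod | And | Or | Xor | Shl | Shr

fun binop_val :: "binop \<Rightarrow> int \<Rightarrow> int \<Rightarrow> int" where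
  "binop_val Add x y = x + y"
| "binop_val Sub x y = x - y"
| "binop_val Mul x y = x * y"
| "binop_val Div x y = x div y"
| "binop_val Mod x y = x mod y"
| "binop_val And x y = and x y"
| "binop_val Or x y = or x y"
| "binop_val Xor x y = xor x y"
| "binop_val Shl x y = push_bit (nat y) x"
| "binop_val Shr x y = drop_bit (nat y) x"

datatype aexp = Const int | Reg nat | Load aexp | Bin binop aexp aexp

fun aval :: "nat \<Rightarrow> state \<Rightarrow> aexp \<Rightarrow> int option" where
  "aval w s (Const n) = (if n \<in> words w then Some n else None)"
| "aval w s (Reg x) = Some (reg s x)"
| "aval w s (Load a) = map_option (mem s) (aval w s a)"
| "aval w s (Bin p a b) =
     (case (aval w s a, aval w s b) of
        (Some x, Some y) \<Rightarrow> if binop_val p x y \<in> words w then Some (binop_val p x y) else None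
      | _ \<Rightarrow> None)"

fun acost :: "aexp \<Rightarrow> nat" where
  "acost (Const n) = 1"
| "acost (Reg x) = 1"
| "acost (Load a) = 1 + acost a"
| "acost (Bin p a b) = 1 + acost a + acost b"

datatype bexp = Eq aexp aexp | Less aexp aexp | Neg bexp | Conj bexp bexp

fun bval :: "nat \<Rightarrow> state \<Rightarrow> bexp \<Rightarrow> bool option" where
  "bval w s (Eq a b) =
     (case (aval w s a, aval w s b) of (Some x, Some y) \<Rightarrow> Some (x = y) | _ \<Rightarrow> None)"
| "bval w s (Less a b) =
     (case (aval w s a, aval w s b) of (Some x, Some y) \<Rightarrow> Some (x < y) | _ \<Rightarrow> None)"
| "bval w s (Neg b) = map_option Not (bval w s b)"
| "bval w s (Conj b c) =
     (case (bval w s b, bval w s c) of (Some x, Some y) \<Rightarrow> Some (x \<and> y) | _ \<Rightarrow> None)"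

fun bcost :: "bexp \<Rightarrow> nat" where
  "bcost (Eq a b) = 1 + acost a + acost b"
| "bcost (Less a b) = 1 + acost a + acost b"
| "bcost (Neg b) = 1 + bcost b"
| "bcost (Conj b c) = 1 + bcost b + bcost c"

datatype com =
    Skip
  | Assign nat aexp
  | Store aexp aexp
  | Encode aexp aexp aexp
  | Reencode nat aexp aexp aexp
  | Seq com com
  | If bexp com com
  | While bexp com

definition read_string :: "(int \<Rightarrow> int) \<Rightarrow> int \<Rightarrow> int \<Rightarrow> int list" where
  "read_string M a n = map M [a..a + n - 1]"

definition write_string :: "(int \<Rightarrow> int) \<Rightarrow> int \<Rightarrow> int list \<Rightarrow> int \<Rightarrow> int" where
  "write_string M b Y = (\<lambda>x. if b \<le> x \<and> x < b + int (length Y) then Y ! nat (x - b) else M x)"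

text \<open>\<open>exec w \<Sigma> f E R c s t s'\<close>: started in \<open>s\<close>, the program \<open>c\<close> halts in \<open>s'\<close> after \<open>t\<close> steps.\<close>

inductive exec :: "nat \<Rightarrow> int set \<Rightarrow> (int list \<Rightarrow> int list) \<Rightarrow> (nat \<Rightarrow> nat) \<Rightarrow> (nat \<Rightarrow> nat) \<Rightarrow>
    com \<Rightarrow> state \<Rightarrow> nat \<Rightarrow> state \<Rightarrow> bool"
  for w \<Sigma> f E R where
  Skip: "exec w \<Sigma> f E R Skip s 1 s"
| Assign: "aval w s a = Some v \<Longrightarrow>
    exec w \<Sigma> f E R (Assign x a) s (1 + acost a) (s\<lparr>reg := (reg s)(x := v)\<rparr>)"
| Store: "aval w s a = Some p \<Longrightarrow> aval w s e = Some v \<Longrightarrow>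
    exec w \<Sigma> f E R (Store a e) s (1 + acost a + acost e) (s\<lparr>mem := (mem s)(p := v)\<rparr>)"
| Encode: "aval w s a = Some p \<Longrightarrow> aval w s n = Some k \<Longrightarrow> aval w s b = Some q \<Longrightarrow>
    0 \<le> k \<Longrightarrow> {p..<p + k} \<subseteq> words w \<Longrightarrow> {q..<q + k} \<subseteq> words w \<Longrightarrow>
    X = read_string (mem s) p k \<Longrightarrow> X \<in> lists \<Sigma> \<Longrightarrow> set (f X) \<subseteq> words w \<Longrightarrow>
    exec w \<Sigma> f E R (Encode a n b) s (1 + acost a + acost n + acost b + E (nat k))
      (s\<lparr>mem := write_string (mem s) q (f X), encoded := encoded s @ [X]\<rparr>)"
| Reencode: "aval w s h = Some k \<Longrightarrow> aval w s a = Some i \<Longrightarrow> aval w s b = Some j \<Longrightarrow>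
    0 \<le> k \<Longrightarrow> k < int (length (encoded s)) \<Longrightarrow> X = encoded s ! nat k \<Longrightarrow>
    1 \<le> i \<Longrightarrow> i \<le> j \<Longrightarrow> j \<le> int (length X) \<Longrightarrow>
    v = last (f (substr X (nat i) (nat j))) \<Longrightarrow> v \<in> words w \<Longrightarrow>
    exec w \<Sigma> f E R (Reencode x h a b) s
      (1 + acost h + acost a + acost b + R (nat (j - i + 1))) (s\<lparr>reg := (reg s)(x := v)\<rparr>)"
| Seq: "exec w \<Sigma> f E R c1 s t1 s1 \<Longrightarrow> exec w \<Sigma> f E R c2 s1 t2 s2 \<Longrightarrow>
    exec w \<Sigma> f E R (Seq c1 c2) s (t1 + t2) s2"
| IfTrue: "bval w s b = Some True \<Longrightarrow> exec w \<Sigma> f E R c1 s t s' \<Longrightarrow>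
    exec w \<Sigma> f E R (If b c1 c2) s (1 + bcost b + t) s'"
| IfFalse: "bval w s b = Some False \<Longrightarrow> exec w \<Sigma> f E R c2 s t s' \<Longrightarrow>
    exec w \<Sigma> f E R (If b c1 c2) s (1 + bcost b + t) s'"
| WhileFalse: "bval w s b = Some False \<Longrightarrow> exec w \<Sigma> f E R (While b c) s (1 + bcost b) s"
| WhileTrue: "bval w s b = Some True \<Longrightarrow> exec w \<Sigma> f E R c s t1 s1 \<Longrightarrow>
    exec w \<Sigma> f E R (While b c) s1 t2 s2 \<Longrightarrow>
    exec w \<Sigma> f E R (While b c) s (1 + bcost b + t1 + t2) s2"

lemma exec_deterministic:
  "exec w \<Sigma> f E R c s t s' \<Longrightarrow> exec w \<Sigma> f E R c s u s'' \<Longrightarrow> u = t \<and> s'' = s'"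
proof (induction arbitrary: u s'' rule: exec.induct)
  case (Seq c1 s t1 s1 c2 t2 s2)
  from Seq.prems obtain u1 v1 u2 where "exec w \<Sigma> f E R c1 s u1 v1" "exec w \<Sigma> f E R c2 v1 u2 s''"
    "u = u1 + u2"
    by (cases rule: exec.cases) auto
  with Seq.IH show ?case by blast
next
  case (WhileTrue s b c t1 s1 t2 s2)
  from WhileTrue.prems WhileTrue.hyps obtain u1 v1 u2 where "exec w \<Sigma> f E R c s u1 v1"
    "exec w \<Sigma> f E R (While b c) v1 u2 s''" "u = 1 + bcost b + u1 + u2"
    by (cases rule: exec.cases) auto
  with WhileTrue.IH show ?case by blast
next
  case (IfTrue s b c1 t s' c2)
  from IfTrue.prems IfTrue.hyps obtain u1 where "exec w \<Sigma> f E R c1 s u1 s''" "u = 1 + bcost b + u1"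
    by (cases rule: exec.cases) auto
  with IfTrue.IH show ?case by blast
next
  case (IfFalse s b c2 t s' c1)
  from IfFalse.prems IfFalse.hyps obtain u1 where "exec w \<Sigma> f E R c2 s u1 s''" "u = 1 + bcost b + u1"
    by (cases rule: exec.cases) auto
  with IfFalse.IH show ?case by blast
qed (erule exec.cases; simp)+

text \<open>The dictionary is given in memory from address 0 on, as the number of patterns, followed by
  their lengths, followed by the patterns themselves. Everything else is zero.\<close>

definition input_words :: "int list list \<Rightarrow> int list" where
  "input_words D = int (length D) # map (\<lambda>P. int (length P)) D @ concat D"

definition init :: "int list list \<Rightarrow> state" where
  "init D = \<lparr>reg = (\<lambda>_. 0), mem = write_string (\<lambda>_. 0) 0 (input_words D), encoded = []\<rparr>"


section \<open>Data structures for the automaton\<close>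

text \<open>\<open>answers w \<Sigma> f E R q s args t v\<close>: on the data structure in the memory of \<open>s\<close>, and with
  arguments in registers \<open>0, 1, \<dots>\<close> (all other registers being cleared), the query program \<open>q\<close>
  returns \<open>v\<close> in register 0 after \<open>t\<close> steps. It leaves the data structure unchanged.\<close>

definition answers :: "nat \<Rightarrow> int set \<Rightarrow> (int list \<Rightarrow> int list) \<Rightarrow> (nat \<Rightarrow> nat) \<Rightarrow> (nat \<Rightarrow> nat) \<Rightarrow>
    com \<Rightarrow> state \<Rightarrow> int list \<Rightarrow> nat \<Rightarrow> int \<Rightarrow> bool" where
  "answers w \<Sigma> f E R q s args t v \<longleftrightarrow>
     (\<exists>\<rho>. exec w \<Sigma> f E R q (s\<lparr>reg := (\<lambda>x. if x < length args then args ! x else 0)\<rparr>) t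
            (s\<lparr>reg := \<rho>\<rparr>) \<and> \<rho> 0 = v)"

text \<open>A null-terminated linked list of pattern indices; cells may be shared between lists, as the
  total size of all output sets is in general not bounded by \<open>O(m)\<close>.\<close>

fun linked_list :: "(int \<Rightarrow> int) \<Rightarrow> int \<Rightarrow> nat list \<Rightarrow> bool" where
  "linked_list M p [] \<longleftrightarrow> p = -1"
| "linked_list M p (k # ks) \<longleftrightarrow> 0 \<le> p \<and> M p = int k \<and> linked_list M (M (p + 1)) ks"

text \<open>The states of the automaton are represented by nonnegative words \<open>\<nu> S\<close>, and Null by \<open>-1\<close>.\<close>

definition null_or :: "('b list \<Rightarrow> int) \<Rightarrow> 'b list option \<Rightarrow> int" where
  "null_or \<nu> T = (case T of None \<Rightarrow> -1 | Some S \<Rightarrow> \<nu> S)"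

text \<open>The state \<open>s\<close> holds the automaton, with the root in register 0: transitions are found in
  \<open>O(1 + log \<pi>)\<close> steps, failure links and the list of outputs in \<open>O(1)\<close> steps.\<close>

definition holds_SCERA :: "nat \<Rightarrow> int set \<Rightarrow> (int list \<Rightarrow> int list) \<Rightarrow> (nat \<Rightarrow> nat) \<Rightarrow> (nat \<Rightarrow> nat) \<Rightarrow>
    (int list \<times> int list) set \<Rightarrow> int list list \<Rightarrow> com \<Rightarrow> com \<Rightarrow> com \<Rightarrow> real \<Rightarrow> state \<Rightarrow> bool" where
  "holds_SCERA w \<Sigma> f E R r D goto_q fail_q out_q C s \<longleftrightarrow>
     (\<exists>\<nu>. inj_on \<nu> (Pref f D) \<and> \<nu> ` Pref f D \<subseteq> {0..} \<inter> words w \<and> reg s 0 = \<nu> [] \<and>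
       (\<forall>S \<in> Pref f D.
          (\<forall>c \<in> words w. \<exists>t. answers w \<Sigma> f E R goto_q s [\<nu> S, c] t (null_or \<nu> (goto f D S c)) \<and>
             real t \<le> C * (1 + log 2 (real (max_out_degree f D)))) \<and>
          (\<exists>t. answers w \<Sigma> f E R fail_q s [\<nu> S] t (null_or \<nu> (Fail f D S)) \<and> real t \<le> C) \<and>
          (\<exists>t p ks. answers w \<Sigma> f E R out_q s [\<nu> S] t p \<and> real t \<le> C \<and>
             linked_list (mem s) p ks \<and> distinct ks \<and> set ks \<subseteq> {..<length D} \<and>
             (\<lambda>k. D ! k) ` set ks = Out r f D S)))"

end

theory Submission
  imports Defs
begin

text \<open>
  The encoded patterns are inserted into the trie in breadth-first order: each node carries the list of
  the patterns through it and distributes it to its children, so that the lists have total length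
  \<open>O(m)\<close>. To find the right child, symbols are first renamed to numbers below \<open>O(m)\<close>, using the
  addresses that the input leaves free as a table with direct access; a second table then gives the last
  node created for a symbol. A scan over the renamed symbols sorts the children of all nodes at once, after
  which a transition is found by binary search in \<open>O(1 + log \<pi>)\<close> steps.

  Failure links are computed in breadth-first order as in the algorithm of Aho and Corasick, except that
  the last symbol has to be encoded anew for each candidate on the failure chain of the parent. Along one
  pattern the length of the failure link grows by at most 1 per position and decreases with each rejected
  candidate, so that \<open>O(m)\<close> candidates are tried in all. The outputs of a state are the patterns ending in
  it, followed by the list of its failure link.
\<close>

section \<open>Structured programs on interleaved arrays\<close>

text \<open>What makes the failure recursion work for encodings is that the prefix law turns
  \<open>f (P[l:j])\<close> into \<open>f (P[l:j-1])\<close> plus one symbol, so a start position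
  that is no state at \<open>j - 1\<close> cannot become one at \<open>j\<close>. The obstacle is
  sharing: a chain is stored for states, and a state may be a prefix of the encodings of several
  patterns. Substring consistency resolves this, as equivalent prefixes have equivalent suffixes and
  every chain can be read as start positions in the one pattern being followed. Sharing also affects
  the amortisation. A state common to several patterns is processed once, so the work is summed over
  states, whereas telescoping happens along patterns; nonnegativity of each summand allows the sum
  over states to be bounded by the sum over all pattern positions. As log \<pi> may vanish, the
  terms linear in \<open>m\<close> are absorbed by \<open>0 < R (max_length D)\<close>. The constant
  1024 leaves room above the input for 32 arrays with indices up to
  \<open>4 * m + 8\<close>.\<close>

text \<open>Cell \<open>i\<close> of array \<open>j < 32\<close> lives at address \<open>B + 32 * i + j\<close>, where \<open>B\<close> is the end of the
  input and is kept in register 9. The addresses below \<open>B\<close>, including the negative ones, are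
  accessed directly.\<close>

datatype exp = Num int | Var nat | Fld nat exp | Low exp | Op binop exp exp

datatype bexpr = EqE exp exp | LtE exp exp | NotE bexpr

datatype cmd =
    Nop
  | Asg nat exp (infix \<open>::=\<close> 61)
  | SetF nat exp exp
  | SetL exp exp
  | Enc exp exp
  | Ree nat exp exp exp
  | Sq cmd cmd (infixr \<open>;;\<close> 60)
  | Ite bexpr cmd cmd
  | Wh bexpr cmd

abbreviation plus_exp :: "exp \<Rightarrow> exp \<Rightarrow> exp" (infixl \<open>.+\<close> 65) where
  "x .+ y \<equiv> Op Add x y"

abbreviation minus_exp :: "exp \<Rightarrow> exp \<Rightarrow> exp" (infixl \<open>.-\<close> 65) where
  "x .- y \<equiv> Op Sub x y"

record astate =
  rg :: "nat \<Rightarrow> int"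
  lo :: "int \<Rightarrow> int"
  fl :: "nat \<Rightarrow> int \<Rightarrow> int"
  en :: "int list list"

text \<open>With one field per array, writes to different arrays commute by the shape of the record
  alone. Residue and quotient modulo 32 recover array and index from an address. Parts of an
  \<open>astate\<close> without an address (\<open>lo\<close> from \<open>B\<close> on,
  \<open>fl\<close> at negative indices or for arrays from 32 on) have no image.\<close>

definition conc :: "int \<Rightarrow> astate \<Rightarrow> state" where
  "conc B a = \<lparr>reg = rg a,
     mem = (\<lambda>x. if x < B then lo a x else fl a (nat ((x - B) mod 32)) ((x - B) div 32)),
     encoded = en a\<rparr>"

abbreviation adr :: "nat \<Rightarrow> aexp \<Rightarrow> aexp" where
  "adr j e \<equiv> Bin Add (Reg 9) (Bin Add (Bin Mul (Const 32) e) (Const (int j)))"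

primrec cexp :: "exp \<Rightarrow> aexp" where
  "cexp (Num n) = Const n"
| "cexp (Var x) = Reg x"
| "cexp (Fld j e) = Load (adr j (cexp e))"
| "cexp (Low e) = Load (cexp e)"
| "cexp (Op p x y) = Bin p (cexp x) (cexp y)"

primrec cbexp :: "bexpr \<Rightarrow> bexp" where
  "cbexp (EqE x y) = Eq (cexp x) (cexp y)"
| "cbexp (LtE x y) = Less (cexp x) (cexp y)"
| "cbexp (NotE b) = Neg (cbexp b)"

primrec compile :: "cmd \<Rightarrow> com" where
  "compile Nop = Skip"
| "compile (Asg x e) = Assign x (cexp e)"
| "compile (SetF j i e) = Store (adr j (cexp i)) (cexp e)"
| "compile (SetL i e) = Store (cexp i) (cexp e)"
| "compile (Enc p n) = Encode (cexp p) (cexp n) (cexp p)"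
| "compile (Ree x h i j) = Reencode x (cexp h) (cexp i) (cexp j)"
| "compile (Sq c1 c2) = Seq (compile c1) (compile c2)"
| "compile (Ite b c1 c2) = If (cbexp b) (compile c1) (compile c2)"
| "compile (Wh b c) = While (cbexp b) (compile c)"

primrec ev :: "astate \<Rightarrow> exp \<Rightarrow> int" where
  "ev a (Num n) = n"
| "ev a (Var x) = rg a x"
| "ev a (Fld j e) = fl a j (ev a e)"
| "ev a (Low e) = lo a (ev a e)"
| "ev a (Op p x y) = binop_val p (ev a x) (ev a y)"

primrec evb :: "astate \<Rightarrow> bexpr \<Rightarrow> bool" where
  "evb a (EqE x y) = (ev a x = ev a y)"
| "evb a (LtE x y) = (ev a x < ev a y)"
| "evb a (NotE b) = (\<not> evb a b)"

text \<open>Integers are used because the time bounds of the loops contain differences. The 7 of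
  \<open>Fld\<close> is six steps for the address and one for the load.\<close>

primrec cost :: "exp \<Rightarrow> int" where
  "cost (Num n) = 1"
| "cost (Var x) = 1"
| "cost (Fld j e) = 7 + cost e"
| "cost (Low e) = 1 + cost e"
| "cost (Op p x y) = 1 + cost x + cost y"

primrec costb :: "bexpr \<Rightarrow> int" where
  "costb (EqE x y) = 1 + cost x + cost y"
| "costb (LtE x y) = 1 + cost x + cost y"
| "costb (NotE b) = 1 + costb b"

lemma acost_cexp [simp]: "int (acost (cexp e)) = cost e"
  by (induction e) auto

lemma bcost_cbexp [simp]: "int (bcost (cbexp b)) = costb b"
  by (induction b) auto

section \<open>Verification conditions with an explicit step counter\<close>

locale machine =
  fixes w :: nat and \<Sigma> :: "int set" and f :: "int list \<Rightarrow> int list" and E R :: "nat \<Rightarrow> nat"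
    and B M :: int
  assumes B_nonneg: "0 \<le> B" and M_pos: "1 \<le> M" and mem_bound: "B + 32 * M + 32 \<le> 2 ^ w"
begin

text \<open>The conditions under which a compiled expression has the value \<open>ev\<close>: no
  overflow, and each access on the side of \<open>B\<close> that \<open>conc\<close> maps to the
  intended component. \<open>M\<close> is the largest admissible array index.\<close>

primrec ok :: "astate \<Rightarrow> exp \<Rightarrow> bool" where
  "ok a (Num n) = (n \<in> words w)"
| "ok a (Var x) = True"
| "ok a (Fld j e) = (ok a e \<and> rg a 9 = B \<and> 0 \<le> ev a e \<and> ev a e \<le> M \<and> j < 32)"
| "ok a (Low e) = (ok a e \<and> ev a e < B)"
| "ok a (Op p x y) = (ok a x \<and> ok a y \<and> binop_val p (ev a x) (ev a y) \<in> words w)"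

primrec okb :: "astate \<Rightarrow> bexpr \<Rightarrow> bool" where
  "okb a (EqE x y) = (ok a x \<and> ok a y)"
| "okb a (LtE x y) = (ok a x \<and> ok a y)"
| "okb a (NotE b) = okb a b"

lemma wordsI: "- (2 ^ w) \<le> x \<Longrightarrow> x < 2 ^ w \<Longrightarrow> x \<in> words w"
  by (simp add: words_def)

lemma small_word: "-1 \<le> x \<Longrightarrow> x < B + 32 * M + 32 \<Longrightarrow> x \<in> words w"
  using mem_bound B_nonneg M_pos by (intro wordsI) auto

lemma aval_adr:
  assumes "rg a 9 = B" "aval w (conc B a) x = Some i" "0 \<le> i" "i \<le> M" "j < 32"
  shows "aval w (conc B a) (adr j x) = Some (B + (32 * i + int j))"
proof -
  have "32 \<in> words w" "32 * i \<in> words w" "int j \<in> words w" "32 * i + int j \<in> words w"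
    "B + (32 * i + int j) \<in> words w"
    using assms B_nonneg M_pos by (auto intro!: small_word)
  then show ?thesis using assms by (simp add: conc_def)
qed

lemma mem_conc_fld: "0 \<le> i \<Longrightarrow> j < 32 \<Longrightarrow> mem (conc B a) (B + (32 * i + int j)) = fl a j i"
  by (simp add: conc_def)

lemma aval_cexp: "ok a e \<Longrightarrow> aval w (conc B a) (cexp e) = Some (ev a e)"
proof (induction e)
  case (Fld j e)
  then have "aval w (conc B a) (adr j (cexp e)) = Some (B + (32 * ev a e + int j))"
    by (intro aval_adr) auto
  with Fld show ?case by (simp add: mem_conc_fld del: aval.simps(4))
qed (auto simp: conc_def)

lemma bval_cbexp: "okb a b \<Longrightarrow> bval w (conc B a) (cbexp b) = Some (evb a b)"
  by (induction b) (auto simp: aval_cexp)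

text \<open>The argument \<open>t\<close> is the time spent so far and is handed on to the
  postcondition, so loop invariants bound absolute times and no costs have to be composed. Only
  halting runs are in \<open>exec\<close>, hence correctness is total.\<close>

definition wp :: "cmd \<Rightarrow> (astate \<Rightarrow> int \<Rightarrow> bool) \<Rightarrow> astate \<Rightarrow> int \<Rightarrow> bool" where
  "wp c Q a t \<longleftrightarrow> (\<exists>t' a'. exec w \<Sigma> f E R (compile c) (conc B a) t' (conc B a') \<and> Q a' (t + int t'))"

lemma wpI: "exec w \<Sigma> f E R (compile c) (conc B a) t' s' \<Longrightarrow> s' = conc B a' \<Longrightarrow> Q a' (t + int t') \<Longrightarrow> wp c Q a t"
  unfolding wp_def by blast

lemma wp_mono: "wp c P a t \<Longrightarrow> (\<And>a t. P a t \<Longrightarrow> Q a t) \<Longrightarrow> wp c Q a t"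
  unfolding wp_def by blast

text \<open>The index of \<open>I\<close> is the variant. Loops are the only commands for which
  \<open>vc\<close> is not syntactic, so every loop below is an application of this rule.\<close>

lemma wp_while:
  assumes "I (n :: nat) a t"
    and okb: "\<And>n a t. I n a t \<Longrightarrow> okb a b"
    and step: "\<And>n a t. I n a t \<Longrightarrow> evb a b \<Longrightarrow>
      wp c (\<lambda>a' t'. \<exists>n' < n. I n' a' t') a (t + (1 + costb b))"
    and exit: "\<And>n a t. I n a t \<Longrightarrow> \<not> evb a b \<Longrightarrow> Q a (t + (1 + costb b))"
  shows "wp (Wh b c) Q a t"
  using assms(1)
proof (induction n arbitrary: a t rule: less_induct)
  case (less n)
  note b = bval_cbexp[OF okb[OF less.prems]]
  show ?case
  proof (cases "evb a b")
    case True
    from step[OF less.prems True] obtain t1 a1 n' where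
      1: "exec w \<Sigma> f E R (compile c) (conc B a) t1 (conc B a1)" "n' < n"
         "I n' a1 (t + (1 + costb b) + int t1)"
      unfolding wp_def by blast
    from less.IH[OF 1(2,3)] obtain t2 a2 where
      2: "exec w \<Sigma> f E R (compile (Wh b c)) (conc B a1) t2 (conc B a2)"
         "Q a2 (t + (1 + costb b) + int t1 + int t2)"
      unfolding wp_def by blast
    have "exec w \<Sigma> f E R (compile (Wh b c)) (conc B a) (1 + bcost (cbexp b) + t1 + t2) (conc B a2)"
      using exec.WhileTrue[OF _ 1(1) 2(1)[unfolded compile.simps]] b True by simp
    then show ?thesis using 2(2) by (intro wpI) (auto simp: algebra_simps)
  next
    case False
    then have "exec w \<Sigma> f E R (compile (Wh b c)) (conc B a) (1 + bcost (cbexp b)) (conc B a)"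
      using exec.WhileFalse[of w "conc B a" "cbexp b"] b by simp
    then show ?thesis using exit[OF less.prems False] by (intro wpI) auto
  qed
qed

lemma wp_seq: "wp c1 (wp c2 Q) a t \<Longrightarrow> wp (c1 ;; c2) Q a t"
proof -
  assume "wp c1 (wp c2 Q) a t"
  then obtain t1 a1 t2 a2 where
    "exec w \<Sigma> f E R (compile c1) (conc B a) t1 (conc B a1)"
    "exec w \<Sigma> f E R (compile c2) (conc B a1) t2 (conc B a2)" "Q a2 (t + int t1 + int t2)"
    unfolding wp_def by blast
  then show ?thesis
    by (intro wpI[OF _ refl, where a' = a2 and t' = "t1 + t2"]) (auto intro: exec.Seq simp: add.assoc)
qed

text \<open>The weakest precondition is computed up to the first loop.\<close>

primrec vc :: "cmd \<Rightarrow> (astate \<Rightarrow> int \<Rightarrow> bool) \<Rightarrow> astate \<Rightarrow> int \<Rightarrow> bool" where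
  "vc Nop Q a t = Q a (t + 1)"
| "vc (Asg x e) Q a t = (ok a e \<and> Q (a\<lparr>rg := (rg a)(x := ev a e)\<rparr>) (t + (1 + cost e)))"
| "vc (SetF j i e) Q a t =
     (rg a 9 = B \<and> ok a i \<and> 0 \<le> ev a i \<and> ev a i \<le> M \<and> j < 32 \<and> ok a e \<and>
      Q (a\<lparr>fl := (fl a)(j := (fl a j)(ev a i := ev a e))\<rparr>) (t + (7 + cost i + cost e)))"
| "vc (SetL i e) Q a t =
     (ok a i \<and> ev a i < B \<and> ok a e \<and>
      Q (a\<lparr>lo := (lo a)(ev a i := ev a e)\<rparr>) (t + (1 + cost i + cost e)))"
| "vc (Enc p n) Q a t =
     (ok a p \<and> ok a n \<and> 0 \<le> ev a n \<and> 0 \<le> ev a p \<and> ev a p + ev a n \<le> B \<and>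
      (let X = read_string (lo a) (ev a p) (ev a n) in
        X \<in> lists \<Sigma> \<and> set (f X) \<subseteq> words w \<and> length (f X) = nat (ev a n) \<and>
        Q (a\<lparr>lo := write_string (lo a) (ev a p) (f X), en := en a @ [X]\<rparr>)
          (t + (1 + cost p + cost n + cost p + int (E (nat (ev a n)))))))"
| "vc (Ree x h i j) Q a t =
     (ok a h \<and> ok a i \<and> ok a j \<and> 0 \<le> ev a h \<and> ev a h < int (length (en a)) \<and>
      1 \<le> ev a i \<and> ev a i \<le> ev a j \<and>
      (let X = en a ! nat (ev a h); v = last (f (substr X (nat (ev a i)) (nat (ev a j)))) in
        ev a j \<le> int (length X) \<and> v \<in> words w \<and>
        Q (a\<lparr>rg := (rg a)(x := v)\<rparr>)
          (t + (1 + cost h + cost i + cost j + int (R (nat (ev a j - ev a i + 1)))))))"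
| "vc (Sq c1 c2) Q a t = vc c1 (vc c2 Q) a t"
| "vc (Ite b c1 c2) Q a t =
     (okb a b \<and> (if evb a b then vc c1 Q a (t + (1 + costb b)) else vc c2 Q a (t + (1 + costb b))))"
| "vc (Wh b c) Q a t = wp (Wh b c) Q a t"

text \<open>Quotient and remainder modulo 32 are unique, so the written address belongs to exactly
  one cell of one array.\<close>

lemma conc_upd_fld:
  assumes "0 \<le> i" "j < 32"
  shows "(conc B a)\<lparr>mem := (mem (conc B a))(B + (32 * i + int j) := v)\<rparr> =
    conc B (a\<lparr>fl := (fl a)(j := (fl a j)(i := v))\<rparr>)"
proof -
  have "((mem (conc B a))(B + (32 * i + int j) := v)) x =
    mem (conc B (a\<lparr>fl := (fl a)(j := (fl a j)(i := v))\<rparr>)) x" for x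
  proof (cases "x < B")
    case True
    then show ?thesis using assms by (auto simp: conc_def)
  next
    case False
    define k l where "k = nat ((x - B) mod 32)" and "l = (x - B) div 32"
    have x: "x = B + (32 * l + int k)" "k < 32" unfolding k_def l_def by auto
    have l: "0 \<le> l" using False unfolding l_def by simp
    have eq: "32 * l + int k = 32 * i + int j \<longleftrightarrow> l = i \<and> k = j"
    proof
      assume "32 * l + int k = 32 * i + int j"
      then have "l = i" using x(2) assms(2) by linarith
      with \<open>32 * l + int k = 32 * i + int j\<close> show "l = i \<and> k = j" by simp
    qed auto
    show ?thesis
      unfolding x mem_conc_fld[OF l x(2)] fun_upd_apply using eq by auto
  qed
  then show ?thesis by (auto simp: conc_def)
qed

lemma vc_sound: "vc c Q a t \<Longrightarrow> wp c Q a t"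
proof (induction c arbitrary: Q a t)
  case Nop
  then show ?case by (intro wpI[OF _ refl]) (auto intro: exec.Skip)
next
  case (Asg x e)
  then have "aval w (conc B a) (cexp e) = Some (ev a e)"
    by (auto intro!: aval_cexp)
  note exec.Assign[OF this, of \<Sigma> f E R x, folded compile.simps(2)]
  from wpI[OF this, where a' = "a\<lparr>rg := (rg a)(x := ev a e)\<rparr>"] Asg show ?case
    by (auto simp: conc_def algebra_simps fun_eq_iff)
next
  case (SetF j i e)
  then have "aval w (conc B a) (adr j (cexp i)) = Some (B + (32 * ev a i + int j))"
    "aval w (conc B a) (cexp e) = Some (ev a e)"
    by (intro aval_adr aval_cexp; simp)+
  note exec.Store[OF this, of \<Sigma> f E R, folded compile.simps(3)]
  from wpI[OF this conc_upd_fld] SetF show ?case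
    by (auto simp: algebra_simps)
next
  case (SetL i e)
  then have "aval w (conc B a) (cexp i) = Some (ev a i)"
    "aval w (conc B a) (cexp e) = Some (ev a e)"
    by (auto intro!: aval_cexp)
  note exec.Store[OF this, of \<Sigma> f E R, folded compile.simps(4)]
  from wpI[OF this, where a' = "a\<lparr>lo := (lo a)(ev a i := ev a e)\<rparr>"] SetL show ?case
    by (auto simp: conc_def algebra_simps fun_eq_iff)
next
  case (Enc p n)
  define X where "X = read_string (lo a) (ev a p) (ev a n)"
  have X: "X = read_string (mem (conc B a)) (ev a p) (ev a n)"
    using Enc unfolding X_def read_string_def by (auto simp: conc_def)
  have len: "int (length (f X)) = ev a n" using Enc unfolding X_def by (auto simp: Let_def)
  have "aval w (conc B a) (cexp p) = Some (ev a p)" "aval w (conc B a) (cexp n) = Some (ev a n)"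
    using Enc by (auto intro!: aval_cexp)
  moreover have "{ev a p..<ev a p + ev a n} \<subseteq> words w"
    using Enc M_pos by (auto intro!: small_word)
  ultimately have "exec w \<Sigma> f E R (compile (Enc p n)) (conc B a)
      (1 + acost (cexp p) + acost (cexp n) + acost (cexp p) + E (nat (ev a n)))
      ((conc B a)\<lparr>mem := write_string (mem (conc B a)) (ev a p) (f X),
        encoded := encoded (conc B a) @ [X]\<rparr>)"
    unfolding compile.simps using Enc X X_def
    by (intro exec.Encode) (auto simp: Let_def)
  from wpI[OF this, where a' = "a\<lparr>lo := write_string (lo a) (ev a p) (f X), en := en a @ [X]\<rparr>"]
  show ?case
    using Enc len
    by (auto simp: conc_def write_string_def X_def Let_def fun_eq_iff algebra_simps)
next
  case (Ree x h i j)
  define X where "X = en a ! nat (ev a h)"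
  have "aval w (conc B a) (cexp h) = Some (ev a h)" "aval w (conc B a) (cexp i) = Some (ev a i)"
    "aval w (conc B a) (cexp j) = Some (ev a j)"
    using Ree by (auto intro!: aval_cexp)
  then have "exec w \<Sigma> f E R (compile (Ree x h i j)) (conc B a)
      (1 + acost (cexp h) + acost (cexp i) + acost (cexp j) + R (nat (ev a j - ev a i + 1)))
      ((conc B a)\<lparr>reg := (reg (conc B a))(x := last (f (substr X (nat (ev a i)) (nat (ev a j)))))\<rparr>)"
    unfolding compile.simps using Ree X_def
    by (intro exec.Reencode) (auto simp: Let_def conc_def)
  from wpI[OF this,
      where a' = "a\<lparr>rg := (rg a)(x := last (f (substr X (nat (ev a i)) (nat (ev a j)))))\<rparr>" and Q = Q and t = t]
  show ?case
    using Ree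
    by (auto simp: fun_eq_iff conc_def X_def Let_def algebra_simps)
next
  case (Sq c1 c2)
  then have "vc c1 (vc c2 Q) a t" by simp
  from Sq.IH(1)[OF this] have "wp c1 (wp c2 Q) a t" by (rule wp_mono) (rule Sq.IH(2))
  then show ?case by (rule wp_seq)
next
  case (Ite b c1 c2)
  then have b: "bval w (conc B a) (cbexp b) = Some (evb a b)" by (auto intro: bval_cbexp)
  show ?case
  proof (cases "evb a b")
    case True
    then have "wp c1 Q a (t + (1 + costb b))" using Ite by auto
    then obtain t' a' where *: "exec w \<Sigma> f E R (compile c1) (conc B a) t' (conc B a')"
      "Q a' (t + (1 + costb b) + int t')" unfolding wp_def by blast
    from exec.IfTrue[OF _ *(1)] b True *(2) show ?thesis
      by (intro wpI[OF _ refl]) (auto simp: algebra_simps)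
  next
    case False
    then have "wp c2 Q a (t + (1 + costb b))" using Ite by auto
    then obtain t' a' where *: "exec w \<Sigma> f E R (compile c2) (conc B a) t' (conc B a')"
      "Q a' (t + (1 + costb b) + int t')" unfolding wp_def by blast
    from exec.IfFalse[OF _ *(1)] b False *(2) show ?thesis
      by (intro wpI[OF _ refl]) (auto simp: algebra_simps)
  qed
qed simp

end

section \<open>Failure chains\<close>

locale encoded_dictionary =
  fixes \<Sigma> :: "'a set" and \<Pi> :: "'b set" and r :: "('a list \<times> 'a list) set"
    and f :: "'a list \<Rightarrow> 'b list" and D :: "'a list list"
  assumes scer: "scer \<Sigma> r" and enc: "prefix_encoding \<Sigma> \<Pi> r f" and dict: "dictionary \<Sigma> D"
begin

lemma pattern: "P \<in> set D \<Longrightarrow> P \<in> lists \<Sigma>" "P \<in> set D \<Longrightarrow> P \<noteq> []"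
  using dict by (auto simp: dictionary_def)

lemma length_f: "X \<in> lists \<Sigma> \<Longrightarrow> length (f X) = length X"
  using enc by (auto simp: prefix_encoding_def)

lemma f_take: "X \<in> lists \<Sigma> \<Longrightarrow> f (take i X) = take i (f X)"
  using enc by (cases "i \<le> length X") (auto simp: prefix_encoding_def)

lemma f_eq_iff: "X \<in> lists \<Sigma> \<Longrightarrow> Y \<in> lists \<Sigma> \<Longrightarrow> f X = f Y \<longleftrightarrow> (X, Y) \<in> r"
  using enc by (auto simp: prefix_encoding_def)

lemma f_Nil [simp]: "f [] = []"
  using length_f[of "[]"] by simp

lemma Pref_iff: "S \<in> Pref f D \<longleftrightarrow> (\<exists>P \<in> set D. \<exists>j \<le> length P. S = take j (f P))"
proof
  assume "S \<in> Pref f D"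
  then obtain P where "P \<in> set D" "prefix S (f P)" by (auto simp: Pref_def)
  then show "\<exists>P \<in> set D. \<exists>j \<le> length P. S = take j (f P)"
    using length_f[OF pattern(1)] by (metis append_eq_conv_conj prefix_def prefix_length_le)
qed (use take_is_prefix in \<open>auto simp: Pref_def\<close>)

lemma Pref_prefix: "S \<in> Pref f D \<Longrightarrow> prefix T S \<Longrightarrow> T \<in> Pref f D"
  by (auto simp: Pref_def intro: prefix_order.trans)

lemma Nil_Pref [simp]: "[] \<in> Pref f D"
  using dict by (cases D) (auto simp: Pref_def dictionary_def)

lemma substr_lists: "P \<in> set D \<Longrightarrow> substr P l j \<in> lists \<Sigma>"
  by (rule substr_in_lists) (rule pattern(1))

lemma length_substr: "1 \<le> l \<Longrightarrow> j \<le> length P \<Longrightarrow> length (substr P l j) = j + 1 - l"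
  by (auto simp: substr_def)

text \<open>By the prefix law, removing the last symbol of the string removes the last symbol of its
  encoding. The symbol appended here is exactly what \<open>Reencode\<close> delivers.\<close>

lemma f_substr_snoc:
  assumes P: "P \<in> set D" and l: "1 \<le> l" "l \<le> j" "j \<le> length P"
  shows "f (substr P l j) = f (substr P l (j - 1)) @ [last (f (substr P l j))]"
proof -
  have "substr P l (j - 1) = take (j - l) (substr P l j)"
    using l by (simp add: substr_def take_drop min_def)
  then have "f (substr P l (j - 1)) = take (j - l) (f (substr P l j))"
    using f_take substr_lists[OF P] by metis
  moreover have len: "length (f (substr P l j)) = j - l + 1"
    using l by (simp add: length_f substr_lists[OF P] length_substr)
  ultimately have "f (substr P l (j - 1)) = butlast (f (substr P l j))"
    by (simp add: butlast_conv_take)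
  moreover have "f (substr P l j) \<noteq> []" using len by auto
  ultimately show ?thesis by simp
qed

text \<open>Extends \<open>fail_pos\<close> from start position 1 to any \<open>l\<close>, so that
  iterated failure links are increasing start positions in one fixed pattern.\<close>

definition next_pos :: "'a list \<Rightarrow> nat \<Rightarrow> nat \<Rightarrow> nat" where
  "next_pos P l j = (LEAST l'. l' > l \<and> f (substr P l' j) \<in> Pref f D)"

lemma next_pos:
  assumes "1 \<le> l" "l \<le> j"
  shows "l < next_pos P l j" "f (substr P (next_pos P l j) j) \<in> Pref f D" "next_pos P l j \<le> j + 1"
    "l < l' \<Longrightarrow> l' < next_pos P l j \<Longrightarrow> f (substr P l' j) \<notin> Pref f D"
proof -
  have ex: "j + 1 > l \<and> f (substr P (j + 1) j) \<in> Pref f D"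
    using assms by (auto simp: substr_def)
  show "l < next_pos P l j" "f (substr P (next_pos P l j) j) \<in> Pref f D"
    using LeastI[of "\<lambda>l'. l' > l \<and> f (substr P l' j) \<in> Pref f D", OF ex]
    by (auto simp: next_pos_def)
  show "next_pos P l j \<le> j + 1"
    unfolding next_pos_def by (rule Least_le) (rule ex)
  show "f (substr P l' j) \<notin> Pref f D" if "l < l'" "l' < next_pos P l j"
    using not_less_Least[of l' "\<lambda>l'. l' > l \<and> f (substr P l' j) \<in> Pref f D"] that
    unfolding next_pos_def by blast
qed

lemma next_posI:
  assumes "l < l'" "f (substr P l' j) \<in> Pref f D"
    "\<And>l''. l < l'' \<Longrightarrow> l'' < l' \<Longrightarrow> f (substr P l'' j) \<notin> Pref f D"
  shows "next_pos P l j = l'"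
  unfolding next_pos_def
  by (rule Least_equality) (use assms in \<open>auto simp: not_less[symmetric]\<close>)

text \<open>A state read off \<open>P\<close> may be a prefix of the encoding of another pattern
  \<open>Q\<close>, and \<open>Fail\<close> and \<open>Out\<close> are evaluated through such a
  \<open>Q\<close>. Equal encodings give equivalent strings, and substring consistency passes this
  to all suffixes, with positions shifted by \<open>l - 1\<close>.\<close>

lemma state_transfer:
  assumes P: "P \<in> set D" "1 \<le> l" "l \<le> j" "j \<le> length P" and S: "f (substr P l j) \<in> Pref f D"
  obtains Q where "Q \<in> set D" "j + 1 - l \<le> length Q" "f (substr P l j) = take (j + 1 - l) (f Q)"
    "\<And>x. 1 \<le> x \<Longrightarrow> (substr Q x (j + 1 - l), substr P (l + x - 1) j) \<in> r"
proof -
  define n where "n = j + 1 - l"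
  from S obtain Q i where Q: "Q \<in> set D" "i \<le> length Q" "f (substr P l j) = take i (f Q)"
    unfolding Pref_iff by blast
  have "length (f (substr P l j)) = n"
    using P by (simp add: length_f substr_lists[OF P(1)] length_substr n_def)
  then have i: "i = n" using Q length_f[OF pattern(1)[OF Q(1)]] by simp
  have lists: "take n Q \<in> lists \<Sigma>" using pattern(1)[OF Q(1)] by (auto dest: in_set_takeD)
  have "f (take n Q) = f (substr P l j)"
    using Q i f_take[OF pattern(1)[OF Q(1)]] by simp
  then have rel: "(take n Q, substr P l j) \<in> r"
    using f_eq_iff[OF lists substr_lists[OF P(1)]] by simp
  have "(substr Q x n, substr P (l + x - 1) j) \<in> r" if x: "1 \<le> x" for x
  proof (cases "x \<le> n")
    case True
    have "(substr (take n Q) x n, substr (substr P l j) x n) \<in> r"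
      using scer rel True x Q(2) i unfolding scer_def by (metis length_take min.absorb2 order_refl)
    moreover have "substr (substr P l j) x n = substr P (l + x - 1) j"
      using P x by (simp add: substr_def n_def take_drop min_def add.commute)
    ultimately show ?thesis by (simp add: substr_take)
  next
    case False
    then have "substr Q x n = []" "substr P (l + x - 1) j = []"
      using P x by (auto simp: substr_def n_def)
    then show ?thesis using scer by (auto simp: scer_def equiv_def refl_on_def)
  qed
  then show ?thesis using that Q i unfolding n_def by blast
qed

text \<open>The search for the failure position in \<open>Q\<close> tests the same encodings as the
  search beyond \<open>l\<close> in \<open>P\<close>, so both stop at corresponding
  positions.\<close>

lemma Fail_substr:
  assumes P: "P \<in> set D" "1 \<le> l" "l \<le> j" "j \<le> length P" and S: "f (substr P l j) \<in> Pref f D"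
  shows "Fail f D (f (substr P l j)) = Some (f (substr P (next_pos P l j) j))"
proof -
  obtain Q where Q: "Q \<in> set D" "j + 1 - l \<le> length Q" "f (substr P l j) = take (j + 1 - l) (f Q)"
    "\<And>x. 1 \<le> x \<Longrightarrow> (substr Q x (j + 1 - l), substr P (l + x - 1) j) \<in> r"
    using state_transfer[OF P S] by metis
  define n where "n = j + 1 - l"
  define q where "q = fail_pos f D Q n"
  have n: "1 \<le> n" "n \<le> length Q" using Q P by (auto simp: n_def)
  have eq: "f (substr Q x n) = f (substr P (l + x - 1) j)" if "1 \<le> x" for x
    using f_eq_iff[OF substr_lists[OF Q(1)] substr_lists[OF P(1)]] Q(4)[OF that] by (simp add: n_def)
  have q: "1 < q" "f (substr Q q n) \<in> Pref f D"
    using fail_pos[OF enc dict Q(1) n] by (auto simp: q_def)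
  \<comment> \<open>Position 1 of \<open>Q\<close> corresponds to position \<open>l\<close> of
    \<open>P\<close>, hence the shift.\<close>
  have "next_pos P l j = l + q - 1"
  proof (rule next_posI)
    show "f (substr P (l + q - 1) j) \<in> Pref f D" using q eq[of q] by simp
    show "l < l + q - 1" using q by simp
    fix l'' assume l'': "l < l''" "l'' < l + q - 1"
    then have "\<not> (l'' - l + 1 > 1 \<and> f (substr Q (l'' - l + 1) n) \<in> Pref f D)"
      using not_less_Least[of "l'' - l + 1" "\<lambda>x. x > 1 \<and> f (substr Q x n) \<in> Pref f D"]
      unfolding q_def fail_pos_def by simp
    then show "f (substr P l'' j) \<notin> Pref f D" using eq[of "l'' - l + 1"] l'' by simp
  qed
  moreover have "Fail f D (take n (f Q)) = Some (f (substr Q q n))"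
    unfolding q_def by (rule Fail_take[OF scer enc dict Q(1) n])
  ultimately show ?thesis using Q(3) eq[of q] q by (simp add: n_def)
qed

lemma take_eq_substr: "take j (f P) = f (substr P 1 j)" if "P \<in> set D"
  using f_take[OF pattern(1)[OF that]] by (simp add: substr_def)

lemma Fail_take_next:
  assumes P: "P \<in> set D" "1 \<le> j" "j \<le> length P"
  shows "Fail f D (take j (f P)) = Some (f (substr P (next_pos P 1 j) j))"
  using Fail_substr[OF P(1), of 1 j] assms take_eq_substr[OF P(1)]
  by (metis Pref_iff order_refl)

section \<open>Failure links from the chain of the parent\<close>

definition fail_len :: "'b list \<Rightarrow> int" where
  "fail_len S = (case Fail f D S of None \<Rightarrow> 0 | Some T \<Rightarrow> int (length T))"

text \<open>The candidates for the failure link of \<open>f(P)[:j]\<close> are the extensions of the states \<open>f(P[l:j-1])\<close>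
  on the failure chain of the parent \<open>f(P)[:j-1]\<close>; those before \<open>l\<close> have been rejected.\<close>

definition candidate :: "'a list \<Rightarrow> nat \<Rightarrow> nat \<Rightarrow> bool" where
  "candidate P j l \<longleftrightarrow> P \<in> set D \<and> 2 \<le> l \<and> l \<le> j \<and> j \<le> length P \<and>
     f (substr P l (j - 1)) \<in> Pref f D \<and> (\<forall>l'. 1 < l' \<and> l' < l \<longrightarrow> f (substr P l' j) \<notin> Pref f D)"

text \<open>Prefix closure of the states. Its contrapositive is what excludes the start positions
  that the chain of the parent skips.\<close>

lemma Pref_substr_butlast:
  assumes "P \<in> set D" "1 \<le> l" "l \<le> j" "j \<le> length P" "f (substr P l j) \<in> Pref f D"
  shows "f (substr P l (j - 1)) \<in> Pref f D"
  using Pref_prefix[OF assms(5)] f_substr_snoc[OF assms(1-4)] by (metis prefixI)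

lemma Fail_Nil [simp]: "Fail f D [] = None"
  by (simp add: Fail_def)

lemma Fail_first:
  assumes "P \<in> set D"
  shows "Fail f D (take 1 (f P)) = Some []"
proof -
  have "1 \<le> length P" using pattern(2)[OF assms] by (cases P) auto
  moreover have "next_pos P 1 1 = 2" using next_pos[of 1 1, where P = P] by auto
  ultimately show ?thesis using Fail_take_next[OF assms, of 1] by (simp add: substr_def)
qed

text \<open>Positions before the failure position of the parent are no states at
  \<open>j - 1\<close>, hence none at \<open>j\<close>.\<close>

lemma candidate_init:
  assumes P: "P \<in> set D" "2 \<le> j" "j \<le> length P"
  obtains l where "candidate P j l" "Fail f D (take (j - 1) (f P)) = Some (f (substr P l (j - 1)))"
proof -
  define l where "l = next_pos P 1 (j - 1)"
  have j: "1 \<le> j - 1" using P by simp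
  note np = next_pos[OF order_refl j, where P = P, folded l_def]
  have "f (substr P l' j) \<notin> Pref f D" if l': "1 < l'" "l' < l" for l'
  proof -
    have "l' \<le> j" using np(3) l' P by simp
    then show ?thesis using np(4)[OF l'] Pref_substr_butlast[OF P(1), of l' j] l' P by auto
  qed
  moreover have "1 < l" "f (substr P l (j - 1)) \<in> Pref f D" "l \<le> j"
    using np P by auto
  ultimately have "candidate P j l" using P by (auto simp: candidate_def)
  then show ?thesis using that Fail_take_next[OF P(1) j] P unfolding l_def by force
qed

lemma candidate_hit:
  assumes "candidate P j l" "f (substr P l j) \<in> Pref f D"
  shows "Fail f D (take j (f P)) = Some (f (substr P l j))"
proof -
  have "next_pos P 1 j = l"
    using assms by (intro next_posI) (auto simp: candidate_def)
  then show ?thesis using Fail_take_next assms(1) by (auto simp: candidate_def)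
qed

text \<open>Following one failure link skips only positions that are no states at
  \<open>j - 1\<close>; together with the rejected \<open>l\<close> nothing before \<open>l'\<close>
  remains possible.\<close>

lemma candidate_miss:
  assumes c: "candidate P j l" and l: "l < j" and miss: "f (substr P l j) \<notin> Pref f D"
  obtains l' where "l < l'" "candidate P j l'"
    "Fail f D (f (substr P l (j - 1))) = Some (f (substr P l' (j - 1)))"
proof -
  define l' where "l' = next_pos P l (j - 1)"
  have P: "P \<in> set D" "2 \<le> l" "l \<le> j" "j \<le> length P" using c by (auto simp: candidate_def)
  have np: "l < l'" "f (substr P l' (j - 1)) \<in> Pref f D" "l' \<le> j"
    "\<And>x. l < x \<Longrightarrow> x < l' \<Longrightarrow> f (substr P x (j - 1)) \<notin> Pref f D"
    using next_pos[where P = P and l = l and j = "j - 1"] P l unfolding l'_def by auto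
  have "f (substr P x j) \<notin> Pref f D" if "1 < x" "x < l'" for x
  proof (cases x l rule: linorder_cases)
    case less
    then show ?thesis using c that by (auto simp: candidate_def)
  next
    case equal
    then show ?thesis using miss by simp
  next
    case greater
    then show ?thesis using np(3) np(4)[of x] that P Pref_substr_butlast[OF P(1), of x j] by fastforce
  qed
  then have "candidate P j l'" using P np by (auto simp: candidate_def)
  moreover have "Fail f D (f (substr P l (j - 1))) = Some (f (substr P l' (j - 1)))"
    unfolding l'_def using Fail_substr[OF P(1), of l "j - 1"] c l P by (auto simp: candidate_def)
  ultimately show ?thesis using that np(1) by blast
qed

text \<open>The candidate \<open>j\<close> extends the root, the end of the chain. After its
  rejection only the empty suffix, starting at \<open>j + 1\<close>, is left.\<close>

lemma candidate_end:
  assumes c: "candidate P j j" and miss: "f (substr P j j) \<notin> Pref f D"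
  shows "Fail f D (take j (f P)) = Some []"
proof -
  have "next_pos P 1 j = j + 1"
  proof (rule next_posI)
    show "f (substr P (j + 1) j) \<in> Pref f D" by (simp add: substr_def)
  next
    fix l'' assume "1 < l''" "l'' < j + 1"
    then show "f (substr P l'' j) \<notin> Pref f D"
      using c miss by (cases "l'' = j") (auto simp: candidate_def)
  qed (use c in \<open>auto simp: candidate_def\<close>)
  then show ?thesis using Fail_take_next[of P j] c by (auto simp: candidate_def substr_def)
qed

lemma length_candidate:
  "candidate P j l \<Longrightarrow> length (f (substr P l (j - 1))) = j - l"
  "candidate P j l \<Longrightarrow> length (f (substr P l j)) = j + 1 - l"
  by (auto simp: candidate_def length_f substr_lists length_substr)

text \<open>The strict decrease in length ensures that a failure link leads to a node with a smaller
  breadth-first number, whose data are already complete.\<close>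

lemma Fail_Pref:
  assumes "S \<in> Pref f D" "S \<noteq> []"
  obtains T where "Fail f D S = Some T" "T \<in> Pref f D" "length T < length S"
proof -
  obtain P j where P: "P \<in> set D" "j \<le> length P" "S = take j (f P)"
    using assms(1) unfolding Pref_iff by blast
  have j: "1 \<le> j" using assms(2) P by (cases j) auto
  note np = next_pos[OF order_refl j, where P = P]
  have "length (f (substr P (next_pos P 1 j) j)) < length S"
    using np(1) P j by (simp add: length_f substr_lists length_substr pattern)
  then show ?thesis using that np(2) Fail_take_next[OF P(1) j P(2)] P(3) by blast
qed

text \<open>Dropping the last symbol of a nonempty failure state leaves a state ending at
  \<open>j - 1\<close>, which the failure link of the parent cannot undercut.\<close>

lemma fail_len_step:
  assumes P: "P \<in> set D" "1 \<le> j" "j \<le> length P"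
  shows "fail_len (take j (f P)) \<le> fail_len (take (j - 1) (f P)) + 1"
proof (cases "next_pos P 1 j \<le> j")
  case False
  then have "substr P (next_pos P 1 j) j = []" by (simp add: substr_def)
  then show ?thesis
    using Fail_take_next[OF P] by (simp add: fail_len_def split: option.splits)
next
  case True
  define l where "l = next_pos P 1 j"
  have l: "1 < l" "f (substr P l j) \<in> Pref f D" "l \<le> j"
    using next_pos[OF order_refl P(2), where P = P] True by (auto simp: l_def)
  have j: "1 \<le> j - 1" "j - 1 \<le> length P" using l P by auto
  have "next_pos P 1 (j - 1) \<le> l"
    unfolding next_pos_def
    by (rule Least_le) (use l Pref_substr_butlast[OF P(1), of l j] P in auto)
  then have "length (f (substr P l j)) \<le> length (f (substr P (next_pos P 1 (j - 1)) (j - 1))) + 1"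
    using P l j next_pos(1)[OF order_refl j(1), where P = P]
    by (simp add: length_f substr_lists length_substr)
  then show ?thesis
    using Fail_take_next[OF P] Fail_take_next[OF P(1) j] by (simp add: fail_len_def l_def)
qed

section \<open>Recursion for the output sets\<close>

lemma Out_Nil: "Out r f D [] = {}"
proof -
  obtain P where P: "P \<in> set D" using dict by (cases D) (auto simp: dictionary_def)
  show ?thesis using Out_take[OF scer enc dict P, of 0] by (simp add: out_patterns_def)
qed

text \<open>The encoding of a pattern is itself a state. Hence no pattern starts strictly between 1
  and the failure position \<open>l\<close>: a match is either all of \<open>S\<close> or starts at
  \<open>l\<close> or later, and the latter matches are those of \<open>T\<close>.\<close>

lemma Out_step:
  assumes "S \<in> Pref f D" "S \<noteq> []" "Fail f D S = Some T"
  shows "Out r f D S = {Q \<in> set D. f Q = S} \<union> Out r f D T"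
proof -
  obtain P j where P: "P \<in> set D" "j \<le> length P" "S = take j (f P)"
    using assms(1) unfolding Pref_iff by blast
  have j: "1 \<le> j" using assms(2) P by (cases j) auto
  define l where "l = next_pos P 1 j"
  have l: "1 < l" "l \<le> j + 1" "f (substr P l j) \<in> Pref f D"
    "\<And>x. 1 < x \<Longrightarrow> x < l \<Longrightarrow> f (substr P x j) \<notin> Pref f D"
    using next_pos[OF order_refl j, where P = P] by (auto simp: l_def)
  have T: "T = f (substr P l j)"
    using assms(3) Fail_take_next[OF P(1) j P(2)] P(3) by (simp add: l_def)
  have OutS: "Out r f D S = out_patterns r D P j"
    unfolding P(3) by (rule Out_take[OF scer enc dict P(1,2)])
  have rel: "(Q, substr P i j) \<in> r \<longleftrightarrow> f Q = f (substr P i j)" if "Q \<in> set D" for Q i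
    using f_eq_iff[OF pattern(1)[OF that] substr_lists[OF P(1)]] by simp
  have in_Pref: "f Q \<in> Pref f D" if "Q \<in> set D" for Q
    using that by (auto simp: Pref_def)
  \<comment> \<open>\<open>Out\<close> of \<open>T\<close> is evaluated through a pattern
    \<open>Q\<close> that begins with \<open>T\<close>; \<open>state_transfer\<close> moves the
    start positions back into \<open>P\<close>.\<close>
  have OutT: "Out r f D T = {Q \<in> set D. \<exists>i. l \<le> i \<and> i \<le> j \<and> f Q = f (substr P i j)}"
  proof (cases "l \<le> j")
    case False
    then have "T = []" by (simp add: T substr_def)
    then show ?thesis using False by (auto simp: Out_Nil)
  next
    case True
    obtain Q where Q: "Q \<in> set D" "j + 1 - l \<le> length Q" "f (substr P l j) = take (j + 1 - l) (f Q)"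
      "\<And>x. 1 \<le> x \<Longrightarrow> (substr Q x (j + 1 - l), substr P (l + x - 1) j) \<in> r"
      using state_transfer[OF P(1) _ True P(2) l(3)] l(1) by (metis less_imp_le)
    have eq: "f (substr Q x (j + 1 - l)) = f (substr P (l + x - 1) j)" if "1 \<le> x" for x
      using f_eq_iff[OF substr_lists[OF Q(1)] substr_lists[OF P(1)]] Q(4)[OF that] by simp
    have "Out r f D T = out_patterns r D Q (j + 1 - l)"
      unfolding T Q(3) by (rule Out_take[OF scer enc dict Q(1,2)])
    also have "\<dots> = {Q' \<in> set D. \<exists>x. 1 \<le> x \<and> x \<le> j + 1 - l \<and> f Q' = f (substr P (l + x - 1) j)}"
    proof -
      have "(Q', substr Q x (j + 1 - l)) \<in> r \<longleftrightarrow> f Q' = f (substr P (l + x - 1) j)"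
        if "Q' \<in> set D" "1 \<le> x" for Q' x
        using f_eq_iff[OF pattern(1)[OF that(1)] substr_lists[OF Q(1)]] eq[OF that(2)] by metis
      then show ?thesis unfolding out_patterns_def by blast
    qed
    also have "\<dots> = {Q' \<in> set D. \<exists>i. l \<le> i \<and> i \<le> j \<and> f Q' = f (substr P i j)}"
    proof -
      have "(\<exists>x. 1 \<le> x \<and> x \<le> j + 1 - l \<and> f Q' = f (substr P (l + x - 1) j)) \<longleftrightarrow>
        (\<exists>i. l \<le> i \<and> i \<le> j \<and> f Q' = f (substr P i j))" for Q'
      proof
        assume "\<exists>i. l \<le> i \<and> i \<le> j \<and> f Q' = f (substr P i j)"
        then obtain i where i: "l \<le> i" "i \<le> j" "f Q' = f (substr P i j)" by blast
        then show "\<exists>x. 1 \<le> x \<and> x \<le> j + 1 - l \<and> f Q' = f (substr P (l + x - 1) j)"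
          by (intro exI[of _ "i + 1 - l"]) auto
      next
        assume "\<exists>x. 1 \<le> x \<and> x \<le> j + 1 - l \<and> f Q' = f (substr P (l + x - 1) j)"
        then obtain x where "1 \<le> x" "x \<le> j + 1 - l" "f Q' = f (substr P (l + x - 1) j)" by blast
        then show "\<exists>i. l \<le> i \<and> i \<le> j \<and> f Q' = f (substr P i j)"
          using True by (intro exI[of _ "l + x - 1"]) auto
      qed
      then show ?thesis by simp
    qed
    finally show ?thesis .
  qed
  show ?thesis
  proof (intro set_eqI iffI)
    fix Q assume "Q \<in> Out r f D S"
    then obtain i where i: "Q \<in> set D" "1 \<le> i" "i \<le> j" "f Q = f (substr P i j)"
      unfolding OutS out_patterns_def using rel by auto
    show "Q \<in> {Q \<in> set D. f Q = S} \<union> Out r f D T"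
    proof (cases "i = 1")
      case True
      then show ?thesis using i take_eq_substr[OF P(1)] P(3) by simp
    next
      case False
      then have "l \<le> i" using l(4)[of i] i in_Pref[OF i(1)] by (metis le_neq_implies_less not_le)
      then show ?thesis using i OutT by auto
    qed
  next
    fix Q assume "Q \<in> {Q \<in> set D. f Q = S} \<union> Out r f D T"
    then consider "Q \<in> set D" "f Q = f (substr P 1 j)"
      | i where "Q \<in> set D" "l \<le> i" "i \<le> j" "f Q = f (substr P i j)"
      unfolding OutT using P(3) take_eq_substr[OF P(1)] by auto
    then show "Q \<in> Out r f D S"
    proof cases
      case 1
      then show ?thesis using rel j unfolding OutS out_patterns_def by blast
    next
      case (2 i)
      moreover have "1 \<le> i" using 2 l(1) by simp
      ultimately show ?thesis using rel unfolding OutS out_patterns_def by blast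
    qed
  qed
qed

section \<open>Counting\<close>

lemma total_length_sum: "total_length D = (\<Sum>i<length D. length (D ! i))"
  by (simp add: total_length_def sum_list_sum_nth atLeast0LessThan)

lemma length_D_le: "length D \<le> total_length D"
proof -
  have "(\<Sum>i<length D. 1) \<le> (\<Sum>i<length D. length (D ! i))"
    using pattern(2) by (intro sum_mono) (auto simp: Suc_le_eq)
  then show ?thesis by (simp add: total_length_sum)
qed

lemma total_length_pos: "1 \<le> total_length D"
  using length_D_le dict by (cases D) (auto simp: dictionary_def)

abbreviation positions :: "(nat \<times> nat) set" where
  "positions \<equiv> (SIGMA i:{..<length D}. {1..length (D ! i)})"

lemma Pref_positions: "Pref f D - {[]} = (\<lambda>(i, j). take j (f (D ! i))) ` positions" (is "_ = ?g ` _")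
proof (intro set_eqI iffI)
  fix S assume "S \<in> Pref f D - {[]}"
  then have S: "S \<in> Pref f D" "S \<noteq> []" by auto
  then obtain P j where P: "P \<in> set D" "j \<le> length P" "S = take j (f P)"
    unfolding Pref_iff by blast
  then obtain i where "i < length D" "D ! i = P" by (auto simp: in_set_conv_nth)
  moreover have "1 \<le> j" using P S by (cases j) auto
  ultimately show "S \<in> ?g ` positions" using P by (intro image_eqI[of _ _ "(i, j)"]) auto
next
  fix S assume "S \<in> ?g ` positions"
  then obtain i j where "i < length D" "1 \<le> j" "j \<le> length (D ! i)" "S = take j (f (D ! i))" by auto
  then show "S \<in> Pref f D - {[]}"
    using length_f[OF pattern(1), of "D ! i"] by (auto simp: Pref_iff intro!: bexI[of _ "D ! i"] exI[of _ j])
qed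

lemma finite_Pref [simp]: "finite (Pref f D)"
proof -
  have "finite (Pref f D - {[]})" unfolding Pref_positions by simp
  then show ?thesis by simp
qed

lemma card_Pref: "card (Pref f D) \<le> total_length D + 1"
proof -
  have "card (Pref f D - {[]}) \<le> card positions"
    unfolding Pref_positions by (rule card_image_le) simp
  also have "\<dots> = total_length D" by (simp add: total_length_sum)
  finally show ?thesis by (simp add: card_Diff_singleton)
qed

text \<open>The summand bounds the number of candidates tried for \<open>S\<close>. From a parent
  link of length \<open>A\<close>, a hit that extends a state of length \<open>x\<close> is at most
  the \<open>(A - x + 1)\<close>-st trial and gives a link of length \<open>x + 1\<close>, whence
  the 2. Along one pattern the sum telescopes.\<close>

lemma sum_fail_len:
  "(\<Sum>S \<in> Pref f D - {[]}. fail_len (butlast S) + 2 - fail_len S) \<le> 2 * int (total_length D)"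
proof -
  define g where "g = (\<lambda>(i, j). take j (f (D ! i)))"
  define h where "h S = fail_len (butlast S) + 2 - fail_len S" for S
  have h: "h (take j (f (D ! i))) = fail_len (take (j - 1) (f (D ! i))) + 2 - fail_len (take j (f (D ! i)))"
    if "i < length D" "j \<le> length (D ! i)" for i j
  proof -
    have "butlast (take j (f (D ! i))) = take (j - 1) (f (D ! i))"
      using that length_f[OF pattern(1), of "D ! i"] by (simp add: butlast_take)
    then show ?thesis by (simp add: h_def)
  qed
  \<comment> \<open>Several positions may denote the same state; counting it repeatedly only
    increases the sum, because \<open>fail_len_step\<close> makes each summand nonnegative.\<close>
  have "sum h (g ` positions) \<le> sum (h \<circ> g) positions"
  proof (rule sum_image_le)
    fix x assume "x \<in> positions"
    then obtain i j where x: "x = (i, j)" "i < length D" "1 \<le> j" "j \<le> length (D ! i)" by auto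
    show "0 \<le> h (g x)"
      using fail_len_step[of "D ! i" j] x by (simp add: h g_def)
  qed simp
  also have "sum (h \<circ> g) positions = (\<Sum>i<length D. \<Sum>j = 1..length (D ! i). h (take j (f (D ! i))))"
    by (subst sum.Sigma) (auto simp: g_def case_prod_beta)
  also have "\<dots> \<le> (\<Sum>i<length D. 2 * int (length (D ! i)))"
  proof (rule sum_mono)
    fix i assume i: "i \<in> {..<length D}"
    have "(\<Sum>j = 1..n. h (take j (f (D ! i)))) = 2 * int n - fail_len (take n (f (D ! i)))"
      if "n \<le> length (D ! i)" for n
      using that
    proof (induction n)
      case 0
      then show ?case by (simp add: fail_len_def)
    next
      case (Suc n)
      then show ?case using h[of i "Suc n"] i by simp
    qed
    moreover have "0 \<le> fail_len S" for S by (simp add: fail_len_def split: option.split)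
    ultimately show "(\<Sum>j = 1..length (D ! i). h (take j (f (D ! i)))) \<le> 2 * int (length (D ! i))"
      by simp
  qed
  also have "\<dots> = 2 * int (total_length D)" by (simp add: total_length_sum sum_distrib_left)
  finally show ?thesis unfolding Pref_positions h_def g_def by simp
qed

lemma out_degree: "S \<in> Pref f D \<Longrightarrow> card {c. S @ [c] \<in> Pref f D} \<le> max_out_degree f D"
  unfolding max_out_degree_def
  by (rule Max_ge) (auto simp: goto_def intro!: image_eqI[of _ _ S] arg_cong[of _ _ card])

lemma finite_children: "finite {c. S @ [c] \<in> Pref f D}"
  by (rule finite_imageD[of "\<lambda>c. S @ [c]"], rule finite_subset[OF _ finite_Pref])
    (auto simp: inj_on_def)

text \<open>The patterns are nonempty, so the root has a child. This keeps the logarithm of the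
  out-degree nonnegative.\<close>

lemma max_out_degree_pos: "1 \<le> max_out_degree f D"
proof -
  obtain P where P: "P \<in> set D" using dict by (cases D) (auto simp: dictionary_def)
  then obtain c where "take 1 (f P) = [c]"
    using length_f[OF pattern(1)[OF P]] pattern(2)[OF P]
    by (cases "f P") auto
  then have "[] @ [c] \<in> Pref f D" using P by (auto simp: Pref_def) (metis take_is_prefix)
  then have "1 \<le> card {c. [] @ [c] \<in> Pref f D}"
    using finite_children[of "[]"] by (metis card_gt_0_iff One_nat_def Suc_leI empty_iff mem_Collect_eq)
  then show ?thesis using out_degree[OF Nil_Pref] by linarith
qed

text \<open>Double counting: a pattern of length \<open>n\<close> passes through
  \<open>n + 1\<close> states, root included, and there are at most \<open>total_length D\<close>
  patterns.\<close>

lemma sum_card_through: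
  "(\<Sum>S \<in> Pref f D. card {i \<in> {..<length D}. prefix S (f (D ! i))}) \<le> 2 * total_length D"
proof -
  have "(\<Sum>S \<in> Pref f D. card {i \<in> {..<length D}. prefix S (f (D ! i))}) =
    (\<Sum>S \<in> Pref f D. \<Sum>i<length D. if prefix S (f (D ! i)) then 1 else 0)"
    by (intro sum.cong refl) (simp add: sum.If_cases Int_def)
  also have "\<dots> = (\<Sum>i<length D. \<Sum>S \<in> Pref f D. if prefix S (f (D ! i)) then 1 else 0)"
    by (rule sum.swap)
  also have "\<dots> \<le> (\<Sum>i<length D. length (D ! i) + 1)"
  proof (rule sum_mono)
    fix i assume i: "i \<in> {..<length D}"
    have "{S \<in> Pref f D. prefix S (f (D ! i))} \<subseteq> (\<lambda>j. take j (f (D ! i))) ` {..length (D ! i)}"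
    proof
      fix S assume S: "S \<in> {S \<in> Pref f D. prefix S (f (D ! i))}"
      then have "S = take (length S) (f (D ! i))" by (auto simp: prefix_def)
      moreover have "length S \<le> length (D ! i)"
        using S i length_f[OF pattern(1), of "D ! i"] prefix_length_le by fastforce
      ultimately show "S \<in> (\<lambda>j. take j (f (D ! i))) ` {..length (D ! i)}" by blast
    qed
    then have "card {S \<in> Pref f D. prefix S (f (D ! i))} \<le> card {..length (D ! i)}"
      by (meson card_image_le card_mono finite_atMost finite_imageI le_trans)
    then show "(\<Sum>S \<in> Pref f D. if prefix S (f (D ! i)) then 1 else 0) \<le> length (D ! i) + 1"
      by (simp add: sum.If_cases Int_def)
  qed
  also have "\<dots> = total_length D + length D" by (simp only: total_length_sum sum.distrib) simp
  also have "\<dots> \<le> 2 * total_length D" using length_D_le by simp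
  finally show ?thesis .
qed

end

section \<open>Loading the dictionary\<close>

text \<open>Arrays indexed by patterns: \<open>START\<close> (address before the first symbol), \<open>NEXT\<close> and \<open>NEXTE\<close> (successors
  in the lists \<open>LIST\<close> and \<open>ENDS\<close>), \<open>CK\<close> and \<open>CN\<close> (cell of the output lists). Indexed by nodes: \<open>PAR\<close>, \<open>SYM\<close>
  (last symbol), \<open>REP\<close> (a pattern through the node), \<open>DEP\<close>, \<open>NXS\<close> (previous node for the same symbol), \<open>LIST\<close>
  and \<open>ENDS\<close> (patterns through and ending in the node), \<open>FIRST\<close> and \<open>LAST\<close> (range of the children), \<open>CUR\<close>,
  \<open>FAIL\<close>, \<open>OUT\<close>. Indexed by symbols: \<open>LC\<close> (last node created). \<open>SLOT\<close> holds the sorted children.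

  Registers: 0 to 7 for searches, 9 base address, 10 number of patterns, 14 largest base of a symbol code,
  15 number of nodes, 16 current node, 17 list pointer, 18 pattern, 19 depth, 20 symbol code, 21 node,
  22 failure link.\<close>

abbreviation (input) "START \<equiv> 0 :: nat"
abbreviation (input) "NEXT \<equiv> 1 :: nat"
abbreviation (input) "LIST \<equiv> 2 :: nat"
abbreviation (input) "PAR \<equiv> 3 :: nat"
abbreviation (input) "SYM \<equiv> 4 :: nat"
abbreviation (input) "REP \<equiv> 5 :: nat"
abbreviation (input) "DEP \<equiv> 6 :: nat"
abbreviation (input) "NXS \<equiv> 7 :: nat"
abbreviation (input) "LC \<equiv> 8 :: nat"
abbreviation (input) "FIRST \<equiv> 9 :: nat"
abbreviation (input) "LAST \<equiv> 10 :: nat"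
abbreviation (input) "CUR \<equiv> 11 :: nat"
abbreviation (input) "ENDS \<equiv> 12 :: nat"
abbreviation (input) "NEXTE \<equiv> 13 :: nat"
abbreviation (input) "SLOT \<equiv> 14 :: nat"
abbreviation (input) "FAIL \<equiv> 15 :: nat"
abbreviation (input) "OUT \<equiv> 16 :: nat"
abbreviation (input) "CK \<equiv> 17 :: nat"
abbreviation (input) "CN \<equiv> 18 :: nat"

text \<open>Computes the cell \<open>bkt\<close> and the offset \<open>rsd\<close>, both defined
  below, of the symbol in register 1 and leaves them in registers 2 and 3.\<close>

definition locate :: cmd where
  "locate =
    Ite (LtE (Var 1) (Num 0))
      (2 ::= Op Div (Var 1) (Num 2) ;; 3 ::= Op Mod (Var 1) (Num 2) .+ Num 2)
      (2 ::= Num (-1) .- Op Div (Var 1) (Num 2) ;; 3 ::= Op Mod (Var 1) (Num 2))"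

definition setup_body :: cmd where
  "setup_body = 9 ::= Var 9 .+ Low (Var 11) ;; 11 ::= Var 11 .+ Num 1"

text \<open>Cell 0 gives up the number of patterns, kept in register 10, for the base address:
  queries start with cleared registers and recover the base from there.\<close>

definition setup_prog :: cmd where
  "setup_prog =
    10 ::= Low (Num 0) ;; 9 ::= Num 1 .+ Var 10 ;; 11 ::= Num 1 ;;
    Wh (NotE (LtE (Var 10) (Var 11))) setup_body ;;
    SetL (Num 0) (Var 9)"

text \<open>Encoding is done in place. \<open>START\<close> points one cell before the pattern, so
  that positions counted from 1 can be added to it; \<open>NEXT\<close> links all patterns into one
  list with head \<open>d\<close>, the initial list of the root.\<close>

definition encode_body :: cmd where
  "encode_body =
    Enc (Var 12) (Low (Var 11)) ;;
    SetF START (Var 11) (Var 12 .- Num 1) ;; SetF NEXT (Var 11) (Var 11 .- Num 1) ;;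
    12 ::= Var 12 .+ Low (Var 11) ;; 11 ::= Var 11 .+ Num 1"

definition encode_prog :: cmd where
  "encode_prog =
    12 ::= Num 1 .+ Var 10 ;; 11 ::= Num 1 ;;
    Wh (NotE (LtE (Var 10) (Var 11))) encode_body ;;
    SetF LIST (Num 0) (Var 10)"

text \<open>Register 14 is raised by 4 before it is stored, so bases are positive and a zero cell
  means that no symbol of this cell has been met.\<close>

definition rename_body :: cmd where
  "rename_body =
    1 ::= Low (Var 12) ;; locate ;;
    Ite (EqE (Low (Var 2)) (Num 0)) (14 ::= Var 14 .+ Num 4 ;; SetL (Var 2) (Var 14)) Nop ;;
    SetL (Var 12) (Low (Var 2) .+ Var 3) ;; 12 ::= Var 12 .+ Num 1"

definition rename_prog :: cmd where
  "rename_prog =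
    12 ::= Num 1 .+ Var 10 ;; 14 ::= Num 0 ;;
    Wh (LtE (Var 12) (Var 9)) rename_body"

text \<open>The table of symbols occupies the negative addresses, which initially hold zero. As there are
  fewer of them than words, four symbols share the cell \<open>bkt c\<close>: it holds a base to which \<open>rsd c\<close> is
  added.\<close>

definition bkt :: "int \<Rightarrow> int" where
  "bkt c = (if c < 0 then c div 2 else - 1 - c div 2)"

definition rsd :: "int \<Rightarrow> int" where
  "rsd c = (if c < 0 then c mod 2 + 2 else c mod 2)"

lemma bkt_neg: "bkt c < 0"
  by (auto simp: bkt_def)

lemma rsd_bounds: "0 \<le> rsd c" "rsd c < 4"
  using pos_mod_bound[of 2 c] pos_mod_sign[of 2 c] unfolding rsd_def by (auto simp del: pos_mod_bound pos_mod_sign)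

text \<open>The residue tells the sign, being at least 2 exactly for negative symbols; quotient and
  remainder modulo 2 then determine the symbol.\<close>

lemma bkt_rsd_inj: "bkt c = bkt c' \<Longrightarrow> rsd c = rsd c' \<Longrightarrow> c = c'"
  unfolding bkt_def rsd_def by (smt (verit) mult_div_mod_eq pos_mod_bound pos_mod_sign)

section \<open>Layout of the input and bounds on addresses\<close>

locale construction = encoded_dictionary \<Sigma> \<Pi> r f D
  for \<Sigma> \<Pi> :: "int set" and r f D +
  fixes w :: nat and E R :: "nat \<Rightarrow> nat"
  assumes size: "1024 * total_length D \<le> 2 ^ w"
    and pattern_words: "\<And>P. P \<in> set D \<Longrightarrow> set P \<subseteq> words w"
    and symbol_words: "\<And>P i j. P \<in> set D \<Longrightarrow> 1 \<le> i \<Longrightarrow> i \<le> j \<Longrightarrow> j \<le> length P \<Longrightarrow>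
      set (f (substr P i j)) \<subseteq> words w"
    and E_bound: "(\<Sum>P\<leftarrow>D. E (length P)) \<le> E (total_length D)"
    and R_pos: "0 < R (max_length D)"
    and R_mono: "\<And>n. 1 \<le> n \<Longrightarrow> n \<le> max_length D \<Longrightarrow> R n \<le> R (max_length D)"
begin

definition "d = int (length D)"
definition "m = int (total_length D)"
definition "B = 1 + d + m"
text \<open>Indices are patterns, nodes and symbol codes; the codes are the largest, up to
  \<open>4 * m + 3\<close>. As \<open>d \<le> m\<close> and \<open>1 \<le> m\<close>, the end
  \<open>B + 32 * M + 32\<close> of the arrays is below \<open>1024 * m\<close>.\<close>

definition "M = 4 * m + 8"

text \<open>Patterns are numbered from 1 on, since 0 terminates the lists.\<close>

definition "pat k = D ! nat (k - 1)"
definition "F k = f (pat k)"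
definition "plen k = int (length (pat k))"
text \<open>\<open>pos k\<close> is the address of the first symbol of pattern \<open>k\<close>, and
  \<open>esum k\<close> is the charge for encoding the patterns before \<open>k\<close>. Both are
  also used at \<open>d + 1\<close>, where \<open>pos\<close> is \<open>B\<close>.\<close>

definition "pos k = 1 + d + int (\<Sum>P\<leftarrow>take (nat (k - 1)) D. length P)"
definition "esum k = int (\<Sum>P\<leftarrow>take (nat (k - 1)) D. E (length P))"

lemma d_m: "1 \<le> d" "d \<le> m" "1 \<le> m"
  using length_D_le total_length_pos dict by (auto simp: d_def m_def dictionary_def Suc_le_eq)

lemma size_int: "1024 * m \<le> 2 ^ w"
  using size unfolding m_def by (metis of_nat_le_iff of_nat_mult of_nat_numeral of_nat_power)

sublocale machine w \<Sigma> f E R B M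
  by unfold_locales (use d_m size_int in \<open>auto simp: B_def M_def\<close>)

lemma B_bounds: "1 + d \<le> B" "2 \<le> B" "d < B" "0 < B" "4 * m + 8 \<le> M" "d \<le> M" "1 \<le> M" "0 \<le> M"
  using d_m by (auto simp: B_def M_def)

lemma small: "-1 \<le> x \<Longrightarrow> x \<le> B + 32 * m + 100 \<Longrightarrow> x \<in> words w"
  using d_m by (intro small_word) (auto simp: M_def)

lemma pat_in: "1 \<le> k \<Longrightarrow> k \<le> d \<Longrightarrow> pat k \<in> set D"
  by (simp add: pat_def d_def)

lemma length_F: "1 \<le> k \<Longrightarrow> k \<le> d \<Longrightarrow> int (length (F k)) = plen k"
  by (simp add: F_def plen_def length_f pattern pat_in)

lemma plen_pos: "1 \<le> k \<Longrightarrow> k \<le> d \<Longrightarrow> 1 \<le> plen k"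
  using pattern(2)[OF pat_in] by (cases "pat k") (auto simp: plen_def)

lemma take_Suc_pat:
  assumes "1 \<le> k" "k \<le> d"
  shows "take (nat k) D = take (nat (k - 1)) D @ [pat k]"
proof -
  have "nat k = Suc (nat (k - 1))" "nat (k - 1) < length D" using assms by (auto simp: d_def)
  then show ?thesis by (simp add: take_Suc_conv_app_nth pat_def)
qed

lemma pos_step: "1 \<le> k \<Longrightarrow> k \<le> d \<Longrightarrow> pos (k + 1) = pos k + plen k"
  by (simp add: pos_def take_Suc_pat plen_def)

lemma esum_step: "1 \<le> k \<Longrightarrow> k \<le> d \<Longrightarrow> esum (k + 1) = esum k + int (E (length (pat k)))"
  by (simp add: esum_def take_Suc_pat)

lemma pos_1: "pos 1 = 1 + d" and esum_1: "esum 1 = 0"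
  by (simp_all add: pos_def esum_def)

lemma pos_end: "pos (d + 1) = B" and esum_end: "esum (d + 1) \<le> int (E (total_length D))"
  using E_bound by (simp_all add: pos_def d_def B_def m_def total_length_def esum_def)

lemma pos_mono_aux: "1 \<le> i \<Longrightarrow> i + int n \<le> d + 1 \<Longrightarrow> pos i \<le> pos (i + int n)"
proof (induction n)
  case (Suc n)
  then show ?case using pos_step[of "i + int n"] plen_pos[of "i + int n"] by (simp add: algebra_simps)
qed simp

lemma pos_mono: "1 \<le> i \<Longrightarrow> i \<le> k \<Longrightarrow> k \<le> d + 1 \<Longrightarrow> pos i \<le> pos k"
  using pos_mono_aux[of i "nat (k - i)"] by simp

lemma pos_disjoint: "1 \<le> i \<Longrightarrow> i < k \<Longrightarrow> k \<le> d + 1 \<Longrightarrow> pos i + plen i \<le> pos k"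
  using pos_mono[of "i + 1" k] pos_step[of i] by simp

lemma pos_bounds: "1 \<le> k \<Longrightarrow> k \<le> d + 1 \<Longrightarrow> 1 + d \<le> pos k \<and> pos k \<le> B"
  using pos_mono[of 1 k] pos_mono[of k "d + 1"] pos_1 pos_end d_m by simp

lemma pos_plen: "1 \<le> k \<Longrightarrow> k \<le> d \<Longrightarrow> pos k + plen k \<le> B"
  using pos_disjoint[of k "d + 1"] pos_end by simp

lemma nth_concat_aux:
  "k < length xs \<Longrightarrow> j < length (xs ! k) \<Longrightarrow>
    (\<Sum>x\<leftarrow>take k xs. length x) + j < length (concat xs) \<and>
    concat xs ! ((\<Sum>x\<leftarrow>take k xs. length x) + j) = xs ! k ! j"
proof (induction xs arbitrary: k)
  case (Cons x xs)
  then show ?case by (cases k) (auto simp: nth_append)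
qed simp

definition "lo0 x = (if 0 \<le> x \<and> x < B then input_words D ! nat x else 0)"

definition a0 :: astate where "a0 = \<lparr>rg = (\<lambda>_. 0), lo = lo0, fl = (\<lambda>_ _. 0), en = []\<rparr>"

lemma length_input: "int (length (input_words D)) = B"
  by (simp add: input_words_def B_def d_def m_def total_length_def length_concat)

lemma conc_a0: "conc B a0 = init D"
  by (auto simp: conc_def a0_def init_def lo0_def write_string_def length_input fun_eq_iff)

lemma lo0_0: "lo0 0 = d"
  using d_m by (simp add: lo0_def input_words_def d_def B_def)

lemma lo0_neg: "x < 0 \<Longrightarrow> lo0 x = 0"
  by (simp add: lo0_def)

lemma lo0_len: "1 \<le> k \<Longrightarrow> k \<le> d \<Longrightarrow> lo0 k = plen k"
  using d_m by (auto simp: lo0_def B_def input_words_def nth_append nth_Cons' plen_def pat_def d_def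
      nat_diff_distrib nat_less_iff)

lemma lo0_pat:
  assumes "1 \<le> k" "k \<le> d" "0 \<le> j" "j < plen k"
  shows "lo0 (pos k + j) = pat k ! nat j"
proof -
  have k: "nat (k - 1) < length D" "nat j < length (D ! nat (k - 1))"
    using assms by (auto simp: d_def plen_def pat_def)
  have "nat (pos k + j) = 1 + length D + ((\<Sum>P\<leftarrow>take (nat (k - 1)) D. length P) + nat j)"
    using assms by (simp add: pos_def d_def nat_add_distrib)
  then have "input_words D ! nat (pos k + j) = pat k ! nat j"
    using nth_concat_aux[OF k] by (simp add: input_words_def nth_append pat_def)
  moreover have "0 \<le> pos k + j" "pos k + j < B"
    using assms pos_bounds[of k] pos_plen[of k] d_m by auto
  ultimately show ?thesis by (simp add: lo0_def)
qed

section \<open>Base address, encoding and renaming\<close>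

lemma setup_spec:
  assumes "\<And>a t. rg a 9 = B \<Longrightarrow> rg a 10 = d \<Longrightarrow> lo a = lo0(0 := B) \<Longrightarrow> fl a = (\<lambda>_ _. 0) \<Longrightarrow> en a = [] \<Longrightarrow>
    t \<le> 50 + 50 * d \<Longrightarrow> Q a t"
  shows "wp setup_prog Q a0 0"
proof (rule vc_sound)
  \<comment> \<open>Register 9 starts at \<open>1 + d\<close> and grows by one length per round, so
    it always equals \<open>pos\<close> of the counter and ends at \<open>B\<close>.\<close>
  define I :: "nat \<Rightarrow> astate \<Rightarrow> int \<Rightarrow> bool" where
    "I = (\<lambda>n a t. n = nat (d + 1 - rg a 11) \<and> 1 \<le> rg a 11 \<and> rg a 11 \<le> d + 1 \<and> rg a 10 = d \<and>
      rg a 9 = pos (rg a 11) \<and> lo a = lo0 \<and> fl a = (\<lambda>_ _. 0) \<and> en a = [] \<and>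
      t \<le> 20 + 20 * (rg a 11 - 1))"
  have "wp (Wh (NotE (LtE (Var 10) (Var 11))) setup_body) (vc (SetL (Num 0) (Var 9)) Q) a t"
    if "rg a 11 = 1" "rg a 10 = d" "rg a 9 = 1 + d" "lo a = lo0" "fl a = (\<lambda>_ _. 0)" "en a = []" "t \<le> 20"
    for a t
  proof (rule wp_while[where n = "nat d" and I = I])
    fix n :: nat and a :: astate and t :: int
    let ?k = "rg a 11"
    assume I: "I n a t"
    show "okb a (NotE (LtE (Var 10) (Var 11)))" by simp
    {
      assume "evb a (NotE (LtE (Var 10) (Var 11)))"
      then have k: "1 \<le> ?k" "?k \<le> d" using I by (auto simp: I_def)
      show "wp setup_body (\<lambda>a' t'. \<exists>n'<n. I n' a' t') a
          (t + (1 + costb (NotE (LtE (Var 10) (Var 11)))))"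
        using I k d_m pos_step[OF k] lo0_len[OF k] pos_bounds[of "?k + 1"] plen_pos[OF k] pos_bounds[of ?k]
          B_bounds
        by (intro vc_sound) (auto simp: setup_body_def I_def intro!: small)
    next
      assume "\<not> evb a (NotE (LtE (Var 10) (Var 11)))"
      then have "?k = d + 1" using I by (auto simp: I_def)
      then show "vc (SetL (Num 0) (Var 9)) Q a (t + (1 + costb (NotE (LtE (Var 10) (Var 11)))))"
        using I pos_end d_m B_bounds by (auto intro!: small assms simp: I_def)
    }
  qed (use that pos_1 d_m in \<open>auto simp: I_def\<close>)
  then show "vc setup_prog Q a0 0"
    using d_m lo0_0 B_bounds by (auto simp: setup_prog_def a0_def intro!: small)
qed


lemma read_string_eq:
  assumes "int (length xs) = n" "\<And>j. 0 \<le> j \<Longrightarrow> j < n \<Longrightarrow> g (p + j) = xs ! nat j"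
  shows "read_string g p n = xs"
  using assms(1) assms(2)[of "int _"] by (auto simp: read_string_def intro!: nth_equalityI)

lemma F_words: "1 \<le> k \<Longrightarrow> k \<le> d \<Longrightarrow> set (F k) \<subseteq> words w"
  using symbol_words[OF pat_in, of k 1 "length (pat k)"] plen_pos[of k]
  by (simp add: substr_def F_def plen_def Suc_le_eq)

text \<open>The conclusion \<open>en a' = D\<close> fixes the handles of later re-encodings: pattern
  \<open>k\<close> is known under \<open>k - 1\<close>. Neighbouring patterns occupy disjoint
  intervals, so encoding one in place leaves the others intact.\<close>

lemma encode_spec:
  assumes a: "rg a 9 = B" "rg a 10 = d" "lo a = lo0(0 := B)" "fl a = (\<lambda>_ _. 0)" "en a = []"
    and Q: "\<And>a' t'. rg a' 9 = B \<Longrightarrow> rg a' 10 = d \<Longrightarrow> lo a' 0 = B \<Longrightarrow>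
      (\<And>i. 1 \<le> i \<Longrightarrow> i \<le> d \<Longrightarrow> lo a' i = plen i) \<Longrightarrow> (\<And>x. x < 0 \<Longrightarrow> lo a' x = 0) \<Longrightarrow>
      (\<And>i j. 1 \<le> i \<Longrightarrow> i \<le> d \<Longrightarrow> 0 \<le> j \<Longrightarrow> j < plen i \<Longrightarrow> lo a' (pos i + j) = F i ! nat j) \<Longrightarrow>
      (\<And>i. 1 \<le> i \<Longrightarrow> i \<le> d \<Longrightarrow> fl a' START i = pos i - 1 \<and> fl a' NEXT i = i - 1) \<Longrightarrow>
      fl a' LIST = (\<lambda>_. 0)(0 := d) \<Longrightarrow>
      (\<And>j. 3 \<le> j \<Longrightarrow> fl a' j = (\<lambda>_. 0)) \<Longrightarrow> en a' = D \<Longrightarrow>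
      t' \<le> t + 50 + 50 * d + int (E (total_length D)) \<Longrightarrow> Q a' t'"
  shows "wp encode_prog Q a t"
proof (rule vc_sound)
  define I :: "nat \<Rightarrow> astate \<Rightarrow> int \<Rightarrow> bool" where
    "I = (\<lambda>n a' t'. n = nat (d + 1 - rg a' 11) \<and> 1 \<le> rg a' 11 \<and> rg a' 11 \<le> d + 1 \<and>
      rg a' 9 = B \<and> rg a' 10 = d \<and> rg a' 12 = pos (rg a' 11) \<and>
      en a' = take (nat (rg a' 11 - 1)) D \<and> lo a' 0 = B \<and>
      (\<forall>i. 1 \<le> i \<longrightarrow> i \<le> d \<longrightarrow> lo a' i = plen i) \<and> (\<forall>x. x < 0 \<longrightarrow> lo a' x = 0) \<and>
      (\<forall>i j. 1 \<le> i \<longrightarrow> i \<le> d \<longrightarrow> 0 \<le> j \<longrightarrow> j < plen i \<longrightarrow>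
        lo a' (pos i + j) = (if i < rg a' 11 then F i else pat i) ! nat j) \<and>
      (\<forall>i. 1 \<le> i \<longrightarrow> i < rg a' 11 \<longrightarrow> fl a' START i = pos i - 1 \<and> fl a' NEXT i = i - 1) \<and>
      (\<forall>j. 2 \<le> j \<longrightarrow> fl a' j = (\<lambda>_. 0)) \<and>
      t' \<le> t + 20 + 50 * (rg a' 11 - 1) + esum (rg a' 11))"
  have "wp (Wh (NotE (LtE (Var 10) (Var 11))) encode_body) (vc (SetF LIST (Num 0) (Var 10)) Q) a' t'"
    if "I (nat d) a' t'" for a' t'
    using that
  proof (rule wp_while[where I = I])
    fix n :: nat and a :: astate and t' :: int
    let ?k = "rg a 11"
    assume I: "I n a t'"
    show "okb a (NotE (LtE (Var 10) (Var 11)))" by simp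
    {
      assume "evb a (NotE (LtE (Var 10) (Var 11)))"
      then have k: "1 \<le> ?k" "?k \<le> d" using I by (auto simp: I_def)
      have rd: "read_string (lo a) (pos ?k) (plen ?k) = pat ?k"
        using I k by (intro read_string_eq) (auto simp: I_def plen_def)
      have frame: "x < pos ?k \<or> pos ?k + plen ?k \<le> x \<Longrightarrow>
          write_string (lo a) (pos ?k) (f (pat ?k)) x = lo a x" for x
        using length_F[OF k] by (auto simp: write_string_def F_def)
      have here: "0 \<le> j \<Longrightarrow> j < plen ?k \<Longrightarrow>
          write_string (lo a) (pos ?k) (f (pat ?k)) (pos ?k + j) = F ?k ! nat j" for j
        using length_F[OF k] by (auto simp: write_string_def F_def)
      have other: "write_string (lo a) (pos ?k) (f (pat ?k)) (pos i + j) = lo a (pos i + j)"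
        if "1 \<le> i" "i \<le> d" "i \<noteq> ?k" "0 \<le> j" "j < plen i" for i j
        using that k pos_disjoint[of i ?k] pos_disjoint[of ?k i]
        by (intro frame, cases "i < ?k") auto
      have pat: "pat ?k \<in> lists \<Sigma>" by (rule pattern(1)[OF pat_in[OF k]])
      have new: "write_string (lo a) (pos ?k) (f (pat ?k)) (pos i + j) =
          (if i < ?k + 1 then F i else pat i) ! nat j"
        if "1 \<le> i" "i \<le> d" "0 \<le> j" "j < plen i" for i j
        using that I here[of j] other[of i j] by (cases "i = ?k") (auto simp: I_def)
      have low: "write_string (lo a) (pos ?k) (f (pat ?k)) x = lo a x" if "x < 1 + d" for x
        using that pos_bounds[of ?k] k by (intro frame) auto
      have tk: "take (nat ?k) D = take (nat (?k - 1)) D @ [pat ?k]" by (rule take_Suc_pat[OF k])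
      show "wp encode_body (\<lambda>a' t'. \<exists>n'<n. I n' a' t') a
          (t' + (1 + costb (NotE (LtE (Var 10) (Var 11)))))"
        using I k d_m B_bounds pos_step[OF k] esum_step[OF k] pos_bounds[of ?k] pos_plen[OF k]
          plen_pos[OF k] length_F[OF k] F_words[OF k] pat rd new low tk
        unfolding I_def
        by (intro vc_sound)
          (auto simp: encode_body_def Let_def length_f pattern pat_in F_def plen_def intro!: small)
    next
      assume "\<not> evb a (NotE (LtE (Var 10) (Var 11)))"
      then have "?k = d + 1" using I by (auto simp: I_def)
      then show "vc (SetF LIST (Num 0) (Var 10)) Q a (t' + (1 + costb (NotE (LtE (Var 10) (Var 11)))))"
        using I d_m B_bounds esum_end
        by (auto intro!: Q small simp: I_def fun_eq_iff) (auto simp: d_def)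
    }
  qed
  moreover have "I (nat d) (a\<lparr>rg := (rg a)(12 := 1 + d, 11 := 1)\<rparr>) (6 + t)"
    using a d_m B_bounds pos_1 esum_1 lo0_len lo0_neg lo0_pat pos_bounds unfolding I_def
    by (auto simp: d_def) smt+
  ultimately show "vc encode_prog Q a t"
    using a d_m B_bounds by (auto simp: encode_prog_def intro!: small)
qed


text \<open>\<open>lo'\<close> is the memory below \<open>B\<close> once the symbols are renamed: the codes of the symbols seen are
  pairwise distinct numbers between 4 and \<open>nb + 3\<close>.\<close>

definition code :: "(int \<Rightarrow> int) \<Rightarrow> int \<Rightarrow> int" where
  "code lo' c = lo' (bkt c) + rsd c"

text \<open>Distinct nonzero bases that are multiples of 4 reserve disjoint blocks of four codes,
  one code per residue.\<close>

definition sym_table :: "(int \<Rightarrow> int) \<Rightarrow> int \<Rightarrow> bool" where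
  "sym_table lo' nb \<longleftrightarrow> 0 \<le> nb \<and> 4 dvd nb \<and>
     (\<forall>z < 0. lo' z = 0 \<or> 4 \<le> lo' z \<and> lo' z \<le> nb \<and> 4 dvd lo' z) \<and>
     (\<forall>z < 0. \<forall>z' < 0. lo' z = lo' z' \<longrightarrow> lo' z \<noteq> 0 \<longrightarrow> z = z')"

definition renamed :: "(int \<Rightarrow> int) \<Rightarrow> int \<Rightarrow> bool" where
  "renamed lo' nb \<longleftrightarrow> sym_table lo' nb \<and> nb \<le> 4 * m \<and> lo' 0 = B \<and>
     (\<forall>i. 1 \<le> i \<longrightarrow> i \<le> d \<longrightarrow> lo' i = plen i) \<and>
     (\<forall>i j. 1 \<le> i \<longrightarrow> i \<le> d \<longrightarrow> 0 \<le> j \<longrightarrow> j < plen i \<longrightarrow>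
        lo' (pos i + j) = code lo' (F i ! nat j) \<and> lo' (bkt (F i ! nat j)) \<noteq> 0)"

lemma sym_table_insert:
  assumes "sym_table h nb"
  shows "sym_table (h(z0 := nb + 4)) (nb + 4)" (is "sym_table ?h _")
proof -
  have nb: "0 \<le> nb" "4 dvd nb"
    and v: "\<And>z. z < 0 \<Longrightarrow> h z = 0 \<or> 4 \<le> h z \<and> h z \<le> nb \<and> 4 dvd h z"
    and i: "\<And>z z'. z < 0 \<Longrightarrow> z' < 0 \<Longrightarrow> h z = h z' \<Longrightarrow> h z \<noteq> 0 \<Longrightarrow> z = z'"
    using assms unfolding sym_table_def by blast+
  have "z = z'" if "z < 0" "z' < 0" "?h z = ?h z'" "?h z \<noteq> 0" for z z'
    using v[of z] v[of z'] i[of z z'] that nb by (auto split: if_splits)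
  moreover have "?h z = 0 \<or> 4 \<le> ?h z \<and> ?h z \<le> nb + 4 \<and> 4 dvd ?h z" if "z < 0" for z
    using v[of z] that nb by auto
  ultimately show ?thesis unfolding sym_table_def using nb by auto
qed

lemma code_inj:
  assumes "sym_table lo' nb" "lo' (bkt c) \<noteq> 0" "lo' (bkt c') \<noteq> 0" "code lo' c = code lo' c'"
  shows "c = c'"
proof -
  have neg: "bkt c < 0" "bkt c' < 0" by (rule bkt_neg)+
  with assms(1) have "4 dvd lo' (bkt c)" "4 dvd lo' (bkt c')"
    by (auto simp: sym_table_def)
  then have "lo' (bkt c) = lo' (bkt c')"
    using assms(4) rsd_bounds[of c] rsd_bounds[of c'] unfolding code_def by presburger
  then show ?thesis
    using assms neg bkt_rsd_inj[of c c'] by (auto simp: sym_table_def code_def)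
qed

lemma code_bounds:
  assumes "sym_table lo' nb" "lo' (bkt c) \<noteq> 0"
  shows "4 \<le> code lo' c" "code lo' c < nb + 4"
  using assms bkt_neg[of c] rsd_bounds[of c] by (auto simp: sym_table_def code_def)

lemma word_div_2: "c \<in> words w \<Longrightarrow> c div 2 \<in> words w \<and> - 1 - c div 2 \<in> words w"
  by (auto simp: words_def)

lemma vc_locate:
  assumes "rg a 1 \<in> words w"
    "Q (a\<lparr>rg := (rg a)(2 := bkt (rg a 1), 3 := rsd (rg a 1))\<rparr>) (14 + t)"
  shows "vc locate Q a t"
  using assms word_div_2[OF assms(1)] B_bounds rsd_bounds[of "rg a 1"] d_m
  by (auto simp: locate_def bkt_def rsd_def intro!: small)

lemma bkt_word: "c \<in> words w \<Longrightarrow> bkt c \<in> words w"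
  using word_div_2[of c] by (auto simp: bkt_def)

text \<open>A base never changes once assigned, so codes written early remain correct for the final
  table. At most one base is created per scanned symbol, which gives the bound \<open>4 * m\<close>
  on the largest base.\<close>

lemma rename_spec:
  assumes a: "rg a 9 = B" "rg a 10 = d" "lo a 0 = B"
      "\<And>i. 1 \<le> i \<Longrightarrow> i \<le> d \<Longrightarrow> lo a i = plen i" "\<And>x. x < 0 \<Longrightarrow> lo a x = 0"
      "\<And>i j. 1 \<le> i \<Longrightarrow> i \<le> d \<Longrightarrow> 0 \<le> j \<Longrightarrow> j < plen i \<Longrightarrow> lo a (pos i + j) = F i ! nat j"
    and Q: "\<And>a' t'. rg a' 9 = B \<Longrightarrow> rg a' 10 = d \<Longrightarrow> renamed (lo a') (rg a' 14) \<Longrightarrow> fl a' = fl a \<Longrightarrow>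
      en a' = en a \<Longrightarrow> t' \<le> t + 100 + 100 * m \<Longrightarrow> Q a' t'"
  shows "wp rename_prog Q a t"
proof (rule vc_sound)
  define g where "g = lo a"
  define I :: "nat \<Rightarrow> astate \<Rightarrow> int \<Rightarrow> bool" where
    "I = (\<lambda>n a' t'. n = nat (B - rg a' 12) \<and> 1 + d \<le> rg a' 12 \<and> rg a' 12 \<le> B \<and>
      rg a' 9 = B \<and> rg a' 10 = d \<and> sym_table (lo a') (rg a' 14) \<and>
      rg a' 14 \<le> 4 * (rg a' 12 - (1 + d)) \<and> fl a' = fl a \<and> en a' = en a \<and>
      (\<forall>x. 0 \<le> x \<longrightarrow> x \<le> d \<longrightarrow> lo a' x = g x) \<and> (\<forall>x. rg a' 12 \<le> x \<longrightarrow> x < B \<longrightarrow> lo a' x = g x) \<and>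
      (\<forall>x. 1 + d \<le> x \<longrightarrow> x < rg a' 12 \<longrightarrow> lo a' x = code (lo a') (g x) \<and> lo a' (bkt (g x)) \<noteq> 0) \<and>
      t' \<le> t + 20 + 80 * (rg a' 12 - (1 + d)))"
  \<comment> \<open>The scan ignores pattern boundaries; an address in its range is attributed to
    the pattern whose interval contains it.\<close>
  have g_word: "g x \<in> words w" if x: "1 + d \<le> x" "x < B" for x
  proof -
    have "\<exists>i. 1 \<le> i \<and> i \<le> d \<and> pos i \<le> x \<and> x < pos i + plen i"
      if "1 \<le> k" "k \<le> d + 1" "x < pos k" for k
      using that
    proof (induction "nat k" arbitrary: k)
      case (Suc n)
      then have "1 < k" using x pos_1 by (cases "k = 1") auto
      with Suc have "1 \<le> k - 1" "k - 1 \<le> d" "n = nat (k - 1)" by auto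
      then show ?case
        using Suc pos_step[of "k - 1"] by (cases "x < pos (k - 1)") (auto intro: exI[of _ "k - 1"])
    qed auto
    from this[of "d + 1"] obtain i where i: "1 \<le> i" "i \<le> d" "pos i \<le> x" "x < pos i + plen i"
      using x pos_end d_m by auto
    then have "g x = F i ! nat (x - pos i)" using a(6)[of i "x - pos i"] by (simp add: g_def)
    moreover have "nat (x - pos i) < length (F i)" using i length_F[of i] by simp
    ultimately show ?thesis using F_words[OF i(1,2)] by (metis nth_mem subsetD)
  qed
  have "wp (Wh (LtE (Var 12) (Var 9)) rename_body) Q a' t'" if "I (nat m) a' t'" for a' t'
    using that
  proof (rule wp_while[where I = I])
    fix n :: nat and a' :: astate and t' :: int
    let ?x = "rg a' 12" and ?nb = "rg a' 14"
    assume I: "I n a' t'"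
    show "okb a' (LtE (Var 12) (Var 9))" by simp
    {
      assume "evb a' (LtE (Var 12) (Var 9))"
      then have x: "1 + d \<le> ?x" "?x < B" using I by (auto simp: I_def)
      define c where "c = g ?x"
      have c: "c \<in> words w" unfolding c_def by (rule g_word[OF x])
      have lo_x: "lo a' ?x = c" using I x by (auto simp: I_def c_def)
      have tab: "sym_table (lo a') ?nb" using I by (auto simp: I_def)
      have nb: "0 \<le> ?nb" "4 dvd ?nb" "?nb \<le> 4 * m"
        using I x by (auto simp: I_def sym_table_def B_def)
      \<comment> \<open>\<open>h\<close> is the low memory after a possible insertion into the
        table, and \<open>h'\<close> below also has the scanned symbol replaced. The two writes
        cannot interfere, as one address is negative and the other is not.\<close>
      define h where "h = (if lo a' (bkt c) = 0 then (lo a')(bkt c := ?nb + 4) else lo a')"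
      define nb' where "nb' = (if lo a' (bkt c) = 0 then ?nb + 4 else ?nb)"
      have hb: "h (bkt c) \<noteq> 0" using nb by (auto simp: h_def)
      have h_old: "lo a' z \<noteq> 0 \<Longrightarrow> h z = lo a' z" for z by (auto simp: h_def)
      have tab_h: "sym_table h nb'"
        using tab sym_table_insert[OF tab, of "bkt c"] unfolding h_def nb'_def by simp
      define h' where "h' = h(?x := code h c)"
      have h'_neg: "z < 0 \<Longrightarrow> h' z = h z" for z using x d_m by (auto simp: h'_def)
      have tab': "sym_table h' nb'" using tab_h h'_neg unfolding sym_table_def by metis
      have code': "code h' y = code h y" for y by (simp add: code_def h'_neg bkt_neg)
      have code_old: "lo a' (bkt y) \<noteq> 0 \<Longrightarrow> code h y = code (lo a') y" for y
        by (simp add: code_def h_old)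
      have done': "h' y = code h' (g y) \<and> h' (bkt (g y)) \<noteq> 0" if "1 + d \<le> y" "y < ?x + 1" for y
      proof (cases "y = ?x")
        case True
        then show ?thesis using hb by (simp add: code' c_def[symmetric] h'_neg bkt_neg) (simp add: h'_def)
      next
        case False
        then have y: "lo a' y = code (lo a') (g y)" "lo a' (bkt (g y)) \<noteq> 0"
          using I that by (auto simp: I_def)
        have "h' y = lo a' y" using False that bkt_neg[of c] d_m by (auto simp: h'_def h_def)
        then show ?thesis using y by (simp add: code' code_old h'_neg bkt_neg h_old)
      qed
      have keep: "h' y = lo a' y" if "0 \<le> y" "y \<noteq> ?x" for y
        using that bkt_neg[of c] by (auto simp: h'_def h_def)
      have "I (nat (B - (?x + 1))) b s"
        if "rg b 9 = B" "rg b 10 = d" "rg b 12 = ?x + 1" "rg b 14 = nb'" "s \<le> t' + 80"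
          "lo b = h'" "fl b = fl a'" "en b = en a'" for b s
        using that I x d_m keep done' tab' nb unfolding I_def nb'_def by auto
      moreover have "h' = (if lo a' (bkt c) = 0
          then (lo a')(bkt c := ?nb + 4, ?x := ?nb + 4 + rsd c) else (lo a')(?x := lo a' (bkt c) + rsd c))"
        by (simp add: h'_def h_def code_def)
      moreover have "n > nat (B - (?x + 1))" using I x by (auto simp: I_def)
      moreover have "lo a' (bkt c) = 0 \<or> 4 \<le> lo a' (bkt c) \<and> lo a' (bkt c) \<le> ?nb"
        using tab bkt_neg[of c] by (auto simp: sym_table_def)
      moreover have "rg a' 9 = B" "rg a' 10 = d" using I by (auto simp: I_def)
      ultimately show "wp rename_body (\<lambda>a' t'. \<exists>n'<n. I n' a' t') a'
          (t' + (1 + costb (LtE (Var 12) (Var 9))))"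
        using c lo_x x B_bounds nb d_m bkt_word[OF c] bkt_neg[of c] rsd_bounds[of c]
        by (intro vc_sound)
          (auto simp: rename_body_def nb'_def intro!: vc_locate exI[of _ "nat (B - (?x + 1))"],
            auto intro!: small)
    next
      assume "\<not> evb a' (LtE (Var 12) (Var 9))"
      then have x: "?x = B" using I by (auto simp: I_def)
      have low: "lo a' i = plen i" if "1 \<le> i" "i \<le> d" for i
        using I that a(4) by (auto simp: I_def g_def)
      have "lo a' (pos i + j) = code (lo a') (F i ! nat j) \<and> lo a' (bkt (F i ! nat j)) \<noteq> 0"
        if ij: "1 \<le> i" "i \<le> d" "0 \<le> j" "j < plen i" for i j
      proof -
        have "1 + d \<le> pos i + j" "pos i + j < ?x"
          using ij pos_bounds[of i] pos_plen[of i] x by auto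
        then have "lo a' (pos i + j) = code (lo a') (g (pos i + j)) \<and> lo a' (bkt (g (pos i + j))) \<noteq> 0"
          using I unfolding I_def by blast
        then show ?thesis using a(6)[OF ij] by (simp add: g_def)
      qed
      then have "renamed (lo a') ?nb"
        using I x low a(3) d_m unfolding renamed_def by (auto simp: I_def g_def B_def)
      then show "Q a' (t' + (1 + costb (LtE (Var 12) (Var 9))))"
        using I x by (intro Q) (auto simp: I_def B_def)
    }
  qed
  moreover have "I (nat m) (a\<lparr>rg := (rg a)(12 := 1 + d, 14 := 0)\<rparr>) (6 + t)"
    using a d_m unfolding I_def by (auto simp: B_def g_def sym_table_def)
  ultimately show "vc rename_prog Q a t"
    using a d_m B_bounds by (auto simp: rename_prog_def intro!: small)
qed

end

section \<open>Linked lists\<close>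

primrec chain :: "(int \<Rightarrow> int) \<Rightarrow> int \<Rightarrow> int list \<Rightarrow> bool" where
  "chain nxt p [] \<longleftrightarrow> p = 0"
| "chain nxt p (x # xs) \<longleftrightarrow> p = x \<and> x \<noteq> 0 \<and> chain nxt (nxt x) xs"

text \<open>The order within the lists is irrelevant below. Distinctness is kept so that the
  cardinality of the set bounds the rounds of a traversal.\<close>

definition chset :: "(int \<Rightarrow> int) \<Rightarrow> int \<Rightarrow> int set \<Rightarrow> bool" where
  "chset nxt p A \<longleftrightarrow> (\<exists>xs. chain nxt p xs \<and> distinct xs \<and> set xs = A)"

lemma chset_empty: "chset nxt p {} \<longleftrightarrow> p = 0"
  by (simp add: chset_def)

lemma chset_0:
  assumes "chset nxt 0 A"
  shows "A = {}"
proof -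
  obtain xs where "chain nxt 0 xs" "set xs = A" using assms by (auto simp: chset_def)
  then show ?thesis by (cases xs) auto
qed

lemma chset_finite: "chset nxt p A \<Longrightarrow> finite A"
  by (auto simp: chset_def)

lemma chain_upd: "x \<notin> set xs \<Longrightarrow> chain (nxt(x := z)) p xs = chain nxt p xs"
  by (induction xs arbitrary: p) auto

lemma chset_upd: "x \<notin> A \<Longrightarrow> chset (nxt(x := z)) p A = chset nxt p A"
  unfolding chset_def by (metis chain_upd)

lemma chset_push:
  assumes "chset nxt p A" "x \<notin> A" "x \<noteq> 0"
  shows "chset (nxt(x := p)) x (insert x A)"
proof -
  obtain xs where "chain nxt p xs" "distinct xs" "set xs = A"
    using assms by (auto simp: chset_def)
  then show ?thesis
    using assms unfolding chset_def by (intro exI[of _ "x # xs"]) (auto simp: chain_upd)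
qed

lemma chset_pop:
  assumes "chset nxt p A" "p \<noteq> 0"
  shows "p \<in> A" "chset nxt (nxt p) (A - {p})"
proof -
  obtain xs where xs: "chain nxt p xs" "distinct xs" "set xs = A"
    using assms by (auto simp: chset_def)
  with assms(2) obtain ys where ys: "xs = p # ys" "chain nxt (nxt p) ys" by (cases xs) auto
  then show "p \<in> A" using xs by auto
  show "chset nxt (nxt p) (A - {p})" unfolding chset_def using xs ys by (intro exI[of _ ys]) auto
qed

lemma chset_interval:
  assumes "\<And>i. 1 \<le> i \<Longrightarrow> i \<le> int n \<Longrightarrow> nxt i = i - 1"
  shows "chset nxt (int n) {1..int n}"
  using assms
proof (induction n)
  case (Suc n)
  then have "chset nxt (int n) {1..int n}" by auto
  from chset_push[OF this, of "int (Suc n)"]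
  have "chset (nxt(int (Suc n) := int n)) (int (Suc n)) (insert (int (Suc n)) {1..int n})" by auto
  moreover have "nxt(int (Suc n) := int n) = nxt" using Suc.prems[of "int (Suc n)"] by auto
  moreover have "insert (int (Suc n)) {1..int n} = {1..int (Suc n)}" by auto
  ultimately show ?case by simp
qed (simp add: chset_empty)

section \<open>Building the trie\<close>

text \<open>The child of \<open>v\<close> for a symbol with code \<open>a\<close> can only be the last node created for \<open>a\<close>, since the
  parents of the nodes are increasing.\<close>

definition trie_inner :: cmd where
  "trie_inner =
    18 ::= Var 17 ;; 17 ::= Fld NEXT (Var 18) ;;
    Ite (EqE (Low (Var 18)) (Var 19))
      (SetF NEXTE (Var 18) (Fld ENDS (Var 16)) ;; SetF ENDS (Var 16) (Var 18))
      (20 ::= Low (Fld START (Var 18) .+ (Var 19 .+ Num 1)) ;;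
       21 ::= Fld LC (Var 20) ;;
       Ite (EqE (Fld PAR (Var 21)) (Var 16)) Nop
         (21 ::= Var 15 ;; 15 ::= Var 15 .+ Num 1 ;;
          SetF PAR (Var 21) (Var 16) ;; SetF SYM (Var 21) (Var 20) ;; SetF REP (Var 21) (Var 18) ;;
          SetF DEP (Var 21) (Var 19 .+ Num 1) ;; SetF NXS (Var 21) (Fld LC (Var 20)) ;;
          SetF LC (Var 20) (Var 21)) ;;
       SetF NEXT (Var 18) (Fld LIST (Var 21)) ;; SetF LIST (Var 21) (Var 18))"

definition trie_outer :: cmd where
  "trie_outer =
    SetF FIRST (Var 16) (Var 15) ;; SetF CUR (Var 16) (Var 15) ;;
    17 ::= Fld LIST (Var 16) ;; 19 ::= Fld DEP (Var 16) ;;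
    Wh (NotE (EqE (Var 17) (Num 0))) trie_inner ;;
    SetF LAST (Var 16) (Var 15) ;; 16 ::= Var 16 .+ Num 1"

text \<open>The parent -1 of the root is a sentinel: an unset entry of \<open>LC\<close> is 0, and
  the test of \<open>PAR\<close> at node 0 then fails for every current node, so symbols without a
  node need no separate case.\<close>

definition trie_prog :: cmd where
  "trie_prog =
    15 ::= Num 1 ;; SetF PAR (Num 0) (Num (-1)) ;; 16 ::= Num 0 ;;
    Wh (LtE (Var 16) (Var 15)) trie_outer"

locale loaded = construction \<Sigma> \<Pi> r f D w E R
  for \<Sigma> \<Pi> :: "int set" and r f D w E R +
  fixes lo1 :: "int \<Rightarrow> int" and nb :: int
  assumes renamed: "renamed lo1 nb"
begin

abbreviation "cd \<equiv> code lo1"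

lemma table: "sym_table lo1 nb" "0 \<le> nb" "nb \<le> 4 * m" "lo1 0 = B"
    "1 \<le> i \<Longrightarrow> i \<le> d \<Longrightarrow> lo1 i = plen i"
    "1 \<le> i \<Longrightarrow> i \<le> d \<Longrightarrow> 0 \<le> j \<Longrightarrow> j < plen i \<Longrightarrow> lo1 (pos i + j) = cd (F i ! nat j)"
    "1 \<le> i \<Longrightarrow> i \<le> d \<Longrightarrow> 0 \<le> j \<Longrightarrow> j < plen i \<Longrightarrow> lo1 (bkt (F i ! nat j)) \<noteq> 0"
  using renamed unfolding renamed_def sym_table_def by auto

section \<open>Invariants of the breadth-first construction\<close>

definition "thru S = {k. 1 \<le> k \<and> k \<le> d \<and> prefix S (F k)}"
definition "ends S = {k. 1 \<le> k \<and> k \<le> d \<and> F k = S}"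

lemma seen:
  assumes "c \<in> set (F k)" "1 \<le> k" "k \<le> d"
  shows "lo1 (bkt c) \<noteq> 0"
proof -
  obtain j where "j < length (F k)" "c = F k ! j" using assms(1) by (auto simp: in_set_conv_nth)
  then show ?thesis using table(7)[OF assms(2,3), of "int j"] length_F[OF assms(2,3)] by simp
qed

lemma cd_inj:
  assumes "c \<in> set (F k)" "1 \<le> k" "k \<le> d" "c' \<in> set (F k')" "1 \<le> k'" "k' \<le> d" "cd c = cd c'"
  shows "c = c'"
  using code_inj[OF table(1) seen[OF assms(1-3)] seen[OF assms(4-6)] assms(7)] .

lemma cd_bounds: "c \<in> set (F k) \<Longrightarrow> 1 \<le> k \<Longrightarrow> k \<le> d \<Longrightarrow> 4 \<le> cd c \<and> cd c < nb + 4"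
  using code_bounds[OF table(1) seen] by blast

text \<open>The ghost map \<open>ns\<close> names the state of each node. Monotonicity of the
  parents, the last conjunct, is the trace of breadth-first order that makes the lookup through
  \<open>LC\<close> correct.\<close>

definition tree :: "int \<Rightarrow> (int \<Rightarrow> int list) \<Rightarrow> (nat \<Rightarrow> int \<Rightarrow> int) \<Rightarrow> bool" where
  "tree N ns h \<longleftrightarrow> 1 \<le> N \<and> ns 0 = [] \<and> h PAR 0 = -1 \<and> h DEP 0 = 0 \<and> inj_on ns {0..<N} \<and>
    (\<forall>u. 1 \<le> u \<longrightarrow> u < N \<longrightarrow> 0 \<le> h PAR u \<and> h PAR u < u \<and> ns u \<noteq> [] \<and>
      ns (h PAR u) = butlast (ns u) \<and> h SYM u = cd (last (ns u)) \<and>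
      1 \<le> h REP u \<and> h REP u \<le> d \<and> prefix (ns u) (F (h REP u)) \<and>
      h DEP u = int (length (ns u))) \<and>
    (\<forall>u u'. 1 \<le> u \<longrightarrow> u < u' \<longrightarrow> u' < N \<longrightarrow> h PAR u \<le> h PAR u')"

definition sym_chains :: "int \<Rightarrow> (nat \<Rightarrow> int \<Rightarrow> int) \<Rightarrow> bool" where
  "sym_chains N h \<longleftrightarrow>
    (\<forall>a. chset (h NXS) (h LC a) {u. 1 \<le> u \<and> u < N \<and> h SYM u = a}) \<and>
    (\<forall>u. 1 \<le> u \<longrightarrow> u < N \<longrightarrow> u \<le> h LC (h SYM u))"

text \<open>The last conjunct says that each pattern continuing past a finished node has a child to
  continue in; completeness of the trie rests on it. \<open>CUR\<close> equals \<open>FIRST\<close>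
  in preparation for the sorting phase.\<close>

definition finished :: "int \<Rightarrow> int \<Rightarrow> (int \<Rightarrow> int list) \<Rightarrow> (nat \<Rightarrow> int \<Rightarrow> int) \<Rightarrow> bool" where
  "finished v N ns h \<longleftrightarrow> (\<forall>i. 0 \<le> i \<longrightarrow> i < v \<longrightarrow>
    1 \<le> h FIRST i \<and> h FIRST i \<le> h LAST i \<and> h LAST i \<le> N \<and> h CUR i = h FIRST i \<and>
    (\<forall>u. 1 \<le> u \<longrightarrow> u < N \<longrightarrow> (h PAR u = i \<longleftrightarrow> h FIRST i \<le> u \<and> u < h LAST i)) \<and>
    chset (h NEXTE) (h ENDS i) (ends (ns i)) \<and>
    (\<forall>k \<in> thru (ns i). F k \<noteq> ns i \<longrightarrow> (\<exists>u. 1 \<le> u \<and> u < N \<and> h PAR u = i \<and> prefix (ns u) (F k))))"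

text \<open>\<open>A\<close> is the set of patterns of node \<open>v\<close> that are not yet handed
  on; only the lists of its children are incomplete by \<open>A\<close>. Disjointness of the other
  unprocessed nodes, \<open>v\<close> included, is what allows one array \<open>NEXT\<close> to hold
  all lists.\<close>

definition pending :: "int \<Rightarrow> int \<Rightarrow> (int \<Rightarrow> int list) \<Rightarrow> int set \<Rightarrow> (nat \<Rightarrow> int \<Rightarrow> int) \<Rightarrow> bool" where
  "pending v N ns A h \<longleftrightarrow>
    (\<forall>i. v < i \<longrightarrow> i < N \<longrightarrow>
      chset (h NEXT) (h LIST i) (if h PAR i = v then thru (ns i) - A else thru (ns i))) \<and>
    (\<forall>i i'. v \<le> i \<longrightarrow> i < i' \<longrightarrow> i' < N \<longrightarrow> h PAR i \<noteq> v \<longrightarrow> h PAR i' \<noteq> v \<longrightarrow> thru (ns i) \<inter> thru (ns i') = {}) \<and>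
    (\<forall>i. N \<le> i \<longrightarrow> h LIST i = 0) \<and> (\<forall>i. v < i \<longrightarrow> h ENDS i = 0)"

definition current :: "int \<Rightarrow> int \<Rightarrow> (int \<Rightarrow> int list) \<Rightarrow> int set \<Rightarrow> (nat \<Rightarrow> int \<Rightarrow> int) \<Rightarrow> bool" where
  "current v N ns A h \<longleftrightarrow> 0 \<le> v \<and> v < N \<and> A \<subseteq> thru (ns v) \<and>
    1 \<le> h FIRST v \<and> h FIRST v \<le> N \<and> h CUR v = h FIRST v \<and>
    (\<forall>u. 1 \<le> u \<longrightarrow> u < N \<longrightarrow> h PAR u \<le> v \<and> (h PAR u = v \<longleftrightarrow> h FIRST v \<le> u)) \<and>
    chset (h NEXTE) (h ENDS v) (ends (ns v) - A) \<and>
    (\<forall>k \<in> thru (ns v) - A. F k \<noteq> ns v \<longrightarrow>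
      (\<exists>u. 1 \<le> u \<and> u < N \<and> h PAR u = v \<and> prefix (ns u) (F k)))"

definition inner :: "int \<Rightarrow> int \<Rightarrow> (int \<Rightarrow> int list) \<Rightarrow> int set \<Rightarrow> int \<Rightarrow> (nat \<Rightarrow> int \<Rightarrow> int) \<Rightarrow> bool" where
  "inner v N ns A q h \<longleftrightarrow> tree N ns h \<and> sym_chains N h \<and> finished v N ns h \<and>
    pending v N ns A h \<and> current v N ns A h \<and> chset (h NEXT) q A"

definition outer :: "int \<Rightarrow> int \<Rightarrow> (int \<Rightarrow> int list) \<Rightarrow> (nat \<Rightarrow> int \<Rightarrow> int) \<Rightarrow> bool" where
  "outer v N ns h \<longleftrightarrow> tree N ns h \<and> sym_chains N h \<and> finished v N ns h \<and> 0 \<le> v \<and> v \<le> N \<and>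
    (\<forall>u. 1 \<le> u \<longrightarrow> u < N \<longrightarrow> h PAR u < v) \<and>
    (\<forall>i. v \<le> i \<longrightarrow> i < N \<longrightarrow> chset (h NEXT) (h LIST i) (thru (ns i))) \<and>
    (\<forall>i i'. v \<le> i \<longrightarrow> i < i' \<longrightarrow> i' < N \<longrightarrow> thru (ns i) \<inter> thru (ns i') = {}) \<and>
    (\<forall>i. N \<le> i \<longrightarrow> h LIST i = 0) \<and> (\<forall>i. v \<le> i \<longrightarrow> h ENDS i = 0)"

lemma treeD:
  assumes "tree N ns h"
  shows "1 \<le> N" "ns 0 = []" "h PAR 0 = -1" "h DEP 0 = 0" "inj_on ns {0..<N}"
    "1 \<le> u \<Longrightarrow> u < N \<Longrightarrow> 0 \<le> h PAR u \<and> h PAR u < u \<and> ns u \<noteq> [] \<and>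
      ns (h PAR u) = butlast (ns u) \<and> h SYM u = cd (last (ns u)) \<and>
      1 \<le> h REP u \<and> h REP u \<le> d \<and> prefix (ns u) (F (h REP u)) \<and> h DEP u = int (length (ns u))"
    "1 \<le> u \<Longrightarrow> u < u' \<Longrightarrow> u' < N \<Longrightarrow> h PAR u \<le> h PAR u'"
  using assms unfolding tree_def by blast+

lemma tree_eq: "tree N ns h \<Longrightarrow> 0 \<le> i \<Longrightarrow> i < N \<Longrightarrow> 0 \<le> j \<Longrightarrow> j < N \<Longrightarrow> ns i = ns j \<Longrightarrow> i = j"
  using treeD(5)[of N ns h] by (auto dest: inj_onD)

lemma tree_dep: "tree N ns h \<Longrightarrow> 0 \<le> u \<Longrightarrow> u < N \<Longrightarrow> h DEP u = int (length (ns u))"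
  using treeD(2)[of N ns h] treeD(4)[of N ns h] treeD(6)[of N ns h u] by (cases "u = 0") auto

lemma F_Pref: "1 \<le> k \<Longrightarrow> k \<le> d \<Longrightarrow> prefix S (F k) \<Longrightarrow> S \<in> Pref f D"
  using pat_in by (auto simp: Pref_def F_def)

lemma tree_Pref: "tree N ns h \<Longrightarrow> 0 \<le> u \<Longrightarrow> u < N \<Longrightarrow> ns u \<in> Pref f D"
  using treeD(2)[of N ns h] treeD(6)[of N ns h u] F_Pref by (cases "u = 0") auto

lemma sibling_length:
  assumes "tree N ns h" "1 \<le> i" "i < N" "1 \<le> i'" "i' < N" "h PAR i = h PAR i'"
  shows "length (ns i) = length (ns i')"
proof -
  have "ns i \<noteq> []" "ns i' \<noteq> []" "butlast (ns i) = butlast (ns i')"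
    using treeD(6)[OF assms(1-3)] treeD(6)[OF assms(1,4,5)] assms(6) by auto
  then show ?thesis by (metis append_butlast_last_id length_append_singleton)
qed

text \<open>\<open>ns\<close> is injective into the states. The bound holds at every moment of the
  construction and keeps the indices of new nodes below \<open>M\<close>.\<close>

lemma tree_bound:
  assumes "tree N ns h"
  shows "N \<le> m + 1"
proof -
  have "card (ns ` {0..<N}) \<le> card (Pref f D)"
    by (rule card_mono) (use tree_Pref[OF assms] in auto)
  then show ?thesis
    using card_image[OF treeD(5)[OF assms]] card_Pref by (simp add: m_def)
qed

lemma last_in_F: "S \<noteq> [] \<Longrightarrow> prefix S (F k) \<Longrightarrow> last S \<in> set (F k)"
  by (auto simp: prefix_def)

lemma tree_child:
  assumes "tree N ns h" "1 \<le> u" "u < N" "1 \<le> k" "k \<le> d" "c \<in> set (F k)" "h SYM u = cd c"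
  shows "ns u = ns (h PAR u) @ [c]"
proof -
  note u = treeD(6)[OF assms(1-3)]
  have "last (ns u) = c"
    using cd_inj[of "last (ns u)" "h REP u" c k] u assms(4-) last_in_F by auto
  then show ?thesis using u by (metis append_butlast_last_id)
qed

lemma prefix_snoc_nth:
  assumes "prefix S T" "length S < length T"
  shows "prefix (S @ [T ! length S]) T"
proof -
  obtain zs where "T = S @ zs" using assms(1) by (auto simp: prefix_def)
  with assms(2) show ?thesis by (cases zs) auto
qed

lemma butlast_short: "length xs \<le> length (butlast xs) \<Longrightarrow> xs = []"
  by (cases xs rule: rev_cases) auto

section \<open>Handing on one pattern of the current node\<close>

lemma innerD:
  assumes "inner v N ns A q h"
  shows "tree N ns h" "sym_chains N h" "finished v N ns h" "pending v N ns A h"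
    "current v N ns A h" "chset (h NEXT) q A"
  using assms by (auto simp: inner_def)

lemma inner_head:
  assumes "inner v N ns A k h" "k \<noteq> 0"
  shows "0 \<le> v" "v < N" "1 \<le> k" "k \<le> d" "prefix (ns v) (F k)"
  using innerD(5)[OF assms(1)] chset_pop(1)[OF innerD(6)[OF assms(1)] assms(2)]
  by (auto simp: current_def thru_def)

text \<open>A pattern ends in one node only, so no finished list runs through its
  \<open>NEXTE\<close> cell, and it is too short to pass through a child of
  \<open>v\<close>.\<close>

lemma inner_end:
  assumes inn: "inner v N ns A k h" and k: "k \<noteq> 0" and len: "plen k = h DEP v"
    and h': "h' = h(NEXTE := (h NEXTE)(k := h ENDS v), ENDS := (h ENDS)(v := k))"
  shows "inner v N ns (A - {k}) (h NEXT k) h'"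
proof -
  note parts = innerD[OF inn] and v = inner_head(1,2)[OF inn k] and kt = inner_head(3-5)[OF inn k]
  note pop = chset_pop[OF parts(6) k]
  have "length (F k) = length (ns v)"
    using len length_F[OF kt(1,2)] tree_dep[OF parts(1) v] by simp
  then have Fk: "F k = ns v" using kt(3) by (auto elim!: prefixE)
  have other: "k \<notin> ends (ns i)" if "0 \<le> i" "i < v" for i
    using that Fk tree_eq[OF parts(1), of i v] v by (auto simp: ends_def)
  have child: "k \<notin> thru (ns i)" if "1 \<le> i" "i < N" "h PAR i = v" for i
  proof
    assume "k \<in> thru (ns i)"
    then have "length (ns i) \<le> length (F k)" by (simp add: thru_def prefix_length_le)
    moreover have "F k = butlast (ns i)" using treeD(6)[OF parts(1) that(1,2)] that(3) Fk by simp
    ultimately have "length (ns i) \<le> length (butlast (ns i))" by metis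
    then show False
      using treeD(6)[OF parts(1) that(1,2)] butlast_short by blast
  qed
  have tree': "tree N ns h'" using parts(1) by (simp add: tree_def h')
  moreover have "sym_chains N h'" using parts(2) by (simp add: sym_chains_def h')
  moreover have "finished v N ns h'"
    using parts(3) other unfolding finished_def h' by (auto simp: chset_upd)
  moreover have "pending v N ns (A - {k}) h'"
  proof -
    have "thru (ns i) - (A - {k}) = thru (ns i) - A" if "v < i" "i < N" "h PAR i = v" for i
      using child[of i] that v by auto
    then show ?thesis using parts(4) unfolding pending_def h' by auto
  qed
  moreover have "current v N ns (A - {k}) h'"
  proof -
    have "k \<notin> ends (ns v) - A" using pop(1) by simp
    moreover have "insert k (ends (ns v) - A) = ends (ns v) - (A - {k})"
      using pop(1) Fk kt by (auto simp: ends_def)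
    ultimately have "chset (h' NEXTE) (h' ENDS v) (ends (ns v) - (A - {k}))"
      using chset_push[of "h NEXTE" "h ENDS v" "ends (ns v) - A" k] parts(5) k
      by (simp add: current_def h')
    then show ?thesis using parts(5) Fk unfolding current_def h' by auto
  qed
  moreover have "chset (h' NEXT) (h NEXT k) (A - {k})" using pop by (simp add: h')
  ultimately show ?thesis by (simp add: inner_def)
qed

text \<open>Overwriting \<open>NEXT\<close> at \<open>k\<close> is safe because \<open>k\<close> is
  in no other list: siblings of \<open>u\<close> are different prefixes of the same length, and the
  remaining unprocessed nodes share no pattern with \<open>v\<close>.\<close>

lemma inner_push:
  assumes inn: "inner v N ns A k h" and k: "k \<noteq> 0"
    and u: "1 \<le> u" "u < N" "h PAR u = v" "prefix (ns u) (F k)"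
    and h': "h' = h(NEXT := (h NEXT)(k := h LIST u), LIST := (h LIST)(u := k))"
  shows "inner v N ns (A - {k}) (h NEXT k) h'"
proof -
  note parts = innerD[OF inn] and v = inner_head(1,2)[OF inn k] and kt = inner_head(3-5)[OF inn k]
  note pop = chset_pop[OF parts(6) k]
  note tu = treeD(6)[OF parts(1) u(1,2)]
  have vu: "v < u" using tu u by simp
  have ku: "k \<in> thru (ns u)" using u kt by (simp add: thru_def)
  have Fk: "F k \<noteq> ns v"
  proof
    assume "F k = ns v"
    moreover have "ns v = butlast (ns u)" using tu u(3) by simp
    ultimately have "length (ns u) \<le> length (butlast (ns u))"
      using prefix_length_le[OF u(4)] by metis
    then show False using tu butlast_short by blast
  qed
  have sib: "k \<notin> thru (ns i)" if i: "v < i" "i < N" "i \<noteq> u" "h PAR i = v" for i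
  proof
    assume "k \<in> thru (ns i)"
    then have "prefix (ns i) (F k)" by (simp add: thru_def)
    moreover have "length (ns i) = length (ns u)"
      using sibling_length[OF parts(1), of i u] i u v by simp
    ultimately have "ns i = ns u" using u(4) by (metis append_eq_append_conv prefix_def)
    then show False using tree_eq[OF parts(1), of i u] i u v by auto
  qed
  have old: "k \<notin> thru (ns i)" if i: "v < i" "i < N" "h PAR i \<noteq> v" for i
  proof -
    have "h PAR v \<noteq> v" using treeD(6)[OF parts(1), of v] treeD(3)[OF parts(1)] v by (cases "v = 0") auto
    then have "thru (ns v) \<inter> thru (ns i) = {}" using parts(4) i unfolding pending_def by blast
    then show ?thesis using kt by (auto simp: thru_def)
  qed
  have "tree N ns h'" using parts(1) by (simp add: tree_def h')
  moreover have "sym_chains N h'" using parts(2) by (simp add: sym_chains_def h')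
  moreover have "finished v N ns h'"
    using parts(3) unfolding finished_def h' by auto
  moreover have "pending v N ns (A - {k}) h'"
  proof -
    have "chset (h' NEXT) (h' LIST i) (if h' PAR i = v then thru (ns i) - (A - {k}) else thru (ns i))"
      if i: "v < i" "i < N" for i
    proof (cases "i = u")
      case True
      have "insert k (thru (ns u) - A) = thru (ns u) - (A - {k})" using pop(1) ku by auto
      moreover have "chset (h NEXT) (h LIST u) (thru (ns u) - A)"
        using parts(4) u vu unfolding pending_def by auto
      ultimately show ?thesis
        using chset_push[of "h NEXT" "h LIST u" "thru (ns u) - A" k] k pop(1) True u
        by (simp add: h')
    next
      case False
      have ki: "k \<notin> thru (ns i)" using sib[of i] old[of i] i False by blast
      then have "thru (ns i) - (A - {k}) = thru (ns i) - A" by auto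
      then show ?thesis using ki parts(4) i False unfolding pending_def by (auto simp: h' chset_upd)
    qed
    then show ?thesis using parts(4) u unfolding pending_def by (auto simp: h')
  qed
  moreover have "current v N ns (A - {k}) h'"
  proof -
    have "ends (ns v) - (A - {k}) = ends (ns v) - A" using Fk by (auto simp: ends_def)
    moreover have "\<exists>u. 1 \<le> u \<and> u < N \<and> h PAR u = v \<and> prefix (ns u) (F k')"
      if "k' \<in> thru (ns v) - (A - {k})" "F k' \<noteq> ns v" for k'
      using that parts(5) u unfolding current_def by (cases "k' = k") blast+
    ultimately show ?thesis using parts(5) unfolding current_def h' by simp blast
  qed
  moreover have "chset (h' NEXT) (h NEXT k) (A - {k})" using pop by (simp add: h' chset_upd)
  ultimately show ?thesis by (simp add: inner_def)
qed

lemma inner_new: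
  assumes inn: "inner v N ns A k h" and k: "k \<noteq> 0" and len: "plen k \<noteq> h DEP v"
    and c: "c = F k ! nat (h DEP v)" and fresh: "h PAR (h LC (cd c)) \<noteq> v"
    and h': "h' = h(PAR := (h PAR)(N := v), SYM := (h SYM)(N := cd c), REP := (h REP)(N := k),
      DEP := (h DEP)(N := h DEP v + 1), NXS := (h NXS)(N := h LC (cd c)), LC := (h LC)(cd c := N))"
  shows "inner v (N + 1) (ns(N := ns v @ [c])) A k h'"
proof -
  note parts = innerD[OF inn] and v = inner_head(1,2)[OF inn k] and kt = inner_head(3-5)[OF inn k]
  note pop = chset_pop[OF parts(6) k]
  have dep: "h DEP v = int (length (ns v))" by (rule tree_dep[OF parts(1) v])
  have less: "length (ns v) < length (F k)"
    using len dep length_F[OF kt(1,2)] prefix_length_le[OF kt(3)] by simp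
  have cF: "c \<in> set (F k)" using less by (simp add: c dep)
  have pre: "prefix (ns v @ [c]) (F k)"
    using prefix_snoc_nth[OF kt(3) less] by (simp add: c dep)
  have par_le: "h PAR u \<le> v" if "1 \<le> u" "u < N" for u
    using parts(5) that by (auto simp: current_def)
  \<comment> \<open>If this state already had a node \<open>u\<close>, then \<open>LC\<close> of its
    symbol would be at least \<open>u\<close>. By monotonicity its parent would be at least
    \<open>v\<close>, and no parent exceeds \<open>v\<close> yet, which contradicts
    \<open>fresh\<close>.\<close>
  have new: "ns u \<noteq> ns v @ [c]" if "0 \<le> u" "u < N" for u
  proof
    assume eq: "ns u = ns v @ [c]"
    then have u: "1 \<le> u" using treeD(2)[OF parts(1)] that by (cases "u = 0") auto
    note tu = treeD(6)[OF parts(1) u that(2)]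
    have "h PAR u = v" using tree_eq[OF parts(1), of "h PAR u" v] tu eq v that by auto
    moreover have "h SYM u = cd c" using tu eq by simp
    ultimately have le: "u \<le> h LC (cd c)" using parts(2) u that by (auto simp: sym_chains_def)
    then have "h LC (cd c) \<noteq> 0" using u by simp
    moreover have "chset (h NXS) (h LC (cd c)) {u. 1 \<le> u \<and> u < N \<and> h SYM u = cd c}"
      using parts(2) by (simp add: sym_chains_def)
    ultimately have x: "h LC (cd c) < N" using chset_pop(1) by blast
    have "v \<le> h PAR (h LC (cd c))"
      using treeD(7)[OF parts(1) u _ x] le \<open>h PAR u = v\<close> by (cases "u = h LC (cd c)") auto
    then show False using fresh par_le[of "h LC (cd c)"] x le u by simp
  qed
  let ?ns = "ns(N := ns v @ [c])"
  have N: "1 \<le> N" using v by simp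
  have tree': "tree (N + 1) ?ns h'"
  proof -
    have "inj_on ?ns {0..<N + 1}"
    proof -
      have "{0..<N + 1} = insert N {0..<N}" using N by auto
      moreover have "inj_on ?ns {0..<N}" using treeD(5)[OF parts(1)] by (auto simp: inj_on_def)
      moreover have "?ns N \<notin> ?ns ` {0..<N}"
      proof
        assume "?ns N \<in> ?ns ` {0..<N}"
        then obtain x where "x \<in> {0..<N}" "?ns N = ?ns x" by blast
        then show False using new[of x] by auto
      qed
      ultimately show ?thesis by auto
    qed
    moreover have "0 \<le> h' PAR u \<and> h' PAR u < u \<and> ?ns u \<noteq> [] \<and>
        ?ns (h' PAR u) = butlast (?ns u) \<and> h' SYM u = cd (last (?ns u)) \<and>
        1 \<le> h' REP u \<and> h' REP u \<le> d \<and> prefix (?ns u) (F (h' REP u)) \<and> h' DEP u = int (length (?ns u))"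
      if "1 \<le> u" "u < N + 1" for u
      using treeD(6)[OF parts(1), of u] that v kt pre dep by (cases "u = N") (auto simp: h')
    moreover have "h' PAR u \<le> h' PAR u'" if "1 \<le> u" "u < u'" "u' < N + 1" for u u'
      using treeD(7)[OF parts(1), of u u'] par_le[of u] that by (cases "u' = N") (auto simp: h')
    ultimately show ?thesis
      using treeD(1-4)[OF parts(1)] N unfolding tree_def by (auto simp: h')
  qed
  moreover have "sym_chains (N + 1) h'"
  proof -
    have "chset (h' NXS) (h' LC a) {u. 1 \<le> u \<and> u < N + 1 \<and> h' SYM u = a}" for a
    proof (cases "a = cd c")
      case True
      have "{u. 1 \<le> u \<and> u < N + 1 \<and> h' SYM u = a} = insert N {u. 1 \<le> u \<and> u < N \<and> h SYM u = a}"
        using True N by (auto simp: h')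
      then show ?thesis
        using chset_push[of "h NXS" "h LC a" "{u. 1 \<le> u \<and> u < N \<and> h SYM u = a}" N] parts(2) True N
        by (simp add: sym_chains_def h')
    next
      case False
      then have "{u. 1 \<le> u \<and> u < N + 1 \<and> h' SYM u = a} = {u. 1 \<le> u \<and> u < N \<and> h SYM u = a}"
        by (auto simp: h')
      then show ?thesis using parts(2) False by (simp add: sym_chains_def h' chset_upd)
    qed
    then show ?thesis using parts(2) unfolding sym_chains_def by (auto simp: h')
  qed
  moreover have "finished v (N + 1) ?ns h'"
    unfolding finished_def
  proof (intro allI impI)
    fix i assume i: "0 \<le> i" "i < v"
    then have old: "1 \<le> h FIRST i" "h FIRST i \<le> h LAST i" "h LAST i \<le> N" "h CUR i = h FIRST i"
      "\<And>u. 1 \<le> u \<Longrightarrow> u < N \<Longrightarrow> h PAR u = i \<longleftrightarrow> h FIRST i \<le> u \<and> u < h LAST i"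
      "chset (h NEXTE) (h ENDS i) (ends (ns i))"
      "\<And>k. k \<in> thru (ns i) \<Longrightarrow> F k \<noteq> ns i \<Longrightarrow> \<exists>u. 1 \<le> u \<and> u < N \<and> h PAR u = i \<and> prefix (ns u) (F k)"
      using parts(3) unfolding finished_def by blast+
    have "\<exists>u. 1 \<le> u \<and> u < N + 1 \<and> h' PAR u = i \<and> prefix (?ns u) (F k)"
      if "k \<in> thru (?ns i)" "F k \<noteq> ?ns i" for k
    proof -
      have "k \<in> thru (ns i)" "F k \<noteq> ns i" using that i v by auto
      then obtain u where "1 \<le> u" "u < N" "h PAR u = i" "prefix (ns u) (F k)"
        using old(7) by blast
      then show ?thesis by (intro exI[of _ u]) (auto simp: h')
    qed
    moreover have "h' PAR u = i \<longleftrightarrow> h' FIRST i \<le> u \<and> u < h' LAST i" if "1 \<le> u" "u < N + 1" for u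
      using old(3) old(5)[of u] that i by (cases "u = N") (auto simp: h')
    ultimately show "1 \<le> h' FIRST i \<and> h' FIRST i \<le> h' LAST i \<and> h' LAST i \<le> N + 1 \<and>
      h' CUR i = h' FIRST i \<and>
      (\<forall>u. 1 \<le> u \<longrightarrow> u < N + 1 \<longrightarrow> (h' PAR u = i \<longleftrightarrow> h' FIRST i \<le> u \<and> u < h' LAST i)) \<and>
      chset (h' NEXTE) (h' ENDS i) (ends (?ns i)) \<and>
      (\<forall>k \<in> thru (?ns i). F k \<noteq> ?ns i \<longrightarrow> (\<exists>u. 1 \<le> u \<and> u < N + 1 \<and> h' PAR u = i \<and> prefix (?ns u) (F k)))"
      using old(1-4,6) i v by (auto simp: h')
  qed
  moreover have "pending v (N + 1) ?ns A h'"
  proof -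
    \<comment> \<open>A pattern through the new child that had already left \<open>A\<close> would
      have required a node for this very state, so the empty list of the new node is complete
      relative to \<open>A\<close>.\<close>
    have none: "thru (ns v @ [c]) - A = {}"
    proof (rule ccontr)
      assume "thru (ns v @ [c]) - A \<noteq> {}"
      then obtain k' where k': "1 \<le> k'" "k' \<le> d" "prefix (ns v @ [c]) (F k')" "k' \<notin> A"
        by (auto simp: thru_def)
      then have "k' \<in> thru (ns v) - A" "F k' \<noteq> ns v"
        by (auto simp: thru_def prefix_def)
      then obtain u where u: "1 \<le> u" "u < N" "h PAR u = v" "prefix (ns u) (F k')"
        using parts(5) unfolding current_def by blast
      have "length (ns u) = length (ns v @ [c])"
        using treeD(6)[OF parts(1) u(1,2)] u(3)
        by (metis append_butlast_last_id length_append_singleton)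
      then have "ns u = ns v @ [c]" using u(4) k'(3) by (metis append_eq_append_conv prefix_def)
      then show False using new[of u] u by simp
    qed
    then have "chset g 0 (thru (ns v @ [c]) - A)" for g by (simp only: chset_empty)
    then have "chset (h' NEXT) (h' LIST i) (if h' PAR i = v then thru (?ns i) - A else thru (?ns i))"
      if "v < i" "i < N + 1" for i
      using that parts(4) unfolding pending_def by (cases "i = N") (auto simp: h' chset_empty)
    moreover have "thru (?ns i) \<inter> thru (?ns i') = {}"
      if "v \<le> i" "i < i'" "i' < N + 1" "h' PAR i \<noteq> v" "h' PAR i' \<noteq> v" for i i'
    proof -
      have "i \<noteq> N" "i' \<noteq> N" using that by (auto simp: h')
      then show ?thesis using that parts(4) unfolding pending_def by (auto simp: h')
    qed
    ultimately show ?thesis using parts(4) unfolding pending_def by (auto simp: h')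
  qed
  moreover have "current v (N + 1) ?ns A h'"
  proof -
    have "\<exists>u. 1 \<le> u \<and> u < N + 1 \<and> h' PAR u = v \<and> prefix (?ns u) (F k)"
      if k: "k \<in> thru (ns v) - A" "F k \<noteq> ns v" for k
    proof -
      obtain u where "1 \<le> u" "u < N" "h PAR u = v" "prefix (ns u) (F k)"
        using parts(5) k unfolding current_def by blast
      then show ?thesis by (intro exI[of _ u]) (auto simp: h')
    qed
    moreover have "h' PAR u \<le> v \<and> (h' PAR u = v \<longleftrightarrow> h' FIRST v \<le> u)" if "1 \<le> u" "u < N + 1" for u
      using parts(5) that unfolding current_def by (cases "u = N") (auto simp: h')
    ultimately show ?thesis using parts(5) v unfolding current_def by (auto simp: h')
  qed
  moreover have "chset (h' NEXT) k A" using parts(6) by (simp add: h')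
  ultimately show ?thesis by (simp add: inner_def)
qed


text \<open>The parent of the root is -1, so a match with \<open>v\<close> rules out node 0; the
  entry is a genuine node, and its symbol code together with its parent determine its state.\<close>

lemma inner_unique_child:
  assumes inn: "inner v N ns A k h" and k: "k \<noteq> 0" and len: "plen k \<noteq> h DEP v"
    and old: "h PAR (h LC (cd (F k ! nat (h DEP v)))) = v"
  shows "1 \<le> h LC (cd (F k ! nat (h DEP v)))" "h LC (cd (F k ! nat (h DEP v))) < N"
    "prefix (ns (h LC (cd (F k ! nat (h DEP v))))) (F k)"
proof -
  define c u where "c = F k ! nat (h DEP v)" and "u = h LC (cd c)"
  note parts = innerD[OF inn] and v = inner_head(1,2)[OF inn k] and kt = inner_head(3-5)[OF inn k]
  have dep: "h DEP v = int (length (ns v))" by (rule tree_dep[OF parts(1) v])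
  have less: "length (ns v) < length (F k)"
    using len dep length_F[OF kt(1,2)] prefix_length_le[OF kt(3)] by simp
  have cF: "c \<in> set (F k)" using less by (simp add: c_def dep)
  have "u \<noteq> 0" using old treeD(3)[OF parts(1)] v by (auto simp: u_def c_def)
  moreover have "chset (h NXS) u {u. 1 \<le> u \<and> u < N \<and> h SYM u = cd c}"
    using parts(2) by (simp add: sym_chains_def u_def)
  ultimately have u: "1 \<le> u" "u < N" "h SYM u = cd c" using chset_pop(1) by blast+
  have "ns u = ns v @ [c]"
    using tree_child[OF parts(1) u(1,2) kt(1,2) cF u(3)] old by (simp add: u_def c_def)
  moreover have "prefix (ns v @ [c]) (F k)"
    using prefix_snoc_nth[OF kt(3) less] by (simp add: c_def dep)
  ultimately show "1 \<le> h LC (cd (F k ! nat (h DEP v)))" "h LC (cd (F k ! nat (h DEP v))) < N"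
    "prefix (ns (h LC (cd (F k ! nat (h DEP v))))) (F k)"
    using u by (simp_all add: u_def c_def)
qed

lemma trie_inner_spec:
  assumes inn: "inner v (rg a 15) ns A (rg a 17) (fl a)"
    and a: "rg a 9 = B" "rg a 16 = v" "rg a 19 = fl a DEP v" "lo a = lo1"
      "\<And>i. 1 \<le> i \<Longrightarrow> i \<le> d \<Longrightarrow> fl a START i = pos i - 1"
    and Q: "\<And>a' t' ns'. inner v (rg a' 15) ns' {} 0 (fl a') \<Longrightarrow> (\<And>i. i \<le> v \<Longrightarrow> ns' i = ns i) \<Longrightarrow>
      rg a' 9 = B \<Longrightarrow> rg a' 14 = rg a 14 \<Longrightarrow> rg a' 16 = v \<Longrightarrow> lo a' = lo1 \<Longrightarrow> en a' = en a \<Longrightarrow>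
      (\<And>i. 1 \<le> i \<Longrightarrow> i \<le> d \<Longrightarrow> fl a' START i = pos i - 1) \<Longrightarrow>
      t' \<le> t + 10 + 300 * int (card A) \<Longrightarrow> Q a' t'"
  shows "wp (Wh (NotE (EqE (Var 17) (Num 0))) trie_inner) Q a t"
proof -
  define I :: "nat \<Rightarrow> astate \<Rightarrow> int \<Rightarrow> bool" where
    "I = (\<lambda>n a' t'. \<exists>ns' A'. n = card A' \<and> inner v (rg a' 15) ns' A' (rg a' 17) (fl a') \<and>
      (\<forall>i \<le> v. ns' i = ns i) \<and> rg a' 9 = B \<and> rg a' 14 = rg a 14 \<and> rg a' 16 = v \<and>
      rg a' 19 = fl a' DEP v \<and> lo a' = lo1 \<and> en a' = en a \<and>
      (\<forall>i. 1 \<le> i \<longrightarrow> i \<le> d \<longrightarrow> fl a' START i = pos i - 1) \<and>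
      t' \<le> t + 300 * (int (card A) - int (card A')))"
  have "I (card A) a t" unfolding I_def using inn a by auto
  then show ?thesis
  proof (rule wp_while[where I = I])
    fix n :: nat and a' :: astate and t' :: int
    let ?k = "rg a' 17" and ?N = "rg a' 15" and ?fl = "fl a'"
    assume "I n a' t'"
    then obtain ns' A' where inn: "inner v ?N ns' A' ?k ?fl" and n: "n = card A'"
      and ns: "\<And>i. i \<le> v \<Longrightarrow> ns' i = ns i"
      and a': "rg a' 9 = B" "rg a' 14 = rg a 14" "rg a' 16 = v" "rg a' 19 = ?fl DEP v" "lo a' = lo1"
        "en a' = en a" "\<And>i. 1 \<le> i \<Longrightarrow> i \<le> d \<Longrightarrow> ?fl START i = pos i - 1"
      and t': "t' \<le> t + 300 * (int (card A) - int (card A'))"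
      unfolding I_def by blast
    show "okb a' (NotE (EqE (Var 17) (Num 0)))" using B_bounds d_m by (auto intro!: small)
    {
      assume "\<not> evb a' (NotE (EqE (Var 17) (Num 0)))"
      then have k0: "?k = 0" by simp
      then have "A' = {}" using inn chset_0 by (auto simp: inner_def)
      then show "Q a' (t' + (1 + costb (NotE (EqE (Var 17) (Num 0)))))"
        using inn k0 ns a' t' by (intro Q[of a' ns']) auto
    next
      assume "evb a' (NotE (EqE (Var 17) (Num 0)))"
      then have k: "?k \<noteq> 0" by simp
      note parts = innerD[OF inn] and v = inner_head(1,2)[OF inn k] and kt = inner_head(3-5)[OF inn k]
      note kA = chset_pop(1)[OF parts(6) k]
      have N: "?N \<le> m + 1" by (rule tree_bound[OF parts(1)])
      have dep: "?fl DEP v = int (length (ns' v))" by (rule tree_dep[OF parts(1) v])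
      have dep_le: "0 \<le> ?fl DEP v" "?fl DEP v \<le> plen ?k"
        using dep length_F[OF kt(1,2)] prefix_length_le[OF kt(3)] by auto
      have "finite A'" using chset_finite parts(6) by blast
      then have card: "card (A' - {?k}) < n" "int (card (A' - {?k})) = int (card A') - 1"
        using kA n card_gt_0_iff[of A'] by (auto simp: card_Diff_singleton)
      have reach: "\<exists>n'<n. I n' b s"
        if "inner v (rg b 15) ns'' (A' - {?k}) (rg b 17) (fl b)" "\<And>i. i \<le> v \<Longrightarrow> ns'' i = ns' i"
          "rg b 9 = B" "rg b 14 = rg a' 14" "rg b 16 = v" "rg b 19 = fl b DEP v" "lo b = lo1"
          "en b = en a'" "fl b START = ?fl START" "s \<le> t' + 300" for b s ns''
      proof -
        have "I (card (A' - {?k})) b s"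
          unfolding I_def using that card ns a' t' by (intro exI[of _ ns''] exI[of _ "A' - {?k}"]) auto
        then show ?thesis using card(1) by blast
      qed
      have vM: "v \<le> M" "?k \<le> M" "?k < B" using N v B_bounds kt d_m by auto
      have nonneg: "0 \<le> ?k" using kt by simp
      have low_k: "lo1 ?k = plen ?k" by (rule table(5)[OF kt(1,2)])
      have start: "?fl START ?k = pos ?k - 1" by (rule a'(7)[OF kt(1,2)])
      show "wp trie_inner (\<lambda>a' t'. \<exists>n'<n. I n' a' t') a' (t' + (1 + costb (NotE (EqE (Var 17) (Num 0)))))"
      proof (cases "plen ?k = ?fl DEP v")
        case True
        note step = inner_end[OF inn k True refl]
        show ?thesis
          using True k v vM nonneg low_k a' card step
          by (intro vc_sound) (auto simp: trie_inner_def intro!: reach)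
      next
        case len: False
        define c where "c = F ?k ! nat (?fl DEP v)"
        define u where "u = ?fl LC (cd c)"
        have j: "0 \<le> ?fl DEP v" "?fl DEP v < plen ?k" using dep_le len by auto
        have low_c: "lo1 (pos ?k + ?fl DEP v) = cd c"
          unfolding c_def by (rule table(6)[OF kt(1,2) j])
        have "c \<in> set (F ?k)" using j length_F[OF kt(1,2)] by (simp add: c_def)
        then have cd: "0 \<le> cd c" "cd c \<le> M"
          using cd_bounds[of c ?k] kt table(3) B_bounds by auto
        have addr: "pos ?k + ?fl DEP v < B" "1 \<le> pos ?k + ?fl DEP v"
          using pos_plen[OF kt(1,2)] pos_bounds[of ?k] kt j d_m by auto
        have words: "1 \<in> words w" "?fl DEP v + 1 \<in> words w" "pos ?k + ?fl DEP v \<in> words w"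
            "?N + 1 \<in> words w"
          using addr j N v d_m pos_plen[OF kt(1,2)] pos_bounds[of ?k] kt B_bounds by (auto intro!: small)
        show ?thesis
        proof (cases "?fl PAR u = v")
          case True
          note child = inner_unique_child[OF inn k len, folded c_def, folded u_def, OF True]
          note step = inner_push[OF inn k child(1,2) True child(3) refl]
          have "u \<le> M" using child N B_bounds d_m by simp
          then show ?thesis
            using True len k v vM nonneg low_k start low_c cd addr words a' step child u_def[symmetric]
            by (intro vc_sound) (simp add: trie_inner_def, rule reach[where ns'' = ns'], simp_all)
        next
          case False
          define ns2 where "ns2 = ns'(?N := ns' v @ [c])"
          have ns2: "ns2 i = ns' i" if "i \<le> v" for i using that v by (simp add: ns2_def)
          note new = inner_new[OF inn k len c_def False[unfolded u_def] refl, folded ns2_def]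
          have pre: "prefix (ns2 ?N) (F ?k)"
            using prefix_snoc_nth[OF kt(3)] j length_F[OF kt(1,2)] by (simp add: c_def dep ns2_def)
          note step = inner_push[OF new k _ _ _ pre refl]
          have "chset (?fl NXS) u {u. 1 \<le> u \<and> u < ?N \<and> ?fl SYM u = cd c}"
            using inn by (simp add: inner_def sym_chains_def u_def)
          then have "u = 0 \<or> 1 \<le> u \<and> u < ?N" using chset_pop(1) by blast
          then have "0 \<le> u" "u \<le> M" using N B_bounds d_m by auto
          then show ?thesis
            using False len k v vM nonneg low_k start low_c cd addr words a' step u_def[symmetric] N B_bounds d_m
            by (intro vc_sound)
              (simp add: trie_inner_def, rule reach[where ns'' = ns2], simp_all add: ns2)
        qed
      qed
    }
  qed
qed


section \<open>Entering and leaving a node\<close>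

lemma outer_start:
  assumes h: "h PAR = (\<lambda>_. 0)(0 := -1)" "\<And>j. 6 \<le> j \<Longrightarrow> h j = (\<lambda>_. 0)" "h LIST = (\<lambda>_. 0)(0 := d)"
      "\<And>i. 1 \<le> i \<Longrightarrow> i \<le> d \<Longrightarrow> h NEXT i = i - 1"
  shows "outer 0 1 (\<lambda>_. []) h"
proof -
  have "chset (h NEXT) d {1..d}"
    using chset_interval[of "length D" "h NEXT"] h(4) by (simp add: d_def)
  moreover have "thru [] = {1..d}" by (auto simp: thru_def)
  moreover have "{0..<1} = {0::int}" by auto
  moreover have "{u. 1 \<le> u \<and> u < 1 \<and> h SYM u = a} = {}" for a by auto
  then have "chset (\<lambda>_. 0) 0 {u. 1 \<le> u \<and> u < 1 \<and> h SYM u = a}" for a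
    by (simp only: chset_empty)
  ultimately show ?thesis
    using h by (auto simp: outer_def tree_def sym_chains_def finished_def chset_empty)
qed

lemma outer_enter:
  assumes out: "outer v N ns h" and v: "v < N"
    and h': "h' = h(FIRST := (h FIRST)(v := N), CUR := (h CUR)(v := N))"
  shows "inner v N ns (thru (ns v)) (h LIST v) h'"
proof -
  have parts: "tree N ns h" "sym_chains N h" "finished v N ns h" "0 \<le> v"
    "\<And>u. 1 \<le> u \<Longrightarrow> u < N \<Longrightarrow> h PAR u < v"
    "\<And>i. v \<le> i \<Longrightarrow> i < N \<Longrightarrow> chset (h NEXT) (h LIST i) (thru (ns i))"
    "\<And>i i'. v \<le> i \<Longrightarrow> i < i' \<Longrightarrow> i' < N \<Longrightarrow> thru (ns i) \<inter> thru (ns i') = {}"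
    "\<And>i. N \<le> i \<Longrightarrow> h LIST i = 0" "\<And>i. v \<le> i \<Longrightarrow> h ENDS i = 0"
    using out unfolding outer_def by blast+
  have "tree N ns h'" using parts(1) by (simp add: tree_def h')
  moreover have "sym_chains N h'" using parts(2) by (simp add: sym_chains_def h')
  moreover have "finished v N ns h'" using parts(3) unfolding finished_def h' by auto
  moreover have "pending v N ns (thru (ns v)) h'"
    using parts(4-) unfolding pending_def h' by (auto simp: less_le dest: parts(5))
  moreover have "current v N ns (thru (ns v)) h'"
  proof -
    have "ends (ns v) \<subseteq> thru (ns v)" by (auto simp: ends_def thru_def)
    then have "ends (ns v) - thru (ns v) = {}" by blast
    then have "chset (h' NEXTE) (h' ENDS v) (ends (ns v) - thru (ns v))"
      using parts(9)[of v] by (simp only: chset_empty) (simp add: h')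
    moreover have "h' PAR u \<le> v \<and> (h' PAR u = v \<longleftrightarrow> h' FIRST v \<le> u)" if "1 \<le> u" "u < N" for u
      using parts(5)[OF that] that by (simp add: h')
    moreover have "1 \<le> h' FIRST v" "h' FIRST v \<le> N" "h' CUR v = h' FIRST v" using v parts(4) by (auto simp: h')
    ultimately show ?thesis
      using parts(4) v unfolding current_def by blast
  qed
  moreover have "chset (h' NEXT) (h LIST v) (thru (ns v))" using parts(6) v by (simp add: h')
  ultimately show ?thesis by (simp add: inner_def)
qed

lemma outer_exit:
  assumes inn: "inner v N ns {} q h" and h': "h' = h(LAST := (h LAST)(v := N))"
  shows "outer (v + 1) N ns h'"
proof -
  have parts: "tree N ns h" "sym_chains N h" "finished v N ns h" "pending v N ns {} h" "current v N ns {} h"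
    using inn by (auto simp: inner_def)
  have v: "0 \<le> v" "v < N" "1 \<le> h FIRST v" "h FIRST v \<le> N" "h CUR v = h FIRST v"
    "\<And>u. 1 \<le> u \<Longrightarrow> u < N \<Longrightarrow> h PAR u \<le> v \<and> (h PAR u = v \<longleftrightarrow> h FIRST v \<le> u)"
    "chset (h NEXTE) (h ENDS v) (ends (ns v))"
    "\<And>k. k \<in> thru (ns v) \<Longrightarrow> F k \<noteq> ns v \<Longrightarrow> \<exists>u. 1 \<le> u \<and> u < N \<and> h PAR u = v \<and> prefix (ns u) (F k)"
    using parts(5) unfolding current_def by (blast, blast, blast, blast, blast, blast, simp, blast)
  have pend: "\<And>i. v < i \<Longrightarrow> i < N \<Longrightarrow> chset (h NEXT) (h LIST i) (thru (ns i))"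
    "\<And>i i'. v \<le> i \<Longrightarrow> i < i' \<Longrightarrow> i' < N \<Longrightarrow> h PAR i \<noteq> v \<Longrightarrow> h PAR i' \<noteq> v \<Longrightarrow> thru (ns i) \<inter> thru (ns i') = {}"
    "\<And>i. N \<le> i \<Longrightarrow> h LIST i = 0" "\<And>i. v < i \<Longrightarrow> h ENDS i = 0"
    using parts(4) unfolding pending_def by (auto split: if_splits)
  have PAR_v: "h PAR v \<noteq> v"
    using treeD(6)[OF parts(1), of v] treeD(3)[OF parts(1)] v(1,2) by (cases "v = 0") auto
  have "tree N ns h'" using parts(1) by (simp add: tree_def h')
  moreover have "sym_chains N h'" using parts(2) by (simp add: sym_chains_def h')
  moreover have "finished (v + 1) N ns h'"
    unfolding finished_def
  proof (intro allI impI)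
    fix i assume "0 \<le> i" "i < v + 1"
    then consider "0 \<le> i" "i < v" | "i = v" by linarith
    then show "1 \<le> h' FIRST i \<and> h' FIRST i \<le> h' LAST i \<and> h' LAST i \<le> N \<and> h' CUR i = h' FIRST i \<and>
      (\<forall>u. 1 \<le> u \<longrightarrow> u < N \<longrightarrow> (h' PAR u = i \<longleftrightarrow> h' FIRST i \<le> u \<and> u < h' LAST i)) \<and>
      chset (h' NEXTE) (h' ENDS i) (ends (ns i)) \<and>
      (\<forall>k \<in> thru (ns i). F k \<noteq> ns i \<longrightarrow> (\<exists>u. 1 \<le> u \<and> u < N \<and> h' PAR u = i \<and> prefix (ns u) (F k)))"
    proof cases
      case 1
      then show ?thesis using parts(3) unfolding finished_def h' by auto
    next
      case 2
      then show ?thesis using v by (auto simp: h')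
    qed
  qed
  \<comment> \<open>Every pattern through a child of \<open>v\<close> passes through
    \<open>v\<close>, which is disjoint from the other unprocessed nodes; two children of
    \<open>v\<close> have states of equal length, hence share a pattern only if they
    coincide.\<close>
  moreover have "thru (ns i) \<inter> thru (ns i') = {}" if i: "v + 1 \<le> i" "i < i'" "i' < N" for i i'
  proof (rule ccontr)
    assume "thru (ns i) \<inter> thru (ns i') \<noteq> {}"
    then obtain k where k: "k \<in> thru (ns i)" "k \<in> thru (ns i')" by auto
    note ti = treeD(6)[OF parts(1), of i] treeD(6)[OF parts(1), of i']
    have below: "k \<in> thru (ns (h PAR x))" if "x = i \<or> x = i'" for x
      using ti that i v(1) k by (auto simp: thru_def) (metis prefix_order.trans prefixeq_butlast)+
    consider "h PAR i \<noteq> v" "h PAR i' \<noteq> v" | "h PAR i = v" "h PAR i' = v"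
      | "h PAR i \<noteq> v" "h PAR i' = v" | "h PAR i = v" "h PAR i' \<noteq> v" by blast
    then show False
    proof cases
      case 1
      then show ?thesis using pend(2)[of i i'] i k by auto
    next
      case 2
      then have "length (ns i) = length (ns i')"
        using sibling_length[OF parts(1), of i i'] i v(1) by simp
      then have "ns i = ns i'" using k by (auto simp: thru_def) (metis append_eq_append_conv prefix_def)
      then show ?thesis using tree_eq[OF parts(1), of i i'] i v(1) by auto
    next
      case 3
      then have "k \<in> thru (ns v)" using below[of i'] by metis
      moreover have "v < i" "i < N" using i by auto
      ultimately show ?thesis using pend(2)[of v i] 3 PAR_v k by blast
    next
      case 4
      then have "k \<in> thru (ns v)" using below[of i] by metis
      moreover have "v < i'" "i' < N" using i by auto
      ultimately show ?thesis using pend(2)[of v i'] 4 PAR_v k by blast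
    qed
  qed
  ultimately show ?thesis
    using pend v unfolding outer_def by (auto simp: h')
qed

text \<open>For completeness, induct on the state: a pattern through \<open>S @ [c]\<close> does not
  end in the node of \<open>S\<close>, so it continues in a child, and comparing lengths identifies
  that child.\<close>

lemma outer_end:
  assumes out: "outer N N ns h"
  shows "ns ` {0..<N} = Pref f D"
proof
  have parts: "tree N ns h" "finished N N ns h" using out by (auto simp: outer_def)
  show "ns ` {0..<N} \<subseteq> Pref f D" using tree_Pref[OF parts(1)] by auto
  have "S \<in> ns ` {0..<N}" if "S \<in> Pref f D" for S
    using that
  proof (induction S rule: rev_induct)
    case Nil
    then show ?case using treeD(1,2)[OF parts(1)] by (auto intro!: image_eqI[of _ _ 0])
  next
    case (snoc c S)
    then have "S \<in> Pref f D" by (metis Pref_prefix prefixI)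
    then obtain i where i: "0 \<le> i" "i < N" "ns i = S" using snoc by auto
    obtain P where P: "P \<in> set D" "prefix (S @ [c]) (f P)" using snoc.prems by (auto simp: Pref_def)
    then obtain n where n: "n < length D" "D ! n = P" by (auto simp: in_set_conv_nth)
    have k: "1 \<le> int n + 1" "int n + 1 \<le> d" "F (int n + 1) = f P"
      using n by (auto simp: d_def F_def pat_def)
    then have "int n + 1 \<in> thru (ns i)" "F (int n + 1) \<noteq> ns i"
      using P(2) i by (auto simp: thru_def prefix_def)
    then obtain u where u: "1 \<le> u" "u < N" "h PAR u = i" "prefix (ns u) (f P)"
      using parts(2) i k(3) unfolding finished_def by metis
    have "length (ns u) = length (S @ [c])"
      using treeD(6)[OF parts(1) u(1,2)] u(3) i(3) by (metis append_butlast_last_id length_append_singleton)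
    then have "ns u = S @ [c]" using u(4) P(2) by (metis append_eq_append_conv prefix_def)
    then show ?case using u by (auto intro!: image_eqI[of _ _ u])
  qed
  then show "Pref f D \<subseteq> ns ` {0..<N}" by blast
qed

lemma sum_thru:
  assumes "tree N ns h"
  shows "(\<Sum>i\<in>{0..<N}. int (card (thru (ns i)))) \<le> 2 * m"
proof -
  have card: "card (thru S) = card {i \<in> {..<length D}. prefix S (f (D ! i))}" for S
  proof (rule bij_betw_same_card[of "\<lambda>k. nat (k - 1)"])
    show "bij_betw (\<lambda>k. nat (k - 1)) (thru S) {i \<in> {..<length D}. prefix S (f (D ! i))}"
      by (rule bij_betw_byWitness[where f' = "\<lambda>i. int i + 1"]) (auto simp: thru_def d_def F_def pat_def)
  qed
  have "(\<Sum>i\<in>{0..<N}. int (card (thru (ns i)))) = (\<Sum>S\<in>ns ` {0..<N}. int (card (thru S)))"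
    by (rule sum.reindex[OF treeD(5)[OF assms], unfolded o_def, symmetric])
  also have "\<dots> \<le> (\<Sum>S\<in>Pref f D. int (card (thru S)))"
    by (rule sum_mono2) (use tree_Pref[OF assms] in auto)
  also have "\<dots> = int (\<Sum>S\<in>Pref f D. card {i \<in> {..<length D}. prefix S (f (D ! i))})"
    by (simp add: card)
  also have "\<dots> \<le> 2 * m" using sum_card_through by (simp add: m_def del: of_nat_sum)
  finally show ?thesis .
qed

lemma trie_spec:
  assumes a: "rg a 9 = B" "rg a 14 = nb" "lo a = lo1"
      "\<And>i. 1 \<le> i \<Longrightarrow> i \<le> d \<Longrightarrow> fl a START i = pos i - 1 \<and> fl a NEXT i = i - 1"
      "fl a LIST = (\<lambda>_. 0)(0 := d)" "\<And>j. 3 \<le> j \<Longrightarrow> fl a j = (\<lambda>_. 0)"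
    and Q: "\<And>a' t' ns. outer (rg a' 15) (rg a' 15) ns (fl a') \<Longrightarrow> rg a' 9 = B \<Longrightarrow> rg a' 14 = nb \<Longrightarrow>
      lo a' = lo1 \<Longrightarrow> en a' = en a \<Longrightarrow> t' \<le> t + 1500 * m \<Longrightarrow> Q a' t'"
  shows "wp trie_prog Q a t"
proof (rule vc_sound)
  \<comment> \<open>\<open>N\<close> grows while the loop runs, so the variant is measured against
    the fixed bound \<open>m + 1\<close>.\<close>
  define I :: "nat \<Rightarrow> astate \<Rightarrow> int \<Rightarrow> bool" where
    "I = (\<lambda>n a' t'. \<exists>ns. n = nat (m + 1 - rg a' 16) \<and> outer (rg a' 16) (rg a' 15) ns (fl a') \<and>
      rg a' 9 = B \<and> rg a' 14 = nb \<and> lo a' = lo1 \<and> en a' = en a \<and>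
      (\<forall>i. 1 \<le> i \<longrightarrow> i \<le> d \<longrightarrow> fl a' START i = pos i - 1) \<and>
      t' \<le> t + 100 + 200 * rg a' 16 + 300 * (\<Sum>i\<in>{0..<rg a' 16}. int (card (thru (ns i)))))"
  have "wp (Wh (LtE (Var 16) (Var 15)) trie_outer) Q a' t'" if "I (nat (m + 1)) a' t'" for a' t'
    using that
  proof (rule wp_while[where I = I])
    fix n :: nat and a' :: astate and t' :: int
    let ?v = "rg a' 16" and ?N = "rg a' 15"
    assume "I n a' t'"
    then obtain ns where out: "outer ?v ?N ns (fl a')" and n: "n = nat (m + 1 - ?v)"
      and a': "rg a' 9 = B" "rg a' 14 = nb" "lo a' = lo1" "en a' = en a"
        "\<And>i. 1 \<le> i \<Longrightarrow> i \<le> d \<Longrightarrow> fl a' START i = pos i - 1"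
      and t': "t' \<le> t + 100 + 200 * ?v + 300 * (\<Sum>i\<in>{0..<?v}. int (card (thru (ns i))))"
      unfolding I_def by blast
    have tree: "tree ?N ns (fl a')" and v0: "0 \<le> ?v" "?v \<le> ?N" using out by (auto simp: outer_def)
    have N: "?N \<le> m + 1" by (rule tree_bound[OF tree])
    show "okb a' (LtE (Var 16) (Var 15))" by simp
    {
      assume "\<not> evb a' (LtE (Var 16) (Var 15))"
      then have v: "?v = ?N" using v0 by simp
      then show "Q a' (t' + (1 + costb (LtE (Var 16) (Var 15))))"
        using sum_thru[OF tree] out a' t' N d_m by (intro Q[of a' ns]) auto
    next
      assume "evb a' (LtE (Var 16) (Var 15))"
      then have v: "?v < ?N" by simp
      note enter = outer_enter[OF out v refl]
      have vM: "?v \<le> M" using v N B_bounds d_m by simp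
      have post: "\<exists>n'<n. I n' b s"
        if "inner ?v (rg c 15) ns' {} 0 (fl c)" "\<And>i. i \<le> ?v \<Longrightarrow> ns' i = ns i"
          "rg b 9 = B" "rg b 14 = nb" "lo b = lo1" "en b = en a'" "rg b 15 = rg c 15" "rg b 16 = ?v + 1"
          "\<And>i. 1 \<le> i \<Longrightarrow> i \<le> d \<Longrightarrow> fl b START i = pos i - 1"
          "fl b = (fl c)(LAST := (fl c LAST)(?v := rg c 15))"
          "s \<le> t' + 150 + 300 * int (card (thru (ns ?v)))" for b s c ns'
      proof -
        have "{0..<?v + 1} = insert ?v {0..<?v}" using v0 by auto
        then have "(\<Sum>i\<in>{0..<?v + 1}. int (card (thru (ns' i)))) =
            (\<Sum>i\<in>{0..<?v}. int (card (thru (ns i)))) + int (card (thru (ns ?v)))"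
          using that(2) by (simp add: that(2))
        then have "I (nat (m + 1 - (?v + 1))) b s"
          unfolding I_def using that outer_exit[OF that(1) that(10)] a' t' by (intro exI[of _ ns']) auto
        moreover have "nat (m + 1 - (?v + 1)) < n" using n v N by simp
        ultimately show ?thesis by blast
      qed
      have len: "fl a' DEP ?v = int (length (ns ?v))" by (rule tree_dep[OF tree v0(1) v])
      show "wp trie_outer (\<lambda>a' t'. \<exists>n'<n. I n' a' t') a' (t' + (1 + costb (LtE (Var 16) (Var 15))))"
        apply (rule vc_sound)
        apply (simp add: trie_outer_def v0 vM a')
        apply (rule trie_inner_spec[where ns = ns and A = "thru (ns ?v)" and v = ?v])
        using enter apply simp
        using a' apply simp_all
        apply (intro conjI small)
        using v0 N v d_m B_bounds vM apply simp_all
        subgoal for c s ns2 by (rule post[where c = c and ns' = ns2]) simp_all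
        done
    }
  qed
  moreover have "outer 0 1 (\<lambda>_. []) ((fl a)(PAR := (fl a PAR)(0 := - 1)))"
    by (rule outer_start) (use a(4-) in simp_all)
  then have "I (nat (m + 1)) (a\<lparr>fl := (fl a)(PAR := (fl a PAR)(0 := - 1)), rg := (rg a)(15 := 1, 16 := 0)\<rparr>) (13 + t)"
    unfolding I_def using a by (auto intro!: exI[of _ "\<lambda>_. []"])
  ultimately show "vc trie_prog Q a t"
    using a d_m B_bounds by (auto simp: trie_prog_def intro!: small)
qed

end

section \<open>Sorting the children\<close>

text \<open>The children of \<open>v\<close> are the nodes \<open>FIRST v, \<dots>, LAST v - 1\<close>. Scanning the symbol codes in
  increasing order fills the slots \<open>FIRST v, \<dots>, LAST v - 1\<close> with these nodes in order of their
  symbols.\<close>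

definition sort_inner :: cmd where
  "sort_inner =
    SetF SLOT (Fld CUR (Fld PAR (Var 21))) (Var 21) ;;
    SetF CUR (Fld PAR (Var 21)) (Fld CUR (Fld PAR (Var 21)) .+ Num 1) ;;
    21 ::= Fld NXS (Var 21)"

definition sort_outer :: cmd where
  "sort_outer =
    21 ::= Fld LC (Var 20) ;;
    Wh (NotE (EqE (Var 21) (Num 0))) sort_inner ;;
    20 ::= Var 20 .+ Num 1"

definition sort_prog :: cmd where
  "sort_prog = 20 ::= Num 0 ;; Wh (LtE (Var 20) (Var 14 .+ Num 4)) sort_outer"

context loaded
begin

definition trie :: "int \<Rightarrow> (int \<Rightarrow> int list) \<Rightarrow> (nat \<Rightarrow> int \<Rightarrow> int) \<Rightarrow> bool" where
  "trie N ns h \<longleftrightarrow> tree N ns h \<and> sym_chains N h \<and> ns ` {0..<N} = Pref f D \<and>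
    (\<forall>i. 0 \<le> i \<longrightarrow> i < N \<longrightarrow> 1 \<le> h FIRST i \<and> h FIRST i \<le> h LAST i \<and> h LAST i \<le> N \<and>
      (\<forall>u. 1 \<le> u \<longrightarrow> u < N \<longrightarrow> (h PAR u = i \<longleftrightarrow> h FIRST i \<le> u \<and> u < h LAST i)) \<and>
      chset (h NEXTE) (h ENDS i) (ends (ns i)))"

lemma trieD:
  assumes "trie N ns h"
  shows "tree N ns h" "sym_chains N h" "ns ` {0..<N} = Pref f D"
    "0 \<le> i \<Longrightarrow> i < N \<Longrightarrow> 1 \<le> h FIRST i \<and> h FIRST i \<le> h LAST i \<and> h LAST i \<le> N"
    "0 \<le> i \<Longrightarrow> i < N \<Longrightarrow> 1 \<le> u \<Longrightarrow> u < N \<Longrightarrow> h PAR u = i \<longleftrightarrow> h FIRST i \<le> u \<and> u < h LAST i"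
    "0 \<le> i \<Longrightarrow> i < N \<Longrightarrow> chset (h NEXTE) (h ENDS i) (ends (ns i))"
  using assms unfolding trie_def by blast+

lemma outer_trie:
  assumes out: "outer N N ns h"
  shows "trie N ns h"
proof -
  have fin: "finished N N ns h" and "tree N ns h" "sym_chains N h" using out by (simp_all add: outer_def)
  moreover have "1 \<le> h FIRST i \<and> h FIRST i \<le> h LAST i \<and> h LAST i \<le> N \<and>
      (\<forall>u. 1 \<le> u \<longrightarrow> u < N \<longrightarrow> (h PAR u = i \<longleftrightarrow> h FIRST i \<le> u \<and> u < h LAST i)) \<and>
      chset (h NEXTE) (h ENDS i) (ends (ns i))" if "0 \<le> i" "i < N" for i
    using fin that unfolding finished_def by simp
  ultimately show ?thesis using outer_end[OF out] unfolding trie_def by blast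
qed

definition "children N h i = {u. 1 \<le> u \<and> u < N \<and> h PAR u = i}" for h :: "nat \<Rightarrow> int \<Rightarrow> int"

lemma children_interval:
  assumes "trie N ns h" "0 \<le> i" "i < N"
  shows "children N h i = {h FIRST i..<h LAST i}"
proof (intro set_eqI iffI)
  fix u assume "u \<in> {h FIRST i..<h LAST i}"
  then show "u \<in> children N h i"
    using trieD(4)[OF assms] trieD(5)[OF assms, of u] by (simp add: children_def)
next
  fix u assume "u \<in> children N h i"
  then have "1 \<le> u" "u < N" "h PAR u = i" by (simp_all add: children_def)
  then show "u \<in> {h FIRST i..<h LAST i}" using trieD(5)[OF assms, of u] by auto
qed

lemma SYM_inj:
  assumes "tree N ns h" "1 \<le> u" "u < N" "1 \<le> u'" "u' < N" "h PAR u = h PAR u'" "h SYM u = h SYM u'"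
  shows "u = u'"
proof -
  note t = treeD(6)[OF assms(1-3)] treeD(6)[OF assms(1,4,5)]
  have "ns u = ns (h PAR u) @ [last (ns u')]"
    by (rule tree_child[OF assms(1-3), of "h REP u'"]) (use t assms(7) last_in_F in auto)
  then have "ns u = ns u'" using t assms(6) by (metis append_butlast_last_id)
  then show ?thesis using tree_eq[OF assms(1)] assms by simp
qed

text \<open>\<open>Z\<close> is the set of nodes distributed so far. Each parent owns a sorted
  initial piece of its slot range, and \<open>CUR\<close> is the next free slot.\<close>

definition placed :: "int \<Rightarrow> int set \<Rightarrow> (nat \<Rightarrow> int \<Rightarrow> int) \<Rightarrow> bool" where
  "placed N Z h \<longleftrightarrow> (\<forall>i. 0 \<le> i \<longrightarrow> i < N \<longrightarrow> (\<exists>ch. set ch = Z \<inter> children N h i \<and>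
    sorted_wrt (\<lambda>x y. h SYM x < h SYM y) ch \<and> h CUR i = h FIRST i + int (length ch) \<and>
    (\<forall>x < length ch. h SLOT (h FIRST i + int x) = ch ! x)))"

lemma placed_length:
  assumes "trie N ns h" "0 \<le> i" "i < N" "set ch \<subseteq> children N h i"
    "sorted_wrt (\<lambda>x y. h SYM x < h SYM y) ch"
  shows "int (length ch) \<le> h LAST i - h FIRST i"
    and "u \<in> children N h i \<Longrightarrow> u \<notin> set ch \<Longrightarrow> int (length ch) < h LAST i - h FIRST i"
proof -
  have "sorted_wrt (\<lambda>x y. x \<noteq> y) ch" by (rule sorted_wrt_mono_rel[OF _ assms(5)]) auto
  then have "distinct ch" by (simp add: distinct_conv_nth sorted_wrt_iff_nth_less) (metis linorder_neqE_nat)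
  then have len: "length ch = card (set ch)" by (simp add: distinct_card)
  note ci = children_interval[OF assms(1-3)]
  have cardc: "int (card (children N h i)) = h LAST i - h FIRST i"
    using trieD(4)[OF assms(1-3)] by (simp add: ci)
  have "card (set ch) \<le> card (children N h i)"
    by (rule card_mono) (use assms(4) ci in auto)
  then show "int (length ch) \<le> h LAST i - h FIRST i" using cardc len by simp
  assume u: "u \<in> children N h i" "u \<notin> set ch"
  then have "card (set ch) < card (children N h i)"
    by (intro psubset_card_mono) (use assms(4) ci in auto)
  then show "int (length ch) < h LAST i - h FIRST i" using cardc len by simp
qed

lemma placed_insert:
  assumes tr: "trie N ns h" and Z: "placed N Z h" and u: "1 \<le> u" "u < N" "u \<notin> Z"
    and max: "\<And>z. z \<in> Z \<Longrightarrow> z \<in> children N h (h PAR u) \<Longrightarrow> h SYM z < h SYM u"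
    and h': "h' = h(SLOT := (h SLOT)(h CUR (h PAR u) := u),
      CUR := (h CUR)(h PAR u := h CUR (h PAR u) + 1))"
  shows "placed N (insert u Z) h'" "0 \<le> h CUR (h PAR u)" "h CUR (h PAR u) < N"
proof -
  define p where "p = h PAR u"
  have p: "0 \<le> p" "p < N" using treeD(6)[OF trieD(1)[OF tr] u(1,2)] u by (auto simp: p_def)
  have up: "u \<in> children N h p" using u by (simp add: children_def p_def)
  obtain ch where ch: "set ch = Z \<inter> children N h p" "sorted_wrt (\<lambda>x y. h SYM x < h SYM y) ch"
      "h CUR p = h FIRST p + int (length ch)" "\<And>x. x < length ch \<Longrightarrow> h SLOT (h FIRST p + int x) = ch ! x"
    using Z p unfolding placed_def by blast
  have "int (length ch) < h LAST p - h FIRST p"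
    by (rule placed_length(2)[OF tr p _ ch(2) up]) (use ch(1) u(3) in auto)
  then have cur: "h FIRST p \<le> h CUR p" "h CUR p < h LAST p" using ch(3) by auto
  then show "0 \<le> h CUR (h PAR u)" "h CUR (h PAR u) < N"
    using trieD(4)[OF tr p] by (auto simp: p_def)
  \<comment> \<open>Slots are read as node numbers here: the slot range of a parent is the interval
    of its children, so \<open>PAR\<close> tells the owner of a slot and ranges of different parents
    cannot overlap.\<close>
  have cur_child: "h CUR p \<in> children N h p" using cur children_interval[OF tr p] by simp
  show "placed N (insert u Z) h'"
    unfolding placed_def
  proof (intro allI impI)
    fix i assume i: "0 \<le> i" "i < N"
    have ch_eq: "children N h' i = children N h i" by (simp add: children_def h')
    show "\<exists>ch. set ch = insert u Z \<inter> children N h' i \<and> sorted_wrt (\<lambda>x y. h' SYM x < h' SYM y) ch \<and>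
      h' CUR i = h' FIRST i + int (length ch) \<and> (\<forall>x < length ch. h' SLOT (h' FIRST i + int x) = ch ! x)"
    proof (cases "i = p")
      case True
      then show ?thesis
        unfolding ch_eq using ch up max
        by (intro exI[of _ "ch @ [u]"])
          (auto simp: h' p_def[symmetric] sorted_wrt_append nth_append less_Suc_eq)
    next
      case False
      obtain ch' where ch': "set ch' = Z \<inter> children N h i" "sorted_wrt (\<lambda>x y. h SYM x < h SYM y) ch'"
          "h CUR i = h FIRST i + int (length ch')" "\<And>x. x < length ch' \<Longrightarrow> h SLOT (h FIRST i + int x) = ch' ! x"
        using Z i unfolding placed_def by blast
      have "int (length ch') \<le> h LAST i - h FIRST i"
        by (rule placed_length(1)[OF tr i _ ch'(2)]) (use ch'(1) in auto)
      then have "h FIRST i + int x \<in> children N h i" if "x < length ch'" for x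
        using that children_interval[OF tr i] by simp
      then have "h PAR (h FIRST i + int x) = i" if "x < length ch'" for x
        using that by (simp add: children_def)
      moreover have "h PAR (h CUR p) = p" using cur_child by (simp add: children_def)
      ultimately have "h FIRST i + int x \<noteq> h CUR p" if "x < length ch'" for x
        using False that by metis
      moreover have "u \<notin> children N h i" using False by (simp add: children_def p_def)
      ultimately show ?thesis
        unfolding ch_eq using ch' False by (intro exI[of _ ch']) (auto simp: h' p_def[symmetric])
    qed
  qed
qed

definition slots :: "int \<Rightarrow> (nat \<Rightarrow> int \<Rightarrow> int) \<Rightarrow> bool" where
  "slots N h \<longleftrightarrow> (\<forall>i. 0 \<le> i \<longrightarrow> i < N \<longrightarrow>
    (\<forall>x y. h FIRST i \<le> x \<longrightarrow> x < y \<longrightarrow> y < h LAST i \<longrightarrow> h SYM (h SLOT x) < h SYM (h SLOT y)) \<and>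
    (\<forall>x. h FIRST i \<le> x \<longrightarrow> x < h LAST i \<longrightarrow> h SLOT x \<in> children N h i) \<and>
    (\<forall>u \<in> children N h i. \<exists>x. h FIRST i \<le> x \<and> x < h LAST i \<and> h SLOT x = u))"

lemma placed_slots:
  assumes tr: "trie N ns h" and Z: "placed N Z h" "\<And>u. 1 \<le> u \<Longrightarrow> u < N \<Longrightarrow> u \<in> Z"
  shows "slots N h"
  unfolding slots_def
proof (intro allI impI)
  fix i assume i: "0 \<le> i" "i < N"
  have "Z \<inter> children N h i = children N h i" using Z(2) by (auto simp: children_def)
  then obtain ch where ch: "set ch = children N h i" "sorted_wrt (\<lambda>x y. h SYM x < h SYM y) ch"
      "\<And>x. x < length ch \<Longrightarrow> h SLOT (h FIRST i + int x) = ch ! x"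
    using Z(1) i unfolding placed_def by metis
  have "sorted_wrt (\<lambda>x y. x \<noteq> y) ch" by (rule sorted_wrt_mono_rel[OF _ ch(2)]) auto
  then have "distinct ch" by (simp add: distinct_conv_nth sorted_wrt_iff_nth_less) (metis linorder_neqE_nat)
  then have len: "int (length ch) = h LAST i - h FIRST i"
    using ch(1) children_interval[OF tr i] trieD(4)[OF tr i] by (simp add: distinct_card[symmetric])
  have slot: "nat (x - h FIRST i) < length ch \<and> h SLOT x = ch ! nat (x - h FIRST i)"
    if "h FIRST i \<le> x" "x < h LAST i" for x
    using ch(3)[of "nat (x - h FIRST i)"] that len by auto
  have "h SYM (h SLOT x) < h SYM (h SLOT y)" if "h FIRST i \<le> x" "x < y" "y < h LAST i" for x y
    using slot[of x] slot[of y] that ch(2) by (simp add: sorted_wrt_iff_nth_less)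
  moreover have "h SLOT x \<in> children N h i" if "h FIRST i \<le> x" "x < h LAST i" for x
    using slot[OF that] ch(1) nth_mem by metis
  moreover have "\<exists>x. h FIRST i \<le> x \<and> x < h LAST i \<and> h SLOT x = u" if "u \<in> children N h i" for u
  proof -
    have "u \<in> set ch" using that ch(1) by simp
    then obtain j where j: "j < length ch" "ch ! j = u" by (auto simp: in_set_conv_nth)
    then have "h SLOT (h FIRST i + int j) = u" using ch(3)[OF j(1)] by simp
    moreover have "h FIRST i \<le> h FIRST i + int j" "h FIRST i + int j < h LAST i" using j(1) len by auto
    ultimately show ?thesis by blast
  qed
  ultimately show "(\<forall>x y. h FIRST i \<le> x \<longrightarrow> x < y \<longrightarrow> y < h LAST i \<longrightarrow> h SYM (h SLOT x) < h SYM (h SLOT y)) \<and>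
    (\<forall>x. h FIRST i \<le> x \<longrightarrow> x < h LAST i \<longrightarrow> h SLOT x \<in> children N h i) \<and>
    (\<forall>u \<in> children N h i. \<exists>x. h FIRST i \<le> x \<and> x < h LAST i \<and> h SLOT x = u)" by blast
qed

definition "below N h a = {u. 1 \<le> u \<and> u < N \<and> h SYM u < a}" for h :: "nat \<Rightarrow> int \<Rightarrow> int"

lemma trie_frame:
  "trie N ns h \<Longrightarrow> trie N ns (h(SLOT := x, CUR := y))"
proof -
  have "tree N ns (h(SLOT := x, CUR := y)) = tree N ns h" by (simp add: tree_def)
  moreover have "sym_chains N (h(SLOT := x, CUR := y)) = sym_chains N h" by (simp add: sym_chains_def)
  ultimately show "trie N ns h \<Longrightarrow> trie N ns (h(SLOT := x, CUR := y))" by (simp add: trie_def)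
qed

lemma sort_inner_spec:
  assumes tr: "trie N ns (fl a)" and A: "chset (fl a NXS) (rg a 21) A"
      "A = {u. 1 \<le> u \<and> u < N \<and> fl a SYM u = s}"
    and pl: "placed N (below N (fl a) s) (fl a)"
    and a: "rg a 9 = B" "lo a = lo1"
    and Q: "\<And>a' t'. trie N ns (fl a') \<Longrightarrow> placed N (below N (fl a') (s + 1)) (fl a') \<Longrightarrow>
      (\<And>x. x \<noteq> 21 \<Longrightarrow> rg a' x = rg a x) \<Longrightarrow> lo a' = lo1 \<Longrightarrow> en a' = en a \<Longrightarrow>
      fl a' SYM = fl a SYM \<Longrightarrow> fl a' LC = fl a LC \<Longrightarrow> fl a' NXS = fl a NXS \<Longrightarrow>
      t' \<le> t + 10 + 150 * int (card A) \<Longrightarrow> Q a' t'"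
  shows "wp (Wh (NotE (EqE (Var 21) (Num 0))) sort_inner) Q a t"
proof -
  define I :: "nat \<Rightarrow> astate \<Rightarrow> int \<Rightarrow> bool" where
    "I = (\<lambda>n a' t'. \<exists>A'. n = card A' \<and> A' \<subseteq> A \<and> chset (fl a' NXS) (rg a' 21) A' \<and>
      trie N ns (fl a') \<and> placed N (below N (fl a) (s + 1) - A') (fl a') \<and>
      (\<forall>x. x \<noteq> 21 \<longrightarrow> rg a' x = rg a x) \<and> lo a' = lo1 \<and> en a' = en a \<and>
      fl a' SYM = fl a SYM \<and> fl a' LC = fl a LC \<and> fl a' NXS = fl a NXS \<and>
      t' \<le> t + 150 * (int (card A) - int (card A')))"
  have "below N (fl a) (s + 1) - A = below N (fl a) s" by (auto simp: below_def A(2))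
  then have "I (card A) a t" unfolding I_def using assms by auto
  then show ?thesis
  proof (rule wp_while[where I = I])
    fix n :: nat and a' :: astate and t' :: int
    let ?u = "rg a' 21" and ?fl = "fl a'"
    assume "I n a' t'"
    then obtain A' where n: "n = card A'" "A' \<subseteq> A" and ch: "chset (?fl NXS) ?u A'"
      and tr: "trie N ns ?fl" and pl: "placed N (below N (fl a) (s + 1) - A') ?fl"
      and a': "\<And>x. x \<noteq> 21 \<Longrightarrow> rg a' x = rg a x" "lo a' = lo1" "en a' = en a"
        "?fl SYM = fl a SYM" "?fl LC = fl a LC" "?fl NXS = fl a NXS"
      and t': "t' \<le> t + 150 * (int (card A) - int (card A'))"
      unfolding I_def by blast
    show "okb a' (NotE (EqE (Var 21) (Num 0)))" using B_bounds d_m by (auto intro!: small)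
    {
      assume "\<not> evb a' (NotE (EqE (Var 21) (Num 0)))"
      then have "A' = {}" using ch chset_0 by auto
      then show "Q a' (t' + (1 + costb (NotE (EqE (Var 21) (Num 0)))))"
        using tr pl a' t' by (intro Q) (auto simp: below_def)
    next
      assume "evb a' (NotE (EqE (Var 21) (Num 0)))"
      then have u0: "?u \<noteq> 0" by simp
      note pop = chset_pop[OF ch u0]
      have u: "1 \<le> ?u" "?u < N" "?fl SYM ?u = s" using pop(1) n(2) A(2) a' by auto
      have tree: "tree N ns ?fl" by (rule trieD(1)[OF tr])
      note tu = treeD(6)[OF tree u(1,2)]
      \<comment> \<open>Siblings with equal symbol codes coincide, so a sibling placed earlier has a
        strictly smaller code.\<close>
      have max: "?fl SYM z < ?fl SYM ?u"
        if "z \<in> below N (fl a) (s + 1) - A'" "z \<in> children N ?fl (?fl PAR ?u)" for z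
      proof -
        have "z \<noteq> ?u" using that(1) pop(1) by auto
        moreover have "1 \<le> z" "z < N" "?fl SYM z \<le> s" "?fl PAR z = ?fl PAR ?u"
          using that a'(4) by (auto simp: below_def children_def)
        ultimately show ?thesis using SYM_inj[OF tree, of z ?u] u by fastforce
      qed
      have nu: "?u \<notin> below N (fl a) (s + 1) - A'" using pop(1) by simp
      note ins = placed_insert[OF tr pl u(1,2) nu max refl]
      have "insert ?u (below N (fl a) (s + 1) - A') = below N (fl a) (s + 1) - (A' - {?u})"
        using u pop(1) a'(4) by (auto simp: below_def)
      note ins1 = ins(1)[unfolded this]
      have card: "card (A' - {?u}) < n" "int (card (A' - {?u})) = int (card A') - 1"
        using pop(1) n(1) chset_finite[OF ch] card_gt_0_iff[of A'] by (auto simp: card_Diff_singleton)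
      have N: "N \<le> m + 1" by (rule tree_bound[OF tree])
      have ok: "0 \<le> ?fl PAR ?u" "?fl PAR ?u \<le> M" "?fl CUR (?fl PAR ?u) \<le> M" "0 \<le> ?u" "?u \<le> M"
      proof -
        have "0 \<le> ?fl PAR ?u" "?fl PAR ?u < ?u" using tu by blast+
        then show "0 \<le> ?fl PAR ?u" "?fl PAR ?u \<le> M" "?fl CUR (?fl PAR ?u) \<le> M" "0 \<le> ?u" "?u \<le> M"
          using u(1,2) N ins(3) B_bounds d_m by linarith+
      qed
      have words: "1 \<in> words w" "?fl CUR (?fl PAR ?u) + 1 \<in> words w"
        using ins(2,3) N B_bounds d_m by (auto intro!: small)
      have reach: "\<exists>n'<n. I n' b x"
        if "rg b = (rg a')(21 := ?fl NXS ?u)" "lo b = lo1" "en b = en a'"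
          "fl b = ?fl(SLOT := (?fl SLOT)(?fl CUR (?fl PAR ?u) := ?u),
            CUR := (?fl CUR)(?fl PAR ?u := ?fl CUR (?fl PAR ?u) + 1))" "x \<le> t' + 150" for b x
      proof -
        have "trie N ns (fl b)" unfolding that(4) by (rule trie_frame[OF tr])
        moreover have "placed N (below N (fl a) (s + 1) - (A' - {?u})) (fl b)"
          unfolding that(4) by (rule ins1)
        moreover have "chset (fl b NXS) (rg b 21) (A' - {?u})" using pop(2) that by simp
        moreover have "A' - {?u} \<subseteq> A" using n(2) by blast
        moreover have "fl b SYM = fl a SYM" "fl b LC = fl a LC" "fl b NXS = fl a NXS"
          using a' that(4) by simp_all
        moreover have "x \<le> t + 150 * (int (card A) - int (card (A' - {?u})))" using t' that(5) card(2) by simp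
        ultimately have "I (card (A' - {?u})) b x"
          unfolding I_def using that(1-3) a'(1,3) by (intro exI[of _ "A' - {?u}"]) simp
        then show ?thesis using card(1) by blast
      qed
      show "wp sort_inner (\<lambda>a' t'. \<exists>n'<n. I n' a' t') a' (t' + (1 + costb (NotE (EqE (Var 21) (Num 0)))))"
        by (intro vc_sound) (use ins(2) ok words a' a in \<open>simp add: sort_inner_def reach\<close>)
    }
  qed
qed

text \<open>A bucket sort: at most \<open>4 * m + 4\<close> codes are scanned, and each node is
  visited once, in the chain of its code.\<close>

lemma sort_spec:
  assumes tr: "trie N ns (fl a)" and cur: "\<And>i. 0 \<le> i \<Longrightarrow> i < N \<Longrightarrow> fl a CUR i = fl a FIRST i"
    and a: "rg a 9 = B" "rg a 14 = nb" "lo a = lo1" "rg a 15 = N"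
    and Q: "\<And>a' t'. trie N ns (fl a') \<Longrightarrow> slots N (fl a') \<Longrightarrow> rg a' 9 = B \<Longrightarrow> rg a' 15 = N \<Longrightarrow>
      lo a' = lo1 \<Longrightarrow> en a' = en a \<Longrightarrow> t' \<le> t + 2000 * m \<Longrightarrow> Q a' t'"
  shows "wp sort_prog Q a t"
proof (rule vc_sound)
  define I :: "nat \<Rightarrow> astate \<Rightarrow> int \<Rightarrow> bool" where
    "I = (\<lambda>n a' t'. n = nat (nb + 4 - rg a' 20) \<and> 0 \<le> rg a' 20 \<and> rg a' 20 \<le> nb + 4 \<and>
      trie N ns (fl a') \<and> placed N (below N (fl a') (rg a' 20)) (fl a') \<and>
      rg a' 9 = B \<and> rg a' 14 = nb \<and> rg a' 15 = N \<and> lo a' = lo1 \<and> en a' = en a \<and>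
      t' \<le> t + 20 + 50 * rg a' 20 + 150 * int (card (below N (fl a') (rg a' 20))))"
  have N: "1 \<le> N" "N \<le> m + 1" using tree_bound[OF trieD(1)[OF tr]] treeD(1)[OF trieD(1)[OF tr]] by auto
  have fin: "finite (below N h s)" for h s
    by (rule finite_subset[of _ "{1..<N}"]) (auto simp: below_def)
  have "wp (Wh (LtE (Var 20) (Var 14 .+ Num 4)) sort_outer) Q a' t'" if "I (nat (nb + 4)) a' t'" for a' t'
    using that
  proof (rule wp_while[where I = I])
    fix n :: nat and a' :: astate and t' :: int
    let ?s = "rg a' 20" and ?fl = "fl a'"
    assume I: "I n a' t'"
    show "okb a' (LtE (Var 20) (Var 14 .+ Num 4))"
      using I table B_bounds d_m by (auto simp: I_def intro!: small)
    {
      assume "\<not> evb a' (LtE (Var 20) (Var 14 .+ Num 4))"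
      then have s: "?s = nb + 4" using I by (auto simp: I_def)
      have tr: "trie N ns ?fl" using I by (simp add: I_def)
      have "u \<in> below N ?fl ?s" if "1 \<le> u" "u < N" for u
        using treeD(6)[OF trieD(1)[OF tr] that] cd_bounds[of "last (ns u)"] last_in_F that s
        by (auto simp: below_def)
      then have "slots N ?fl" using placed_slots[OF tr] I by (auto simp: I_def)
      moreover have "card (below N ?fl ?s) \<le> card {1..<N}"
        by (rule card_mono) (auto simp: below_def)
      ultimately show "Q a' (t' + (1 + costb (LtE (Var 20) (Var 14 .+ Num 4))))"
        using I s N table d_m by (intro Q) (auto simp: I_def)
    next
      assume "evb a' (LtE (Var 20) (Var 14 .+ Num 4))"
      then have s: "0 \<le> ?s" "?s < nb + 4" using I by (auto simp: I_def)
      define A where "A = {u. 1 \<le> u \<and> u < N \<and> ?fl SYM u = ?s}"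
      have A: "chset (?fl NXS) (?fl LC ?s) A"
        using I by (auto simp: I_def trie_def sym_chains_def A_def)
      have card: "int (card (below N ?fl (?s + 1))) = int (card (below N ?fl ?s)) + int (card A)"
      proof -
        have "below N ?fl (?s + 1) = below N ?fl ?s \<union> A" by (auto simp: below_def A_def)
        moreover have "below N ?fl ?s \<inter> A = {}" by (auto simp: below_def A_def)
        ultimately show ?thesis using card_Un_disjoint[OF fin chset_finite[OF A]] by simp
      qed
      have reach: "\<exists>n'<n. I n' b x"
        if "trie N ns (fl c)" "placed N (below N (fl c) (?s + 1)) (fl c)" "fl c SYM = ?fl SYM"
          "\<And>x. x \<noteq> 20 \<Longrightarrow> rg b x = rg c x" "\<And>x. x \<noteq> 21 \<Longrightarrow> rg c x = rg a' x" "rg b 20 = ?s + 1"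
          "fl b = fl c" "lo b = lo1" "en b = en a'"
          "x \<le> t' + 50 + 150 * int (card A)" for b c x
      proof -
        have eq: "below N (fl c) (?s + 1) = below N ?fl (?s + 1)" by (simp add: below_def that(3))
        have "I (nat (nb + 4 - (?s + 1))) b x"
          unfolding I_def using that I s card eq by (auto simp: I_def)
        moreover have "nat (nb + 4 - (?s + 1)) < n" using I s by (auto simp: I_def)
        ultimately show ?thesis by blast
      qed
      have ok: "?s \<le> M" "?s + 1 \<in> words w" "1 \<in> words w"
        using s table B_bounds d_m by (auto intro!: small)
      have I': "rg a' 9 = B" "lo a' = lo1" "trie N ns ?fl" "placed N (below N ?fl ?s) ?fl"
        using I by (auto simp: I_def)
      show "wp sort_outer (\<lambda>a' t'. \<exists>n'<n. I n' a' t') a' (t' + (1 + costb (LtE (Var 20) (Var 14 .+ Num 4))))"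
        apply (rule vc_sound)
        apply (simp add: sort_outer_def s ok I')
        apply (rule sort_inner_spec[where s = ?s and A = A and N = N and ns = ns])
        using I' A A_def apply simp_all
        subgoal for c x by (rule conjI, (simp add: ok; fail)?, (intro conjI)?; (rule reach[where c = c])?; simp add: ok)
        done
    }
  qed
  moreover have "I (nat (nb + 4)) (a\<lparr>rg := (rg a)(20 := 0)\<rparr>) (t + 2)"
  proof -
    have "below N (fl a) 0 = {}"
      using treeD(6)[OF trieD(1)[OF tr]] cd_bounds last_in_F by (fastforce simp: below_def)
    then show ?thesis
      unfolding I_def using assms table N by (auto simp: placed_def)
  qed
  ultimately show "vc sort_prog Q a t"
    using a d_m B_bounds by (auto simp: sort_prog_def intro!: small)
qed

end

section \<open>Transitions\<close>

definition search_body :: cmd where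
  "search_body =
    7 ::= Op Div (Var 4 .+ Var 5) (Num 2) ;;
    Ite (LtE (Fld SYM (Fld SLOT (Var 7))) (Var 3)) (4 ::= Var 7 .+ Num 1) (5 ::= Var 7)"

text \<open>The input symbol is not renamed, be it a query or a re-encoding, so the search begins
  with the table. A zero cell already excludes a transition; otherwise the loop finds the least slot
  whose code is not smaller.\<close>

definition search_prog :: cmd where
  "search_prog =
    locate ;;
    Ite (EqE (Low (Var 2)) (Num 0)) (0 ::= Num (-1))
      (3 ::= Low (Var 2) .+ Var 3 ;; 4 ::= Fld FIRST (Var 0) ;; 6 ::= Fld LAST (Var 0) ;; 5 ::= Var 6 ;;
       Wh (LtE (Var 4) (Var 5)) search_body ;;
       Ite (LtE (Var 4) (Var 6))
         (Ite (EqE (Fld SYM (Fld SLOT (Var 4))) (Var 3)) (0 ::= Fld SLOT (Var 4)) (0 ::= Num (-1)))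
         (0 ::= Num (-1)))"

context loaded
begin

definition "is_goto N ns S c x \<longleftrightarrow>
  (if S @ [c] \<in> Pref f D then 0 \<le> x \<and> x < N \<and> ns x = S @ [c] else x = -1)"

text \<open>The symbol \<open>c\<close> need not occur in any encoded pattern. A nonzero cell,
  possibly due to another symbol of the same cell, is enough for \<open>code_inj\<close>, so an
  unknown symbol never matches the code of a node.\<close>

lemma child_unique:
  assumes tr: "trie N ns h" and i: "0 \<le> i" "i < N" and u: "u \<in> children N h i"
    and c: "lo1 (bkt c) \<noteq> 0" "h SYM u = cd c"
  shows "ns u = ns i @ [c]"
proof -
  have u': "1 \<le> u" "u < N" "h PAR u = i" using u by (auto simp: children_def)
  note tu = treeD(6)[OF trieD(1)[OF tr] u'(1,2)]
  then have "last (ns u) \<in> set (F (h REP u))" using last_in_F by blast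
  then have "lo1 (bkt (last (ns u))) \<noteq> 0" using seen tu by blast
  then have "last (ns u) = c" using code_inj[OF table(1) _ c(1)] tu c(2) by simp
  then show ?thesis using tu u'(3) by (metis append_butlast_last_id)
qed

lemma child_exists:
  assumes tr: "trie N ns h" and i: "0 \<le> i" "i < N" and S: "ns i @ [c] \<in> Pref f D"
  obtains u where "u \<in> children N h i" "h SYM u = cd c" "ns u = ns i @ [c]" "lo1 (bkt c) \<noteq> 0"
proof -
  note tree = trieD(1)[OF tr]
  obtain u where u: "0 \<le> u" "u < N" "ns u = ns i @ [c]"
    using S trieD(3)[OF tr] by (metis (no_types, lifting) atLeastLessThan_iff imageE)
  have u1: "1 \<le> u" using treeD(2)[OF tree] u by (cases "u = 0") auto
  note tu = treeD(6)[OF tree u1 u(2)]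
  have "h PAR u = i" using tree_eq[OF tree, of "h PAR u" i] tu u i by auto
  moreover have "lo1 (bkt c) \<noteq> 0" using seen[of c "h REP u"] last_in_F[of "ns u"] tu u(3) by auto
  ultimately show ?thesis using that[of u] u u1 tu by (simp add: children_def)
qed

text \<open>Siblings differ in their last symbols. This turns the length of the searched range into
  the out-degree, and so the search time into log \<pi>.\<close>

lemma children_card:
  assumes tr: "trie N ns h" and i: "0 \<le> i" "i < N"
  shows "h LAST i - h FIRST i \<le> int (max_out_degree f D)"
proof -
  note tree = trieD(1)[OF tr]
  have "inj_on (\<lambda>u. last (ns u)) (children N h i)"
  proof (rule inj_onI)
    fix u v assume "u \<in> children N h i" "v \<in> children N h i" "last (ns u) = last (ns v)"
    then show "u = v"
      using SYM_inj[OF tree, of u v] treeD(6)[OF tree, of u] treeD(6)[OF tree, of v]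
      by (simp add: children_def)
  qed
  moreover have "(\<lambda>u. last (ns u)) ` children N h i \<subseteq> {c. ns i @ [c] \<in> Pref f D}"
  proof
    fix c assume "c \<in> (\<lambda>u. last (ns u)) ` children N h i"
    then obtain u where u: "1 \<le> u" "u < N" "h PAR u = i" "c = last (ns u)" by (auto simp: children_def)
    then have "ns i @ [c] = ns u" using treeD(6)[OF tree u(1,2)] by simp
    then show "c \<in> {c. ns i @ [c] \<in> Pref f D}" using tree_Pref[OF tree, of u] u by simp
  qed
  ultimately have "card (children N h i) \<le> card {c. ns i @ [c] \<in> Pref f D}"
    using card_inj_on_le[OF _ _ finite_children] by blast
  also have "\<dots> \<le> max_out_degree f D" by (rule out_degree) (rule tree_Pref[OF tree i])
  finally show ?thesis using children_interval[OF tr i] by simp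
qed

lemma search_loop:
  assumes tr: "trie N ns (fl a)" and sl: "slots N (fl a)" and i: "0 \<le> i" "i < N"
    and a: "rg a 9 = B" "rg a 4 = fl a FIRST i" "rg a 5 = fl a LAST i"
    and size: "fl a LAST i - fl a FIRST i < 2 ^ L"
    and Q: "\<And>a' t'. fl a FIRST i \<le> rg a' 4 \<Longrightarrow> rg a' 4 \<le> fl a LAST i \<Longrightarrow>
      (\<And>x. fl a FIRST i \<le> x \<Longrightarrow> x < rg a' 4 \<Longrightarrow> fl a SYM (fl a SLOT x) < rg a 3) \<Longrightarrow>
      (\<And>x. rg a' 4 \<le> x \<Longrightarrow> x < fl a LAST i \<Longrightarrow> rg a 3 \<le> fl a SYM (fl a SLOT x)) \<Longrightarrow>
      (\<And>x. x \<noteq> 4 \<Longrightarrow> x \<noteq> 5 \<Longrightarrow> x \<noteq> 7 \<Longrightarrow> rg a' x = rg a x) \<Longrightarrow>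
      lo a' = lo a \<Longrightarrow> fl a' = fl a \<Longrightarrow> en a' = en a \<Longrightarrow> t' \<le> t + 10 + 50 * int L \<Longrightarrow> Q a' t'"
  shows "wp (Wh (LtE (Var 4) (Var 5)) search_body) Q a t"
proof -
  note fl_i = trieD(4)[OF tr i]
  have N: "N \<le> m + 1" by (rule tree_bound[OF trieD(1)[OF tr]])
  have mono: "fl a SYM (fl a SLOT x) \<le> fl a SYM (fl a SLOT y)"
    if "fl a FIRST i \<le> x" "x \<le> y" "y < fl a LAST i" for x y
    using sl that i unfolding slots_def by (cases "x = y") (auto simp: less_imp_le)
  have slot: "1 \<le> fl a SLOT x \<and> fl a SLOT x < N" if "fl a FIRST i \<le> x" "x < fl a LAST i" for x
    using sl that i unfolding slots_def children_def by blast
  \<comment> \<open>The variant \<open>n\<close> is also an exponent: the range is shorter than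
    \<open>2 ^ n\<close>, so each halving lowers it by one and \<open>L\<close> rounds
    suffice.\<close>
  define I :: "nat \<Rightarrow> astate \<Rightarrow> int \<Rightarrow> bool" where
    "I = (\<lambda>n a' t'. n \<le> L \<and> rg a' 5 - rg a' 4 < 2 ^ n \<and> fl a FIRST i \<le> rg a' 4 \<and>
      rg a' 4 \<le> rg a' 5 \<and> rg a' 5 \<le> fl a LAST i \<and>
      (\<forall>x. fl a FIRST i \<le> x \<longrightarrow> x < rg a' 4 \<longrightarrow> fl a SYM (fl a SLOT x) < rg a 3) \<and>
      (\<forall>x. rg a' 5 \<le> x \<longrightarrow> x < fl a LAST i \<longrightarrow> rg a 3 \<le> fl a SYM (fl a SLOT x)) \<and>
      (\<forall>x. x \<noteq> 4 \<longrightarrow> x \<noteq> 5 \<longrightarrow> x \<noteq> 7 \<longrightarrow> rg a' x = rg a x) \<and>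
      lo a' = lo a \<and> fl a' = fl a \<and> en a' = en a \<and> t' \<le> t + 50 * (int L - int n))"
  have "I L a t" unfolding I_def using a size fl_i by auto
  then show ?thesis
  proof (rule wp_while[where I = I])
    fix n :: nat and a' :: astate and t' :: int
    let ?l = "rg a' 4" and ?r = "rg a' 5"
    assume I: "I n a' t'"
    show "okb a' (LtE (Var 4) (Var 5))" by simp
    {
      assume "\<not> evb a' (LtE (Var 4) (Var 5))"
      then show "Q a' (t' + (1 + costb (LtE (Var 4) (Var 5))))"
        using I by (intro Q) (auto simp: I_def)
    next
      assume "evb a' (LtE (Var 4) (Var 5))"
      then have lr: "?l < ?r" by simp
      define mid where "mid = (?l + ?r) div 2"
      have mid: "?l \<le> mid" "mid < ?r" using lr by (auto simp: mid_def)
      obtain k where k: "n = Suc k" using I lr by (cases n) (auto simp: I_def)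
      have half: "mid - ?l < 2 ^ k" "?r - (mid + 1) < 2 ^ k"
        using I lr unfolding I_def k mid_def by auto
      have b: "fl a FIRST i \<le> mid" "mid < fl a LAST i" using I mid by (auto simp: I_def)
      have words: "?l + ?r \<in> words w" "2 \<in> words w" "1 \<in> words w" "mid \<in> words w" "mid + 1 \<in> words w"
        using I mid N fl_i B_bounds d_m by (auto simp: I_def intro!: small)
      have ok: "0 \<le> mid" "mid \<le> M" "0 \<le> fl a SLOT mid" "fl a SLOT mid \<le> M"
        using slot[OF b] b N fl_i B_bounds d_m by auto
      have below: "fl a SYM (fl a SLOT x) < rg a 3"
        if "fl a SYM (fl a SLOT mid) < rg a 3" "fl a FIRST i \<le> x" "x < mid + 1" for x
        using mono[of x mid] that b by auto
      have above: "rg a 3 \<le> fl a SYM (fl a SLOT x)"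
        if "\<not> fl a SYM (fl a SLOT mid) < rg a 3" "mid \<le> x" "x < fl a LAST i" for x
        using mono[of mid x] that b by auto
      have reach: "\<exists>n'<n. I n' c x"
        if "fl a SYM (fl a SLOT mid) < rg a 3 \<and> rg c 4 = mid + 1 \<and> rg c 5 = ?r \<or>
            \<not> fl a SYM (fl a SLOT mid) < rg a 3 \<and> rg c 4 = ?l \<and> rg c 5 = mid"
          "\<And>x. x \<noteq> 4 \<Longrightarrow> x \<noteq> 5 \<Longrightarrow> x \<noteq> 7 \<Longrightarrow> rg c x = rg a' x"
          "lo c = lo a'" "fl c = fl a'" "en c = en a'" "x \<le> t' + 50" for c x
      proof -
        have "I k c x"
          using that(1)
        proof (elim disjE conjE)
          assume 1: "fl a SYM (fl a SLOT mid) < rg a 3" "rg c 4 = mid + 1" "rg c 5 = ?r"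
          show ?thesis using I that(2-) 1 half mid below[OF 1(1)] unfolding I_def k by auto
        next
          assume 2: "\<not> fl a SYM (fl a SLOT mid) < rg a 3" "rg c 4 = ?l" "rg c 5 = mid"
          show ?thesis using I that(2-) 2 half mid above[OF 2(1)] unfolding I_def k by auto
        qed
        then show ?thesis using k by blast
      qed
      have I': "fl a' = fl a" "rg a' 9 = B" "rg a' 3 = rg a 3" using I a by (auto simp: I_def)
      show "wp search_body (\<lambda>a' t'. \<exists>n'<n. I n' a' t') a' (t' + (1 + costb (LtE (Var 4) (Var 5))))"
        by (intro vc_sound)
          (use words ok I' mid_def[symmetric] in \<open>simp add: search_body_def reach\<close>)
    }
  qed
qed

lemma search_spec:
  assumes tr: "trie N ns (fl a)" and sl: "slots N (fl a)" and i: "0 \<le> rg a 0" "rg a 0 < N"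
    and a: "rg a 9 = B" "lo a = lo1" "rg a 1 \<in> words w"
    and size: "int (max_out_degree f D) < 2 ^ L"
    and Q: "\<And>a' t'. is_goto N ns (ns (rg a 0)) (rg a 1) (rg a' 0) \<Longrightarrow>
      (\<And>x. 8 \<le> x \<Longrightarrow> rg a' x = rg a x) \<Longrightarrow>
      lo a' = lo a \<Longrightarrow> fl a' = fl a \<Longrightarrow> en a' = en a \<Longrightarrow> t' \<le> t + 200 + 50 * int L \<Longrightarrow> Q a' t'"
  shows "vc search_prog Q a t"
proof -
  let ?i = "rg a 0" and ?c = "rg a 1"
  note fl_i = trieD(4)[OF tr i]
  have N: "N \<le> m + 1" by (rule tree_bound[OF trieD(1)[OF tr]])
  have slot: "fl a SLOT x \<in> children N (fl a) ?i" if "fl a FIRST ?i \<le> x" "x < fl a LAST ?i" for x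
    using sl that i unfolding slots_def by blast
  have bk: "bkt ?c \<in> words w" "bkt ?c < B"
    using bkt_word[OF a(3)] bkt_neg[of ?c] B_bounds by auto
  have neg1: "-1 \<in> words w" "0 \<in> words w" using B_bounds d_m by (auto intro!: small)
  have ok: "?i \<le> M" using i N B_bounds d_m by simp
  show ?thesis
  proof (cases "lo1 (bkt ?c) = 0")
    case True
    then have "ns ?i @ [?c] \<notin> Pref f D" using child_exists[OF tr i] by blast
    then have "is_goto N ns (ns ?i) ?c (-1)" by (simp add: is_goto_def)
    then show ?thesis
      unfolding search_prog_def vc.simps(7)
      by (intro vc_locate) (use True a neg1 bk in \<open>simp_all add: Q\<close>)
  next
    case False
    have code: "lo1 (bkt ?c) + rsd ?c = cd ?c" by (simp add: code_def)
    have cw: "cd ?c \<in> words w"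
      using code_bounds[OF table(1) False] table(3) B_bounds d_m by (intro small) auto
    have size': "fl a LAST ?i - fl a FIRST ?i < 2 ^ L" by (rule order.strict_trans1[OF children_card[OF tr i] size])
    have res: "is_goto N ns (ns ?i) ?c (if l < fl a LAST ?i \<and> fl a SYM (fl a SLOT l) = cd ?c then fl a SLOT l else -1)"
      if l: "fl a FIRST ?i \<le> l" "l \<le> fl a LAST ?i"
        "\<And>x. fl a FIRST ?i \<le> x \<Longrightarrow> x < l \<Longrightarrow> fl a SYM (fl a SLOT x) < cd ?c"
        "\<And>x. l \<le> x \<Longrightarrow> x < fl a LAST ?i \<Longrightarrow> cd ?c \<le> fl a SYM (fl a SLOT x)" for l
    proof (cases "l < fl a LAST ?i \<and> fl a SYM (fl a SLOT l) = cd ?c")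
      case True
      then have ch: "fl a SLOT l \<in> children N (fl a) ?i" using slot l by blast
      have "ns (fl a SLOT l) = ns ?i @ [?c]"
        by (rule child_unique[OF tr i ch False]) (use True in simp)
      moreover have bounds: "1 \<le> fl a SLOT l" "fl a SLOT l < N" using ch by (auto simp: children_def)
      moreover have "ns (fl a SLOT l) \<in> Pref f D"
        using tree_Pref[OF trieD(1)[OF tr], of "fl a SLOT l"] bounds by simp
      ultimately show ?thesis using True by (simp add: is_goto_def)
    next
      case no: False
      have "ns ?i @ [?c] \<notin> Pref f D"
      proof
        assume "ns ?i @ [?c] \<in> Pref f D"
        then obtain u where u: "u \<in> children N (fl a) ?i" "fl a SYM u = cd ?c"
          using child_exists[OF tr i] by blast
        then obtain x where x: "fl a FIRST ?i \<le> x" "x < fl a LAST ?i" "fl a SLOT x = u"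
          using sl i unfolding slots_def by blast
        then have "l \<le> x" using l(3)[of x] u by force
        moreover have "x \<le> l"
        proof (rule ccontr)
          assume "\<not> x \<le> l"
          then have "fl a SYM (fl a SLOT l) < fl a SYM (fl a SLOT x)"
            using sl i x l unfolding slots_def by auto
          then show False using l(4)[of l] x u \<open>\<not> x \<le> l\<close> by auto
        qed
        ultimately show False using no x u by auto
      qed
      then show ?thesis using no by (auto simp: is_goto_def)
    qed
    have post: "Q b x"
      if "rg b 0 = (if rg e 4 < fl a LAST ?i \<and> fl a SYM (fl a SLOT (rg e 4)) = cd ?c
          then fl a SLOT (rg e 4) else -1)"
        "fl a FIRST ?i \<le> rg e 4" "rg e 4 \<le> fl a LAST ?i"
        "\<And>y. fl a FIRST ?i \<le> y \<Longrightarrow> y < rg e 4 \<Longrightarrow> fl a SYM (fl a SLOT y) < cd ?c"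
        "\<And>y. rg e 4 \<le> y \<Longrightarrow> y < fl a LAST ?i \<Longrightarrow> cd ?c \<le> fl a SYM (fl a SLOT y)"
        "\<And>y. 8 \<le> y \<Longrightarrow> rg b y = rg a y" "lo b = lo a" "fl b = fl a" "en b = en a"
        "x \<le> t + 200 + 50 * int L" for b x and e :: astate
      using that res[OF that(2-5)] by (intro Q) simp_all
    have okl: "0 \<le> l" "l \<le> M" "l < fl a LAST ?i \<Longrightarrow> 0 \<le> fl a SLOT l \<and> fl a SLOT l \<le> M"
      if "fl a FIRST ?i \<le> l" "l \<le> fl a LAST ?i" for l
      using that slot[of l] fl_i N B_bounds d_m by (auto simp: children_def)
    show ?thesis
      unfolding search_prog_def vc.simps(7)
      apply (intro vc_locate)
      using a apply simp
      using a False neg1 bk ok cw code i apply simp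
      apply (rule search_loop[where N = N and ns = ns and i = ?i and L = L])
      using tr sl i size' a apply simp_all
      subgoal for b s using okl[of "rg b 4"] neg1 by (auto intro!: post[of _ b])
      done
  qed
qed

end

section \<open>Computing failure links and outputs\<close>

text \<open>Register 21 holds the node of \<open>f (P[l:j-1])\<close>, whose depth is
  \<open>j - l\<close>; thus \<open>l\<close> is recovered by subtracting that depth from
  \<open>j\<close> in register 19. The value -1 in register 21 means a chain that is exhausted or a
  hit stored in register 22.\<close>

definition fail_inner :: cmd where
  "fail_inner =
    Ree 1 (Var 18 .- Num 1) (Var 19 .- Fld DEP (Var 21)) (Var 19) ;;
    0 ::= Var 21 ;; search_prog ;;
    Ite (EqE (Var 0) (Num (-1))) (21 ::= Fld FAIL (Var 21)) (22 ::= Var 0 ;; 21 ::= Num (-1))"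

text \<open>Pattern \<open>k\<close> owns a single list cell, formed by the adjacent addresses of
  \<open>CK\<close> and \<open>CN\<close>. It stores \<open>k - 1\<close>, the index into
  \<open>D\<close>. The cells are pushed in front of the list of the failure link, which remains
  shared.\<close>

definition out_inner :: cmd where
  "out_inner =
    SetF CK (Var 17) (Var 17 .- Num 1) ;; SetF CN (Var 17) (Fld OUT (Var 16)) ;;
    SetF OUT (Var 16) (Var 9 .+ (Op Mul (Num 32) (Var 17) .+ Num 17)) ;;
    17 ::= Fld NEXTE (Var 17)"

definition fail_outer :: cmd where
  "fail_outer =
    21 ::= Fld FAIL (Fld PAR (Var 16)) ;; 22 ::= Num 0 ;;
    18 ::= Fld REP (Var 16) ;; 19 ::= Fld DEP (Var 16) ;;
    Wh (NotE (EqE (Var 21) (Num (-1)))) fail_inner ;;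
    SetF FAIL (Var 16) (Var 22) ;; SetF OUT (Var 16) (Fld OUT (Var 22)) ;;
    17 ::= Fld ENDS (Var 16) ;;
    Wh (NotE (EqE (Var 17) (Num 0))) out_inner ;;
    16 ::= Var 16 .+ Num 1"

definition fail_prog :: cmd where
  "fail_prog =
    SetF FAIL (Num 0) (Num (-1)) ;; SetF OUT (Num 0) (Num (-1)) ;; 16 ::= Num 1 ;;
    Wh (LtE (Var 16) (Var 15)) fail_outer ;; 0 ::= Num 0"

context loaded
begin

definition "is_ref N ns T x \<longleftrightarrow> (case T of None \<Rightarrow> x = -1 | Some S \<Rightarrow> 0 \<le> x \<and> x < N \<and> ns x = S)"
  for N x :: int and ns :: "int \<Rightarrow> int list"

definition "fails N ns v h \<longleftrightarrow> (\<forall>i. 0 \<le> i \<longrightarrow> i < v \<longrightarrow> is_ref N ns (Fail f D (ns i)) (h FAIL i))"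
  for h :: "nat \<Rightarrow> int \<Rightarrow> int"

text \<open>Parents are monotone, so the claim passes from parents to children. It yields that
  strictly shorter states have smaller numbers, the reason why links of candidates are available
  when needed.\<close>

lemma dep_mono:
  assumes tree: "tree N ns h" and "0 \<le> i" "i \<le> i'" "i' < N"
  shows "length (ns i) \<le> length (ns i')"
  using assms(2-)
proof (induction "nat i'" arbitrary: i i' rule: less_induct)
  case less
  show ?case
  proof (cases "i = 0 \<or> i = i'")
    case True
    then show ?thesis using treeD(2)[OF tree] by auto
  next
    case False
    then have b: "1 \<le> i" "i < i'" "1 \<le> i'" "i < N" using less.prems by auto
    note t = treeD(6)[OF tree b(1,4)] treeD(6)[OF tree b(3) less.prems(3)]
    have "h PAR i \<le> h PAR i'" by (rule treeD(7)[OF tree b(1,2) less.prems(3)])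
    then have "length (ns (h PAR i)) \<le> length (ns (h PAR i'))"
      using t less.prems by (intro less.hyps) auto
    then have "length (butlast (ns i)) \<le> length (butlast (ns i'))" using t by metis
    then show ?thesis using t by (cases "ns i" rule: rev_cases; cases "ns i'" rule: rev_cases) auto
  qed
qed

lemma frame:
  assumes "\<And>j. j < 15 \<Longrightarrow> h' j = h j"
  shows "trie N ns h' = trie N ns h" "slots N h' = slots N h"
proof -
  have eq: "h' PAR = h PAR" "h' SYM = h SYM" "h' REP = h REP" "h' DEP = h DEP" "h' NXS = h NXS"
    "h' LC = h LC" "h' FIRST = h FIRST" "h' LAST = h LAST" "h' ENDS = h ENDS" "h' NEXTE = h NEXTE"
    "h' SLOT = h SLOT"
    by (rule assms; simp)+
  show "trie N ns h' = trie N ns h" unfolding trie_def tree_def sym_chains_def eq ..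
  show "slots N h' = slots N h" unfolding slots_def children_def eq ..
qed

definition "Rm = int (R (max_length D))"

lemma length_le_max: "P \<in> set D \<Longrightarrow> length P \<le> max_length D"
  by (simp add: max_length_def)

text \<open>\<open>K\<close> bounds one trial: a re-encoding, a binary search and constant overhead.
  Each rejection moves the start position forward by at least one, so the trials are paid for by the
  drop from the link length of the parent.\<close>

lemma fail_inner_spec:
  assumes tr: "trie N ns (fl a)" and sl: "slots N (fl a)" and v: "1 \<le> v" "v < N"
    and fa: "fails N ns v (fl a)"
    and a: "rg a 9 = B" "lo a = lo1" "en a = D" "rg a 16 = v" "rg a 15 = N"
      "rg a 18 = fl a REP v" "rg a 19 = fl a DEP v" "rg a 21 = fl a FAIL (fl a PAR v)" "rg a 22 = 0"
    and size: "int (max_out_degree f D) < 2 ^ L"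
    and K: "K = 500 + Rm + 50 * int L"
    and Q: "\<And>a' t'. is_ref N ns (Fail f D (ns v)) (rg a' 22) \<Longrightarrow>
      rg a' 9 = B \<Longrightarrow> rg a' 15 = N \<Longrightarrow> rg a' 16 = v \<Longrightarrow>
      lo a' = lo1 \<Longrightarrow> fl a' = fl a \<Longrightarrow> en a' = D \<Longrightarrow>
      t' \<le> t + 10 + K * (fail_len (butlast (ns v)) + 2 - fail_len (ns v)) \<Longrightarrow> Q a' t'"
  shows "wp (Wh (NotE (EqE (Var 21) (Num (-1)))) fail_inner) Q a t"
proof -
  note tree = trieD(1)[OF tr]
  note tv = treeD(6)[OF tree v]
  have N: "N \<le> m + 1" by (rule tree_bound[OF tree])
  define k P j where "k = fl a REP v" and "P = pat k" and "j = length (ns v)"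
  have k: "1 \<le> k" "k \<le> d" "prefix (ns v) (f P)" using tv by (auto simp: k_def P_def F_def)
  have P: "P \<in> set D" using pat_in k by (simp add: P_def)
  have jP: "1 \<le> j" "j \<le> length P"
    using tv prefix_length_le[OF k(3)] length_f[OF pattern(1)[OF P]] by (auto simp: j_def Suc_le_eq)
  have Sv: "ns v = take j (f P)" using k(3) by (auto simp: j_def prefix_def)
  have Sp: "butlast (ns v) = take (j - 1) (f P)"
    using Sv jP length_f[OF pattern(1)[OF P]] by (simp add: butlast_take)
  have K0: "0 \<le> K" by (simp add: K Rm_def)
  define A where "A = fail_len (take (j - 1) (f P))"
  \<comment> \<open>While the search is running, \<open>A - (j - l)\<close> bounds the rejected
    candidates; the first disjunct, with register 21 equal to -1, describes the state after the
    decision.\<close>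
  define I :: "nat \<Rightarrow> astate \<Rightarrow> int \<Rightarrow> bool" where
    "I = (\<lambda>n a' t'. rg a' 9 = B \<and> rg a' 15 = N \<and> rg a' 16 = v \<and> rg a' 18 = k \<and> rg a' 19 = int j \<and>
      lo a' = lo1 \<and> fl a' = fl a \<and> en a' = D \<and>
      (rg a' 21 = -1 \<and> n = 0 \<and> is_ref N ns (Fail f D (ns v)) (rg a' 22) \<and>
         t' \<le> t + K * (A + 2 - fail_len (ns v)) \<or>
       (\<exists>l. 0 \<le> rg a' 21 \<and> rg a' 21 < N \<and> rg a' 22 = 0 \<and> n = Suc (j - l) \<and> candidate P j l \<and>
         ns (rg a' 21) = f (substr P l (j - 1)) \<and> t' \<le> t + K * (A - (int j - int l)))))"
  have "\<exists>n. I n a t"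
  proof (cases "2 \<le> j")
    case True
    obtain l where l: "candidate P j l" "Fail f D (take (j - 1) (f P)) = Some (f (substr P l (j - 1)))"
      using candidate_init[OF P True jP(2)] by blast
    have "0 \<le> fl a PAR v" "fl a PAR v < v" "ns (fl a PAR v) = butlast (ns v)" using tv by auto
    then have "is_ref N ns (Fail f D (take (j - 1) (f P))) (rg a 21)"
      using fa a(8) Sp unfolding fails_def by metis
    then have ref: "0 \<le> rg a 21" "rg a 21 < N" "ns (rg a 21) = f (substr P l (j - 1))"
      unfolding l(2) is_ref_def by simp_all
    have "A = int j - int l"
      using length_candidate(1)[OF l(1)] l by (simp add: A_def fail_len_def candidate_def of_nat_diff)
    then have "I (Suc (j - l)) a t"
      unfolding I_def using a l ref tv by (auto simp: k_def j_def)
    then show ?thesis by blast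
  next
    case False
    \<comment> \<open>At depth 1 the parent is the root, whose link is -1: the loop is not entered,
      and the preset value 0 of register 22 is the correct link.\<close>
    then have j: "j = 1" using jP by simp
    then have "butlast (ns v) = []" using Sp by simp
    then have "fl a PAR v = 0"
      using tree_eq[OF tree, of "fl a PAR v" 0] tv treeD(1,2)[OF tree] v by auto
    then have "rg a 21 = -1"
      using fa v a(8) treeD(2)[OF tree] unfolding fails_def is_ref_def by force
    moreover have "Fail f D (ns v) = Some []" using Fail_first[OF P] Sv j by simp
    moreover from this have "fail_len (ns v) = 0" by (simp add: fail_len_def)
    moreover have "A = 0" by (simp add: A_def j fail_len_def)
    ultimately have "I 0 a t"
      unfolding I_def using a treeD(1,2)[OF tree] K0 tv by (simp add: is_ref_def k_def j_def)
    then show ?thesis by blast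
  qed
  then obtain n where "I n a t" by blast
  then show ?thesis
  proof (rule wp_while[where I = I])
    fix n :: nat and a' :: astate and t' :: int
    let ?u = "rg a' 21"
    assume I: "I n a' t'"
    show "okb a' (NotE (EqE (Var 21) (Num (-1))))" using B_bounds d_m by (auto intro!: small)
    have I': "rg a' 9 = B" "rg a' 15 = N" "rg a' 16 = v" "rg a' 18 = k" "rg a' 19 = int j"
      "lo a' = lo1" "fl a' = fl a" "en a' = D"
      using I by (auto simp: I_def)
    {
      assume "\<not> evb a' (NotE (EqE (Var 21) (Num (-1))))"
      then show "Q a' (t' + (1 + costb (NotE (EqE (Var 21) (Num (-1))))))"
        using I by (intro Q) (auto simp: I_def A_def Sp)
    next
      assume "evb a' (NotE (EqE (Var 21) (Num (-1))))"
      then obtain l where u: "0 \<le> ?u" "?u < N" "rg a' 22 = 0" "n = Suc (j - l)" and c: "candidate P j l"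
        and S: "ns ?u = f (substr P l (j - 1))" and t': "t' \<le> t + K * (A - (int j - int l))"
        using I unfolding I_def by auto
      have l: "2 \<le> l" "l \<le> j" using c by (auto simp: candidate_def)
      have dep: "fl a DEP ?u = int j - int l"
        using tree_dep[OF tree u(1,2)] length_candidate(1)[OF c] l by (simp add: S of_nat_diff)
      define x where "x = last (f (substr P l j))"
      have snoc: "f (substr P l j) = ns ?u @ [x]"
        using f_substr_snoc[OF P _ l(2) jP(2)] l by (simp add: S x_def)
      have xw: "x \<in> words w"
        using symbol_words[OF P _ l(2) jP(2)] l snoc by auto
      have "length (ns ?u) < length (ns v)"
        using length_candidate(1)[OF c] l by (simp add: S j_def[symmetric])
      then have uv: "?u < v" using dep_mono[OF tree, of v ?u] u v by force
      have "is_ref N ns (Fail f D (ns ?u)) (fl a FAIL ?u)" using fa uv u unfolding fails_def by blast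
      note ref_u = this
      have t1: "t' + K \<le> t + K * (A - (int j - int l) + 1)" using t' by (simp add: algebra_simps)
      have reach: "\<exists>n'<n. I n' b s"
        if g: "is_goto N ns (ns ?u) x g"
          "if g = -1 then rg b 21 = fl a FAIL ?u \<and> rg b 22 = 0 else rg b 21 = -1 \<and> rg b 22 = g"
          and b: "\<And>y. 9 \<le> y \<Longrightarrow> y \<noteq> 21 \<Longrightarrow> y \<noteq> 22 \<Longrightarrow> rg b y = rg a' y" "lo b = lo1" "fl b = fl a" "en b = D"
            "s \<le> t' + K" for b s g
      proof (cases "f (substr P l j) \<in> Pref f D")
        case True
        then have g1: "0 \<le> g" "g < N" "ns g = f (substr P l j)"
          using g(1) snoc by (auto simp: is_goto_def)
        have F: "Fail f D (ns v) = Some (f (substr P l j))"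
          using candidate_hit[OF c True] Sv by simp
        then have "fail_len (ns v) = int j + 1 - int l"
          using length_candidate(2)[OF c] l by (simp add: fail_len_def of_nat_diff)
        then have "A - (int j - int l) + 1 = A + 2 - fail_len (ns v)" by simp
        with t1 have "t' + K \<le> t + K * (A + 2 - fail_len (ns v))" by metis
        then have "I 0 b s"
          unfolding I_def using g1 g(2) F b I' by (simp add: is_ref_def)
        then show ?thesis using u(4) by blast
      next
        case miss: False
        then have g1: "g = -1" using g(1) snoc by (auto simp: is_goto_def)
        show ?thesis
        proof (cases "l < j")
          case True
          obtain l' where l': "l < l'" "candidate P j l'"
            "Fail f D (f (substr P l (j - 1))) = Some (f (substr P l' (j - 1)))"
            using candidate_miss[OF c True miss] by blast
          have "K * (A - (int j - int l) + 1) \<le> K * (A - (int j - int l'))"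
            using K0 l'(1) by (intro mult_left_mono) auto
          moreover have "0 \<le> fl a FAIL ?u" "fl a FAIL ?u < N" "ns (fl a FAIL ?u) = f (substr P l' (j - 1))"
            using ref_u l'(3) by (auto simp: is_ref_def S)
          ultimately have "I (Suc (j - l')) b s"
            unfolding I_def using g(2) g1 b I' t1 l'(2) by (intro conjI disjI2 exI[of _ l']) auto
          moreover have "Suc (j - l') < n" using u(4) l'(1) True l'(2) by (auto simp: candidate_def)
          ultimately show ?thesis by blast
        next
          case False
          then have lj: "l = j" using l by simp
          have "ns ?u = []" using length_candidate(1)[OF c] by (simp add: S lj)
          then have "fl a FAIL ?u = -1" using ref_u by (simp add: is_ref_def)
          moreover have F: "Fail f D (ns v) = Some []"
            using candidate_end c miss Sv by (simp add: lj)
          moreover have "fail_len (ns v) = 0" using F by (simp add: fail_len_def)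
          moreover have "K * (A + 1) \<le> K * (A + 2)" using K0 by (intro mult_left_mono) auto
          ultimately have "I 0 b s"
            unfolding I_def using g(2) g1 b I' t1 lj treeD(1,2)[OF tree] by (auto simp: is_ref_def)
          then show ?thesis using u(4) by blast
        qed
      qed
      have Rle: "int (R (Suc j - l)) \<le> Rm"
        using R_mono[of "Suc j - l"] l jP length_le_max[OF P] by (simp add: Rm_def)
      have enk: "D ! nat (k - 1) = P" by (simp add: P_def pat_def)
      have words: "1 \<in> words w" "-1 \<in> words w" "k - 1 \<in> words w" "int l \<in> words w"
        using k l jP length_le_max[OF P] B_bounds d_m pos_plen[OF k(1,2)] pos_bounds[of k]
        by (auto intro!: small simp: plen_def P_def)
      have ok: "?u \<le> M" using u N B_bounds d_m by simp
      have nat_diff: "nat (int j - int l + 1) = Suc j - l" using l by simp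
      show "wp fail_inner (\<lambda>a' t'. \<exists>n'<n. I n' a' t') a' (t' + (1 + costb (NotE (EqE (Var 21) (Num (-1))))))"
        apply (rule vc_sound)
        using I' k u words ok dep l jP enk xw
        apply (simp add: fail_inner_def Let_def x_def[symmetric] d_def[symmetric] nat_diff)
        apply (rule search_spec[where N = N and ns = ns and L = L])
        using tr sl size apply simp_all
        subgoal for e s
          apply (insert Rle K)
          apply (intro conjI impI)
           apply (rule reach[unfolded u(4), of "rg e 0"], simp_all add: I')
          apply (rule reach[unfolded u(4), of "rg e 0"], simp_all add: I')
          done
        done
    }
  qed
qed


section \<open>Output lists with shared tails\<close>

primrec out_list :: "(nat \<Rightarrow> int \<Rightarrow> int) \<Rightarrow> int \<Rightarrow> int list \<Rightarrow> bool" where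
  "out_list h p [] \<longleftrightarrow> p = -1"
| "out_list h p (k # ks) \<longleftrightarrow> p = B + (32 * k + 17) \<and> 1 \<le> k \<and> k \<le> d \<and> h CK k = k - 1 \<and>
     out_list h (h CN k) ks"

lemma out_list_cong:
  "(\<And>k. k \<in> set ks \<Longrightarrow> h' CK k = h CK k \<and> h' CN k = h CN k) \<Longrightarrow> out_list h' p ks = out_list h p ks"
  by (induction ks arbitrary: p) auto

definition "oset S = {k. 1 \<le> k \<and> k \<le> d \<and> pat k \<in> Out r f D S}"

definition "written ns v = (\<Union>i\<in>{0..<v}. ends (ns i))" for ns :: "int \<Rightarrow> int list" and v :: int

text \<open>Confining the list to \<open>written\<close> protects it: patterns ending in node
  \<open>v\<close> or later own other cells, so later pushes do not alter it.\<close>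

definition "has_out ns v h p A \<longleftrightarrow>
  (\<exists>ks. out_list h p ks \<and> distinct ks \<and> set ks = A \<and> A \<subseteq> written ns v)"

definition "outs N ns v h \<longleftrightarrow> (\<forall>i. 0 \<le> i \<longrightarrow> i < v \<longrightarrow> has_out ns v h (h OUT i) (oset (ns i)))"
  for N v :: int and h :: "nat \<Rightarrow> int \<Rightarrow> int"

lemma has_out_cong:
  assumes "has_out ns v h p A"
    "\<And>k. k \<in> written ns v \<Longrightarrow> h' CK k = h CK k \<and> h' CN k = h CN k" "v \<le> v'"
  shows "has_out ns v' h' p A"
proof -
  obtain ks where ks: "out_list h p ks" "distinct ks" "set ks = A" "A \<subseteq> written ns v"
    using assms(1) unfolding has_out_def by blast
  have "out_list h' p ks" using out_list_cong[of ks h' h p] ks assms(2) by blast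
  moreover have "written ns v \<subseteq> written ns v'"
    unfolding written_def by (rule UN_mono) (use assms(3) in auto)
  ultimately show ?thesis unfolding has_out_def using ks by blast
qed

lemma ends_fresh:
  assumes "tree N ns h" "0 \<le> v" "v < N" "k \<in> ends (ns v)"
  shows "k \<notin> written ns v"
proof
  assume "k \<in> written ns v"
  then obtain i where i: "0 \<le> i" "i < v" "k \<in> ends (ns i)" by (auto simp: written_def)
  then have "ns i = ns v" using assms(4) by (simp add: ends_def)
  then show False using tree_eq[OF assms(1), of i v] i assms by auto
qed

lemma written_step: "0 \<le> v \<Longrightarrow> written ns (v + 1) = written ns v \<union> ends (ns v)"
proof -
  assume "0 \<le> v"
  then have "{0..<v + 1} = insert v {0..<v}" by auto
  then show ?thesis by (auto simp: written_def)
qed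

lemma finite_ends: "finite (ends S)" and finite_written: "finite (written ns v)"
proof -
  show "finite (ends S)" for S by (rule finite_subset[of _ "{1..d}"]) (auto simp: ends_def)
  then show "finite (written ns v)" by (auto simp: written_def)
qed

lemma card_written: "int (card (written ns v)) \<le> d"
proof -
  have "card (written ns v) \<le> card {1..d}"
    by (rule card_mono) (auto simp: written_def ends_def)
  then show ?thesis using d_m by simp
qed

lemma oset_step:
  assumes "S \<in> Pref f D" "S \<noteq> []" "Fail f D S = Some T"
  shows "oset S = ends S \<union> oset T"
  using Out_step[OF assms] pat_in by (auto simp: oset_def ends_def F_def)

lemma out_inner_spec:
  assumes tr: "trie N ns (fl a)" and v: "1 \<le> v" "v < N"
    and u: "0 \<le> u" "u < v" "Fail f D (ns v) = Some (ns u)"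
    and ou: "outs N ns v (fl a)" and hv: "fl a OUT v = fl a OUT u"
    and a: "rg a 9 = B" "lo a = lo1" "en a = D" "rg a 16 = v" "rg a 15 = N" "rg a 17 = fl a ENDS v"
    and Q: "\<And>a' t'. outs N ns (v + 1) (fl a') \<Longrightarrow>
      rg a' 9 = B \<Longrightarrow> rg a' 15 = N \<Longrightarrow> rg a' 16 = v \<Longrightarrow> lo a' = lo1 \<Longrightarrow> en a' = D \<Longrightarrow>
      (\<And>j. j < OUT \<Longrightarrow> fl a' j = fl a j) \<Longrightarrow>
      t' \<le> t + 10 + 200 * int (card (ends (ns v))) \<Longrightarrow> Q a' t'"
  shows "wp (Wh (NotE (EqE (Var 17) (Num 0))) out_inner) Q a t"
proof -
  note tree = trieD(1)[OF tr]
  have v0: "0 \<le> v" using v by simp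
  \<comment> \<open>The content of the list of \<open>v\<close> while \<open>A\<close> is still to
    be pushed: the own patterns pushed so far and the outputs inherited from the failure
    link.\<close>
  define W where "W A = (ends (ns v) - A) \<union> oset (ns u)" for A
  define I :: "nat \<Rightarrow> astate \<Rightarrow> int \<Rightarrow> bool" where
    "I = (\<lambda>n a' t'. \<exists>A. n = card A \<and> A \<subseteq> ends (ns v) \<and> chset (fl a NEXTE) (rg a' 17) A \<and>
      rg a' 9 = B \<and> rg a' 15 = N \<and> rg a' 16 = v \<and> lo a' = lo1 \<and> en a' = D \<and>
      (\<forall>j < OUT. fl a' j = fl a j) \<and> (\<forall>i. i \<noteq> v \<longrightarrow> fl a' OUT i = fl a OUT i) \<and>
      (\<forall>k \<in> written ns v. fl a' CK k = fl a CK k \<and> fl a' CN k = fl a CN k) \<and>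
      has_out ns (v + 1) (fl a') (fl a' OUT v) (W A) \<and>
      t' \<le> t + 200 * (int (card (ends (ns v))) - int (card A)))"
  have hu: "has_out ns v (fl a) (fl a OUT u) (oset (ns u))"
    using ou u unfolding outs_def by blast
  have "I (card (ends (ns v))) a t"
    unfolding I_def using a trieD(6)[OF tr v0 v(2)] has_out_cong[OF hu, of "fl a" "v + 1"] hv
    by (auto simp: W_def)
  then show ?thesis
  proof (rule wp_while[where I = I])
    fix n :: nat and a' :: astate and t' :: int
    let ?k = "rg a' 17"
    assume "I n a' t'"
    then obtain A where n: "n = card A" and A: "A \<subseteq> ends (ns v)" "chset (fl a NEXTE) ?k A"
      and a': "rg a' 9 = B" "rg a' 15 = N" "rg a' 16 = v" "lo a' = lo1" "en a' = D"
        "\<And>j. j < OUT \<Longrightarrow> fl a' j = fl a j" "\<And>i. i \<noteq> v \<Longrightarrow> fl a' OUT i = fl a OUT i"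
        "\<And>k. k \<in> written ns v \<Longrightarrow> fl a' CK k = fl a CK k \<and> fl a' CN k = fl a CN k"
      and ho: "has_out ns (v + 1) (fl a') (fl a' OUT v) (W A)"
      and t': "t' \<le> t + 200 * (int (card (ends (ns v))) - int (card A))"
      unfolding I_def by blast
    show "okb a' (NotE (EqE (Var 17) (Num 0)))" using B_bounds d_m by (auto intro!: small)
    {
      assume "\<not> evb a' (NotE (EqE (Var 17) (Num 0)))"
      then have "A = {}" using A(2) chset_0 by auto
      then have "has_out ns (v + 1) (fl a') (fl a' OUT v) (oset (ns v))"
        using ho oset_step[OF tree_Pref[OF tree v0 v(2)] _ u(3)] treeD(6)[OF tree v]
        by (simp add: W_def)
      moreover have "has_out ns (v + 1) (fl a') (fl a' OUT i) (oset (ns i))" if "0 \<le> i" "i < v" for i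
      proof -
        have "has_out ns v (fl a) (fl a OUT i) (oset (ns i))" using ou that unfolding outs_def by blast
        then have "has_out ns (v + 1) (fl a') (fl a OUT i) (oset (ns i))"
          by (rule has_out_cong) (use a'(8) in auto)
        then show ?thesis using a'(7)[of i] that by simp
      qed
      ultimately have "outs N ns (v + 1) (fl a')"
        unfolding outs_def by (metis zle_iff_zadd zless_add1_eq)
      then show "Q a' (t' + (1 + costb (NotE (EqE (Var 17) (Num 0)))))"
        using a' t' \<open>A = {}\<close> by (intro Q) auto
    next
      assume "evb a' (NotE (EqE (Var 17) (Num 0)))"
      then have k0: "?k \<noteq> 0" by simp
      note pop = chset_pop[OF A(2) k0]
      have kE: "?k \<in> ends (ns v)" using pop(1) A(1) by blast
      then have k: "1 \<le> ?k" "?k \<le> d" by (auto simp: ends_def)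
      have fresh: "?k \<notin> written ns v" by (rule ends_fresh[OF tree v0 v(2) kE])
      have card: "card (A - {?k}) < n" "int (card (A - {?k})) = int (card A) - 1"
        using pop(1) n chset_finite[OF A(2)] card_gt_0_iff[of A] by (auto simp: card_Diff_singleton)
      have N: "N \<le> m + 1" by (rule tree_bound[OF tree])
      have ok: "v \<le> M" "?k \<le> M" using v N k B_bounds d_m by auto
      have words: "1 \<in> words w" "32 \<in> words w" "17 \<in> words w" "?k - 1 \<in> words w" "32 * ?k \<in> words w"
          "32 * ?k + 17 \<in> words w" "B + (32 * ?k + 17) \<in> words w"
        using k B_bounds d_m by (auto intro!: small)
      have reach: "\<exists>n'<n. I n' b s"
        if b: "\<And>y. y \<noteq> 17 \<Longrightarrow> rg b y = rg a' y" "rg b 17 = fl a NEXTE ?k" "lo b = lo1" "en b = D"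
          "fl b = (fl a')(CK := (fl a' CK)(?k := ?k - 1), CN := (fl a' CN)(?k := fl a' OUT v),
            OUT := (fl a' OUT)(v := B + (32 * ?k + 17)))" "s \<le> t' + 150" for b s
      proof -
        obtain ks where ks: "out_list (fl a') (fl a' OUT v) ks" "distinct ks" "set ks = W A"
            "W A \<subseteq> written ns (v + 1)"
          using ho unfolding has_out_def by blast
        have "?k \<notin> oset (ns u)"
          using hu fresh unfolding has_out_def by blast
        then have nk: "?k \<notin> set ks" using pop(1) ks(3) by (simp add: W_def)
        have "out_list (fl b) p ks = out_list (fl a') p ks" for p
          by (rule out_list_cong) (use nk b(5) in auto)
        then have "out_list (fl b) (fl a' OUT v) ks" using ks(1) by simp
        then have "out_list (fl b) (fl b OUT v) (?k # ks)" using k b(5) by simp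
        moreover have "set (?k # ks) = W (A - {?k})" using ks(3) kE by (auto simp: W_def)
        moreover have "W (A - {?k}) \<subseteq> written ns (v + 1)"
          using ks(4) kE written_step[OF v0] by (auto simp: W_def)
        ultimately have "has_out ns (v + 1) (fl b) (fl b OUT v) (W (A - {?k}))"
          unfolding has_out_def using ks(2) nk by (intro exI[of _ "?k # ks"]) auto
        moreover have "\<forall>k \<in> written ns v. fl b CK k = fl a CK k \<and> fl b CN k = fl a CN k"
          using a'(8) fresh b(5) by auto
        moreover have "\<forall>j < OUT. fl b j = fl a j" "\<forall>i. i \<noteq> v \<longrightarrow> fl b OUT i = fl a OUT i"
          using a'(6,7) b(5) by auto
        moreover have "A - {?k} \<subseteq> ends (ns v)" using A(1) by blast
        moreover have "chset (fl a NEXTE) (rg b 17) (A - {?k})" using pop(2) b(2) by simp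
        moreover have "s \<le> t + 200 * (int (card (ends (ns v))) - int (card (A - {?k})))"
          using t' card(2) b(6) by simp
        ultimately have "I (card (A - {?k})) b s"
          unfolding I_def using b a'(1-3) by (intro exI[of _ "A - {?k}"]) simp
        then show ?thesis using card(1) by blast
      qed
      show "wp out_inner (\<lambda>a' t'. \<exists>n'<n. I n' a' t') a' (t' + (1 + costb (NotE (EqE (Var 17) (Num 0)))))"
        by (intro vc_sound) (use k ok words a' v0 in \<open>simp add: out_inner_def reach\<close>)
    }
  qed
qed

definition "del S = fail_len (butlast S) + 2 - fail_len S"

text \<open>The time splits into a constant per node, a constant per pattern for its list cell, and
  \<open>K\<close> times the potential \<open>del\<close>, whose sum over all nodes is at most
  \<open>2 * m\<close>.\<close>

lemma fail_spec:
  assumes tr: "trie N ns (fl a)" and sl: "slots N (fl a)"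
    and a: "rg a 9 = B" "lo a = lo1" "en a = D" "rg a 15 = N"
    and size: "int (max_out_degree f D) < 2 ^ L"
    and K: "K = 500 + Rm + 50 * int L"
    and Q: "\<And>a' t'. trie N ns (fl a') \<Longrightarrow> slots N (fl a') \<Longrightarrow> fails N ns N (fl a') \<Longrightarrow>
      outs N ns N (fl a') \<Longrightarrow> rg a' 0 = 0 \<Longrightarrow> lo a' = lo1 \<Longrightarrow> en a' = D \<Longrightarrow>
      t' \<le> t + 1000 * m + 2 * (K * m) \<Longrightarrow> Q a' t'"
  shows "wp fail_prog Q a t"
proof (rule vc_sound)
  note tree0 = trieD(1)[OF tr]
  have N: "1 \<le> N" "N \<le> m + 1" using tree_bound[OF tree0] treeD(1)[OF tree0] by auto
  have K0: "0 \<le> K" by (simp add: K Rm_def)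
  define I :: "nat \<Rightarrow> astate \<Rightarrow> int \<Rightarrow> bool" where
    "I = (\<lambda>n a' t'. n = nat (N - rg a' 16) \<and> 1 \<le> rg a' 16 \<and> rg a' 16 \<le> N \<and>
      trie N ns (fl a') \<and> slots N (fl a') \<and> fails N ns (rg a' 16) (fl a') \<and>
      outs N ns (rg a' 16) (fl a') \<and> rg a' 9 = B \<and> rg a' 15 = N \<and> lo a' = lo1 \<and> en a' = D \<and>
      t' \<le> t + 50 + 200 * rg a' 16 + 200 * int (card (written ns (rg a' 16))) +
        K * (\<Sum>i\<in>{1..<rg a' 16}. del (ns i)))"
  have "wp (Wh (LtE (Var 16) (Var 15)) fail_outer) (vc (0 ::= Num 0) Q) a' t'"
    if "I (nat (N - 1)) a' t'" for a' t'
    using that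
  proof (rule wp_while[where I = I])
    fix n :: nat and a' :: astate and t' :: int
    let ?v = "rg a' 16"
    assume I: "I n a' t'"
    show "okb a' (LtE (Var 16) (Var 15))" by simp
    have tr': "trie N ns (fl a')" and sl': "slots N (fl a')" using I by (auto simp: I_def)
    note tree = trieD(1)[OF tr']
    {
      assume "\<not> evb a' (LtE (Var 16) (Var 15))"
      then have v: "?v = N" using I by (auto simp: I_def)
      have inj: "inj_on ns {1..<N}" by (rule inj_on_subset[OF treeD(5)[OF tree]]) auto
      \<comment> \<open>The nodes from 1 on enumerate the nonempty states without repetition, so the
        sum over nodes is the one bounded by \<open>sum_fail_len\<close>.\<close>
      have "Pref f D - {[]} = ns ` {1..<N}"
      proof -
        have "{0..<N} = insert 0 {1..<N}" using N by auto
        moreover have "ns u \<noteq> []" if "u \<in> {1..<N}" for u using treeD(6)[OF tree, of u] that by auto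
        ultimately show ?thesis using trieD(3)[OF tr'] treeD(2)[OF tree] by (auto simp: image_iff)
      qed
      then have "(\<Sum>i\<in>{1..<N}. del (ns i)) \<le> 2 * m"
        using sum_fail_len sum.reindex[OF inj, of del] by (simp add: del_def o_def m_def)
      then have "K * (\<Sum>i\<in>{1..<N}. del (ns i)) \<le> K * (2 * m)" using K0 by (rule mult_left_mono)
      then show "vc (0 ::= Num 0) Q a' (t' + (1 + costb (LtE (Var 16) (Var 15))))"
        using I v N card_written[of ns N] d_m B_bounds by (auto simp: I_def intro!: Q small)
    next
      assume "evb a' (LtE (Var 16) (Var 15))"
      then have v: "1 \<le> ?v" "?v < N" using I by (auto simp: I_def)
      have v0: "0 \<le> ?v" using v by simp
      have I': "rg a' 9 = B" "rg a' 15 = N" "lo a' = lo1" "en a' = D"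
        "fails N ns ?v (fl a')" "outs N ns ?v (fl a')"
        using I by (auto simp: I_def)
      note tv = treeD(6)[OF tree v]
      obtain T where T: "Fail f D (ns ?v) = Some T" "T \<in> Pref f D" "length T < length (ns ?v)"
        using Fail_Pref[OF tree_Pref[OF tree v0 v(2)]] tv by blast
      have PARv: "0 \<le> fl a' PAR ?v" "fl a' PAR ?v < ?v" using tv by blast+
      have ok: "?v \<le> M" "fl a' PAR ?v \<le> M" "-1 \<in> words w" "0 \<in> words w" "1 \<in> words w" "?v + 1 \<in> words w"
        using v N PARv B_bounds d_m by (auto intro!: small)
      \<comment> \<open>A failure state is strictly shorter, so by \<open>dep_mono\<close> its node
        precedes \<open>?v\<close> and its output list is complete.\<close>
      have ref: "0 \<le> x \<and> x < ?v \<and> x \<le> M \<and> ns x = T" if "is_ref N ns (Fail f D (ns ?v)) x" for x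
      proof -
        have x: "0 \<le> x" "x < N" "ns x = T" using that T by (auto simp: is_ref_def)
        then have "x < ?v" using dep_mono[OF tree v0, of x] T(3) by force
        then show ?thesis using x ok by simp
      qed
      have sumv: "(\<Sum>i\<in>{1..<?v + 1}. del (ns i)) = (\<Sum>i\<in>{1..<?v}. del (ns i)) + del (ns ?v)"
      proof -
        have "{1..<?v + 1} = insert ?v {1..<?v}" using v by auto
        then show ?thesis by simp
      qed
      have cardv: "int (card (written ns (?v + 1))) = int (card (written ns ?v)) + int (card (ends (ns ?v)))"
      proof -
        have "written ns ?v \<inter> ends (ns ?v) = {}" using ends_fresh[OF tree v0 v(2)] by blast
        from card_Un_disjoint[OF finite_written finite_ends this] show ?thesis
          by (simp add: written_step[OF v0])
      qed
      have fails': "fails N ns (?v + 1) h"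
        if "h FAIL = (fl a' FAIL)(?v := x)" "is_ref N ns (Fail f D (ns ?v)) x" for x and h :: "nat \<Rightarrow> int \<Rightarrow> int"
        using I'(5) that unfolding fails_def by (auto simp: zless_add1_eq)
      have out': "outs N ns ?v (h :: nat \<Rightarrow> int \<Rightarrow> int)"
        if h: "h OUT = (fl a' OUT)(?v := x)" "h CK = fl a' CK" "h CN = fl a' CN" for x h
      proof -
        have "has_out ns ?v h (h OUT i) (oset (ns i))" if i: "0 \<le> i" "i < ?v" for i
        proof -
          have "has_out ns ?v (fl a') (fl a' OUT i) (oset (ns i))" using I'(6) i unfolding outs_def by blast
          then have "has_out ns ?v h (fl a' OUT i) (oset (ns i))"
            by (rule has_out_cong) (simp_all add: h)
          then show ?thesis using i by (simp add: h)
        qed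
        then show ?thesis unfolding outs_def by blast
      qed
      have reach: "\<exists>n'<n. I n' b s"
        if "outs N ns (?v + 1) (fl c)" "is_ref N ns (Fail f D (ns ?v)) x"
          "\<And>j. j < OUT \<Longrightarrow> fl c j = ((fl a')(FAIL := (fl a' FAIL)(?v := x))) j"
          "fl b = fl c" "rg b 16 = ?v + 1" "rg b 9 = B" "rg b 15 = N" "lo b = lo1" "en b = D"
          "s \<le> t' + 200 + 200 * int (card (ends (ns ?v))) + K * del (ns ?v)" for b c x s
      proof -
        have agree: "fl c j = fl a' j" if "j < 15" for j using that(1) \<open>\<And>j. j < OUT \<Longrightarrow> _\<close> by simp
        have "trie N ns (fl c)" "slots N (fl c)" using frame[of "fl c" "fl a'", OF agree] tr' sl' by auto
        moreover have "fails N ns (?v + 1) (fl c)" by (rule fails'[OF _ that(2)]) (simp add: that(3))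
        ultimately have "I (nat (N - (?v + 1))) b s"
          unfolding I_def using that v I sumv cardv by (auto simp: I_def algebra_simps)
        moreover have "nat (N - (?v + 1)) < n" using I v by (auto simp: I_def)
        ultimately show ?thesis by blast
      qed
      show "wp fail_outer (\<lambda>a' t'. \<exists>n'<n. I n' a' t') a' (t' + (1 + costb (LtE (Var 16) (Var 15))))"
        apply (rule vc_sound)
        apply (simp add: fail_outer_def v0 ok I' PARv)
        apply (rule fail_inner_spec[where v = ?v and N = N and ns = ns,
            OF _ _ _ _ _ _ _ _ _ _ _ _ _ _ size K])
        using tr' sl' v I' apply simp_all
        subgoal for e s
          using ref[of "rg e 22"] T
          apply (simp add: ok)
          apply (rule out_inner_spec[where v = ?v and N = N and ns = ns and u = "rg e 22"])
          using frame[of "(fl a')(FAIL := (fl a' FAIL)(?v := rg e 22), OUT := (fl a' OUT)(?v := fl a' OUT (rg e 22)))" "fl a'"] ok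
            out'[of "(fl a')(FAIL := (fl a' FAIL)(?v := rg e 22), OUT := (fl a' OUT)(?v := fl a' OUT (rg e 22)))"]
          apply simp_all
          subgoal for c x by (rule reach[of c "rg e 22"]) (simp_all add: del_def)
          done
        done
    }
  qed
  moreover have "I (nat (N - 1)) (a\<lparr>fl := (fl a)(FAIL := (fl a FAIL)(0 := - 1), OUT := (fl a OUT)(0 := - 1)),
      rg := (rg a)(16 := 1)\<rparr>) (20 + t)"
  proof -
    let ?h = "(fl a)(FAIL := (fl a FAIL)(0 := - 1), OUT := (fl a OUT)(0 := - 1))"
    have "trie N ns ?h" "slots N ?h" using frame[of ?h "fl a"] tr sl by auto
    moreover have ns0: "ns 0 = []" by (rule treeD(2)[OF tree0])
    have zero: "i = 0" if "0 \<le> i" "i < 1" for i :: int using that by simp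
    have "is_ref N ns (Fail f D (ns 0)) (?h FAIL 0)" by (simp add: ns0 is_ref_def)
    then have "fails N ns 1 ?h" unfolding fails_def using zero by blast
    moreover have "outs N ns 1 ?h"
    proof -
      have "oset [] = {}" by (simp add: oset_def Out_Nil)
      then have "has_out ns 1 ?h (-1) (oset [])" unfolding has_out_def by (intro exI[of _ "[]"]) auto
      then have "has_out ns 1 ?h (?h OUT 0) (oset (ns 0))" by (simp add: ns0)
      then show ?thesis unfolding outs_def using zero by blast
    qed
    ultimately show ?thesis unfolding I_def using a N by auto
  qed
  ultimately show "vc fail_prog Q a t"
    using a d_m B_bounds by (auto simp: fail_prog_def intro!: small)
qed

end

section \<open>Queries\<close>

definition goto_query :: cmd where
  "goto_query = 9 ::= Low (Num 0) ;; search_prog"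

definition fail_query :: cmd where
  "fail_query = 9 ::= Low (Num 0) ;; 0 ::= Fld FAIL (Var 0)"

definition out_query :: cmd where
  "out_query = 9 ::= Low (Num 0) ;; 0 ::= Fld OUT (Var 0)"

context machine
begin

text \<open>Queries may change only registers; equality of the other fields is what
  \<open>answers\<close> demands of the final state.\<close>

lemma answersI:
  assumes "vc c (\<lambda>a' t'. fl a' = fl a \<and> lo a' = lo a \<and> en a' = en a \<and> rg a' 0 = v \<and> t' \<le> T)
    (a\<lparr>rg := (\<lambda>x. if x < length args then args ! x else 0)\<rparr>) 0"
  shows "\<exists>t. answers w \<Sigma> f E R (compile c) (conc B a) args t v \<and> int t \<le> T"
proof -
  obtain t a' where t: "exec w \<Sigma> f E R (compile c)
      (conc B (a\<lparr>rg := (\<lambda>x. if x < length args then args ! x else 0)\<rparr>)) t (conc B a')"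
    "fl a' = fl a" "lo a' = lo a" "en a' = en a" "rg a' 0 = v" "int t \<le> T"
    using vc_sound[OF assms] unfolding wp_def by auto
  have "conc B (a\<lparr>rg := \<rho>\<rparr>) = (conc B a)\<lparr>reg := \<rho>\<rparr>" for \<rho>
    by (simp add: conc_def fun_eq_iff)
  moreover have "conc B a' = (conc B a)\<lparr>reg := rg a'\<rparr>"
    using t by (simp add: conc_def fun_eq_iff)
  ultimately show ?thesis using t unfolding answers_def by auto
qed

end

context loaded
begin

lemma linked_out_list:
  "out_list (fl a) p ks \<Longrightarrow> linked_list (mem (conc B a)) p (map (\<lambda>k. nat (k - 1)) ks)"
proof (induction ks arbitrary: p)
  case (Cons k ks)
  then have k: "p = B + (32 * k + 17)" "1 \<le> k" "fl a CK k = k - 1" "out_list (fl a) (fl a CN k) ks"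
    by auto
  have "mem (conc B a) (B + (32 * k + 17)) = fl a CK k"
    using mem_conc_fld[of k 17 a] k by simp
  moreover have "mem (conc B a) (B + (32 * k + 17) + 1) = fl a CN k"
    using mem_conc_fld[of k 18 a] k by (simp add: algebra_simps)
  ultimately show ?case using k Cons.IH[OF k(4)] B_bounds by simp
qed simp

lemma pat_oset:
  assumes "S \<in> Pref f D"
  shows "pat ` oset S = Out r f D S"
proof -
  obtain P j where P: "P \<in> set D" "j \<le> length P" "S = take j (f P)"
    using assms unfolding Pref_iff by blast
  have "Out r f D S \<subseteq> set D"
    unfolding P(3) Out_take[OF scer enc dict P(1,2)] by (auto simp: out_patterns_def)
  moreover have "\<exists>k. 1 \<le> k \<and> k \<le> d \<and> pat k = Q" if Q: "Q \<in> set D" for Q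
  proof -
    obtain i where "i < length D" "D ! i = Q" using Q by (auto simp: in_set_conv_nth)
    then show ?thesis by (intro exI[of _ "int i + 1"]) (auto simp: d_def pat_def)
  qed
  ultimately show ?thesis unfolding oset_def by (auto simp: image_iff)
qed

lemma holds_automaton:
  assumes tr: "trie N ns (fl a)" and sl: "slots N (fl a)" and fa: "fails N ns N (fl a)"
    and ou: "outs N ns N (fl a)" and a: "rg a 0 = 0" "lo a = lo1" "en a = D"
    and size: "int (max_out_degree f D) < 2 ^ L" "real L \<le> 1 + log 2 (real (max_out_degree f D))"
    and C: "350 \<le> C"
  shows "holds_SCERA w \<Sigma> f E R r D (compile goto_query) (compile fail_query) (compile out_query) C (conc B a)"
proof -
  note tree = trieD(1)[OF tr]
  have N: "1 \<le> N" "N \<le> m + 1" using tree_bound[OF tree] treeD(1)[OF tree] by auto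
  \<comment> \<open>Node numbers themselves serve as state names; \<open>ns\<close> is a bijection
    from them onto the states.\<close>
  define \<nu> where "\<nu> = inv_into {0..<N} ns"
  have inj: "inj_on ns {0..<N}" by (rule treeD(5)[OF tree])
  have \<nu>: "\<nu> (ns i) = i" if "0 \<le> i" "i < N" for i
    unfolding \<nu>_def by (rule inv_into_f_f[OF inj]) (use that in simp)
  have img: "\<nu> ` Pref f D = {0..<N}"
    unfolding trieD(3)[OF tr, symmetric] image_image using \<nu> by auto
  have inj\<nu>: "inj_on \<nu> (Pref f D)"
    unfolding \<nu>_def using inj_on_inv_into[of "Pref f D" ns "{0..<N}"] trieD(3)[OF tr] by simp
  have words: "{0..<N} \<subseteq> words w" using N B_bounds d_m by (auto intro!: small)
  have w0: "0 \<in> words w" using B_bounds d_m by (auto intro!: small)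
  have lg: "0 \<le> log 2 (real (max_out_degree f D))" using max_out_degree_pos by simp
  have goto: "\<exists>t. answers w \<Sigma> f E R (compile goto_query) (conc B a) [i, c] t (null_or \<nu> (goto f D (ns i) c)) \<and>
      real t \<le> C * (1 + log 2 (real (max_out_degree f D)))"
    if i: "0 \<le> i" "i < N" and c: "c \<in> words w" for i c
  proof -
    have null: "null_or \<nu> (goto f D (ns i) c) = x" if "is_goto N ns (ns i) c x" for x
      using that \<nu>[of x] by (auto simp: is_goto_def null_or_def goto_def split: if_splits)
    have "\<exists>t. answers w \<Sigma> f E R (compile goto_query) (conc B a) [i, c] t (null_or \<nu> (goto f D (ns i) c)) \<and>
        int t \<le> 250 + 50 * int L"
    proof (rule answersI)
      show "vc goto_query (\<lambda>a' t'. fl a' = fl a \<and> lo a' = lo a \<and> en a' = en a \<and>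
          rg a' 0 = null_or \<nu> (goto f D (ns i) c) \<and> t' \<le> 250 + 50 * int L)
        (a\<lparr>rg := (\<lambda>x. if x < length [i, c] then [i, c] ! x else 0)\<rparr>) 0"
        unfolding goto_query_def vc.simps(7)
        apply (simp add: w0 a table(4) d_m B_bounds)
        apply (rule search_spec[where N = N and ns = ns and L = L])
        using tr sl i a c size(1) null apply simp_all
        done
    qed
    then obtain t where t: "answers w \<Sigma> f E R (compile goto_query) (conc B a) [i, c] t
        (null_or \<nu> (goto f D (ns i) c))" "int t \<le> 250 + 50 * int L" by blast
    have "real t \<le> 250 + 50 * real L" using t(2) by linarith
    \<comment> \<open>With \<open>L \<le> 1 + log \<pi>\<close> the bound is at most
      \<open>300 + 50 * log \<pi>\<close>.\<close>
    also have "\<dots> \<le> 350 * (1 + log 2 (real (max_out_degree f D)))" using size(2) lg by simp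
    also have "\<dots> \<le> C * (1 + log 2 (real (max_out_degree f D)))"
      using C lg by (intro mult_right_mono) auto
    finally show ?thesis using t(1) by blast
  qed
  have fail: "\<exists>t. answers w \<Sigma> f E R (compile fail_query) (conc B a) [i] t (null_or \<nu> (Fail f D (ns i))) \<and>
      real t \<le> C" if i: "0 \<le> i" "i < N" for i
  proof -
    have ref: "is_ref N ns (Fail f D (ns i)) (fl a FAIL i)" using fa i unfolding fails_def by blast
    have null: "null_or \<nu> (Fail f D (ns i)) = fl a FAIL i"
      using ref \<nu> by (auto simp: is_ref_def null_or_def split: option.splits)
    have "\<exists>t. answers w \<Sigma> f E R (compile fail_query) (conc B a) [i] t (fl a FAIL i) \<and> int t \<le> 100"
      by (rule answersI)
        (use i N in \<open>simp add: fail_query_def w0 a table(4) d_m B_bounds order.trans[OF _ B_bounds(5)]\<close>)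
    then obtain t where "answers w \<Sigma> f E R (compile fail_query) (conc B a) [i] t (fl a FAIL i)" "int t \<le> 100"
      by blast
    then show ?thesis using C null by (intro exI[of _ t]) auto
  qed
  have out: "\<exists>t p ks. answers w \<Sigma> f E R (compile out_query) (conc B a) [i] t p \<and> real t \<le> C \<and>
      linked_list (mem (conc B a)) p ks \<and> distinct ks \<and> set ks \<subseteq> {..<length D} \<and>
      (\<lambda>k. D ! k) ` set ks = Out r f D (ns i)" if i: "0 \<le> i" "i < N" for i
  proof -
    obtain ks where ks: "out_list (fl a) (fl a OUT i) ks" "distinct ks" "set ks = oset (ns i)"
      using ou i unfolding outs_def has_out_def by blast
    have bounds: "1 \<le> k \<and> k \<le> d" if "k \<in> set ks" for k using that ks(3) by (simp add: oset_def)
    have "\<exists>t. answers w \<Sigma> f E R (compile out_query) (conc B a) [i] t (fl a OUT i) \<and> int t \<le> 100"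
      by (rule answersI)
        (use i N in \<open>simp add: out_query_def w0 a table(4) d_m B_bounds order.trans[OF _ B_bounds(5)]\<close>)
    then obtain t where t: "answers w \<Sigma> f E R (compile out_query) (conc B a) [i] t (fl a OUT i)" "int t \<le> 100"
      by blast
    let ?ks = "map (\<lambda>k. nat (k - 1)) ks"
    have "linked_list (mem (conc B a)) (fl a OUT i) ?ks" by (rule linked_out_list[OF ks(1)])
    moreover have "inj_on (\<lambda>k. nat (k - 1)) (set ks)"
    proof (rule inj_onI)
      fix x y assume "x \<in> set ks" "y \<in> set ks" "nat (x - 1) = nat (y - 1)"
      then show "x = y" using bounds[of x] bounds[of y] by auto
    qed
    then have "distinct ?ks" using ks(2) by (simp add: distinct_map)
    moreover have "set ?ks \<subseteq> {..<length D}" using bounds by (force simp: d_def)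
    moreover have "(\<lambda>k. D ! k) ` set ?ks = Out r f D (ns i)"
      using pat_oset[OF tree_Pref[OF tree i]] by (simp add: image_image ks(3) pat_def)
    ultimately show ?thesis using t C by (intro exI[of _ t] exI[of _ "fl a OUT i"] exI[of _ ?ks]) auto
  qed
  show ?thesis
    unfolding holds_SCERA_def
  proof (intro exI[of _ \<nu>] conjI ballI)
    show "reg (conc B a) 0 = \<nu> []"
      using \<nu>[of 0] N treeD(2)[OF tree] a by (simp add: conc_def)
    show "\<nu> ` Pref f D \<subseteq> {0..} \<inter> words w" using img words by auto
    fix S assume "S \<in> Pref f D"
    then have "S \<in> ns ` {0..<N}" using trieD(3)[OF tr] by simp
    then obtain i where i: "0 \<le> i" "i < N" "S = ns i" by auto
    note \<nu>i = \<nu>[OF i(1,2)]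
    show "\<exists>t. answers w \<Sigma> f E R (compile fail_query) (conc B a) [\<nu> S] t (null_or \<nu> (Fail f D S)) \<and> real t \<le> C"
      using fail[OF i(1,2)] by (simp add: i(3) \<nu>i)
    show "\<exists>t p ks. answers w \<Sigma> f E R (compile out_query) (conc B a) [\<nu> S] t p \<and> real t \<le> C \<and>
      linked_list (mem (conc B a)) p ks \<and> distinct ks \<and> set ks \<subseteq> {..<length D} \<and>
      (\<lambda>k. D ! k) ` set ks = Out r f D S"
      using out[OF i(1,2)] by (simp add: i(3) \<nu>i)
    fix c assume "c \<in> words w"
    then show "\<exists>t. answers w \<Sigma> f E R (compile goto_query) (conc B a) [\<nu> S, c] t (null_or \<nu> (goto f D S c)) \<and>
        real t \<le> C * (1 + log 2 (real (max_out_degree f D)))"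
      using goto[OF i(1,2)] by (simp add: i(3) \<nu>i)
  qed (rule inj\<nu>)
qed

lemma automaton_spec:
  assumes a: "rg a 9 = B" "rg a 14 = nb" "lo a = lo1" "en a = D"
      "\<And>i. 1 \<le> i \<Longrightarrow> i \<le> d \<Longrightarrow> fl a START i = pos i - 1 \<and> fl a NEXT i = i - 1"
      "fl a LIST = (\<lambda>_. 0)(0 := d)" "\<And>j. 3 \<le> j \<Longrightarrow> fl a j = (\<lambda>_. 0)"
    and size: "int (max_out_degree f D) < 2 ^ L" "real L \<le> 1 + log 2 (real (max_out_degree f D))"
    and C: "350 \<le> C"
    and Q: "\<And>a' t'. holds_SCERA w \<Sigma> f E R r D (compile goto_query) (compile fail_query) (compile out_query) C
        (conc B a') \<Longrightarrow>
      t' \<le> t + 4500 * m + 2 * ((500 + int (R (max_length D)) + 50 * int L) * m) \<Longrightarrow> Q a' t'"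
  shows "wp (trie_prog ;; sort_prog ;; fail_prog) Q a t"
proof (intro wp_seq trie_spec[OF a(1-3,5-7)])
  fix a1 :: astate and t1 :: int and ns
  assume 1: "outer (rg a1 15) (rg a1 15) ns (fl a1)" "rg a1 9 = B" "rg a1 14 = nb" "lo a1 = lo1"
    "en a1 = en a" "t1 \<le> t + 1500 * m"
  have cur: "fl a1 CUR i = fl a1 FIRST i" if "0 \<le> i" "i < rg a1 15" for i
    using 1(1) that unfolding outer_def finished_def by blast
  show "wp sort_prog (wp fail_prog Q) a1 t1"
  proof (rule sort_spec[OF outer_trie[OF 1(1)] cur 1(2-4) refl])
    fix a2 :: astate and t2 :: int
    assume 2: "trie (rg a1 15) ns (fl a2)" "slots (rg a1 15) (fl a2)" "rg a2 9 = B" "rg a2 15 = rg a1 15"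
      "lo a2 = lo1" "en a2 = en a1" "t2 \<le> t1 + 2000 * m"
    show "wp fail_prog Q a2 t2"
    proof (rule fail_spec[OF 2(1-3,5) _ 2(4) size(1) refl])
      show "en a2 = D" using 2 1 a by simp
    next
      fix a3 :: astate and t3 :: int
      assume 3: "trie (rg a1 15) ns (fl a3)" "slots (rg a1 15) (fl a3)" "fails (rg a1 15) ns (rg a1 15) (fl a3)"
        "outs (rg a1 15) ns (rg a1 15) (fl a3)" "rg a3 0 = 0" "lo a3 = lo1" "en a3 = D"
        "t3 \<le> t2 + 1000 * m + 2 * ((500 + Rm + 50 * int L) * m)"
      show "Q a3 t3"
        using holds_automaton[OF 3(1-7) size C] 1(6) 2(7) 3(8)
        by (intro Q) (auto simp: Rm_def)
    qed
  qed
qed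

end

section \<open>Composition of the phases\<close>

definition build_prog :: cmd where
  "build_prog = setup_prog ;; encode_prog ;; rename_prog ;; trie_prog ;; sort_prog ;; fail_prog"

context construction
begin

text \<open>The \<open>5000 * m\<close> consists of \<open>4500 * m\<close> for the three phases on
  the automaton and at most \<open>400 * m\<close> for loading, since \<open>d \<le> m\<close> and
  \<open>1 \<le> m\<close>.\<close>

lemma build_spec:
  assumes size: "int (max_out_degree f D) < 2 ^ L" "real L \<le> 1 + log 2 (real (max_out_degree f D))"
    and C: "350 \<le> C"
  shows "\<exists>t s. exec w \<Sigma> f E R (compile build_prog) (init D) t s \<and>
    int t \<le> int (E (total_length D)) + 5000 * m + 2 * ((500 + int (R (max_length D)) + 50 * int L) * m) \<and>
    holds_SCERA w \<Sigma> f E R r D (compile goto_query) (compile fail_query) (compile out_query) C s"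
proof -
  define Q where "Q = (\<lambda>a' t'. holds_SCERA w \<Sigma> f E R r D (compile goto_query) (compile fail_query)
      (compile out_query) C (conc B a') \<and>
    t' \<le> int (E (total_length D)) + 5000 * m + 2 * ((500 + int (R (max_length D)) + 50 * int L) * m))"
  have "wp build_prog Q a0 0"
    unfolding build_prog_def
  proof (intro wp_seq setup_spec)
    fix a1 :: astate and t1 :: int
    assume 1: "rg a1 9 = B" "rg a1 10 = d" "lo a1 = lo0(0 := B)" "fl a1 = (\<lambda>_ _. 0)" "en a1 = []"
      "t1 \<le> 50 + 50 * d"
    show "wp encode_prog (wp (rename_prog ;; trie_prog ;; sort_prog ;; fail_prog) Q) a1 t1"
    proof (rule encode_spec[OF 1(1-5)])
      fix a2 :: astate and t2 :: int
      assume 2: "rg a2 9 = B" "rg a2 10 = d" "lo a2 0 = B" "\<And>i. 1 \<le> i \<Longrightarrow> i \<le> d \<Longrightarrow> lo a2 i = plen i"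
        "\<And>x. x < 0 \<Longrightarrow> lo a2 x = 0"
        "\<And>i j. 1 \<le> i \<Longrightarrow> i \<le> d \<Longrightarrow> 0 \<le> j \<Longrightarrow> j < plen i \<Longrightarrow> lo a2 (pos i + j) = F i ! nat j"
        "\<And>i. 1 \<le> i \<Longrightarrow> i \<le> d \<Longrightarrow> fl a2 START i = pos i - 1 \<and> fl a2 NEXT i = i - 1"
        "fl a2 LIST = (\<lambda>_. 0)(0 := d)" "\<And>j. 3 \<le> j \<Longrightarrow> fl a2 j = (\<lambda>_. 0)" "en a2 = D"
        "t2 \<le> t1 + 50 + 50 * d + int (E (total_length D))"
      show "wp (rename_prog ;; trie_prog ;; sort_prog ;; fail_prog) Q a2 t2"
      proof (rule wp_seq, rule rename_spec[OF 2(1-6)])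
        fix a3 :: astate and t3 :: int
        assume 3: "rg a3 9 = B" "rg a3 10 = d" "renamed (lo a3) (rg a3 14)" "fl a3 = fl a2" "en a3 = en a2"
          "t3 \<le> t2 + 100 + 100 * m"
        interpret loaded \<Sigma> \<Pi> r f D w E R "lo a3" "rg a3 14"
          by unfold_locales (rule 3(3))
        show "wp (trie_prog ;; sort_prog ;; fail_prog) Q a3 t3"
          by (rule automaton_spec[OF 3(1) refl refl _ _ _ _ size C])
            (use 1(6) 2 3 d_m in \<open>auto simp: Q_def\<close>)
      qed
    qed
  qed
  then show ?thesis unfolding wp_def Q_def conc_a0 by auto
qed

end

theorem theorem3:
  shows "\<exists>(build :: com) (goto_q :: com) (fail_q :: com) (out_q :: com) (c :: nat) (C :: real).
    \<forall>(w :: nat) (\<Sigma> :: int set) (\<Pi> :: int set) (r :: (int list \<times> int list) set)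
     (f :: int list \<Rightarrow> int list) (E :: nat \<Rightarrow> nat) (R :: nat \<Rightarrow> nat) (D :: int list list).
      scer \<Sigma> r \<longrightarrow>
      prefix_encoding \<Sigma> \<Pi> r f \<longrightarrow>
      dictionary \<Sigma> D \<longrightarrow>
      c * total_length D \<le> 2 ^ w \<longrightarrow>
      (\<forall>P \<in> set D. set P \<subseteq> words w \<and>
         (\<forall>i j. 1 \<le> i \<and> i \<le> j \<and> j \<le> length P \<longrightarrow> set (f (substr P i j)) \<subseteq> words w)) \<longrightarrow>
      (\<Sum>P\<leftarrow>D. E (length P)) \<le> E (total_length D) \<longrightarrow>
      0 < R (max_length D) \<longrightarrow>
      (\<forall>n. 1 \<le> n \<and> n \<le> max_length D \<longrightarrow> R n \<le> R (max_length D)) \<longrightarrow>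
      (\<exists>t s. exec w \<Sigma> f E R build (init D) t s \<and>
         real t \<le> C * (real (E (total_length D)) + real (total_length D) *
           (real (R (max_length D)) + log 2 (real (max_out_degree f D)))) \<and>
         holds_SCERA w \<Sigma> f E R r D goto_q fail_q out_q C s)"
proof (rule exI[of _ "compile build_prog"], rule exI[of _ "compile goto_query"],
    rule exI[of _ "compile fail_query"], rule exI[of _ "compile out_query"],
    rule exI[of _ 1024], rule exI[of _ 7000], intro allI impI)
  fix w :: nat and \<Sigma> \<Pi> :: "int set" and r :: "(int list \<times> int list) set"
    and f :: "int list \<Rightarrow> int list" and E R :: "nat \<Rightarrow> nat" and D :: "int list list"
  assume assms: "scer \<Sigma> r" "prefix_encoding \<Sigma> \<Pi> r f" "dictionary \<Sigma> D" "1024 * total_length D \<le> 2 ^ w"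
    "\<forall>P \<in> set D. set P \<subseteq> words w \<and>
       (\<forall>i j. 1 \<le> i \<and> i \<le> j \<and> j \<le> length P \<longrightarrow> set (f (substr P i j)) \<subseteq> words w)"
    "(\<Sum>P\<leftarrow>D. E (length P)) \<le> E (total_length D)" "0 < R (max_length D)"
    "\<forall>n. 1 \<le> n \<and> n \<le> max_length D \<longrightarrow> R n \<le> R (max_length D)"
  interpret construction \<Sigma> \<Pi> r f D w E R
    by unfold_locales (use assms in auto)
  define p g where "p = max_out_degree f D" and "g = log 2 (real p)"
  have p: "1 \<le> p" using max_out_degree_pos by (simp add: p_def)
  then have g: "0 \<le> g" by (simp add: g_def)
  \<comment> \<open>The least number of halvings with \<pi> below \<open>2 ^ L\<close>; at \<pi>
    equal to 1 it is still 1.\<close>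
  define L where "L = nat \<lfloor>g\<rfloor> + 1"
  have "real L = 1 + real_of_int \<lfloor>g\<rfloor>" using g by (simp add: L_def)
  then have L: "real L \<le> 1 + g" "g < real L" by linarith+
  have "real p = 2 powr g" using p by (simp add: g_def)
  also have "\<dots> < 2 powr real L" using L by simp
  also have "\<dots> = 2 ^ L" by (simp add: powr_realpow)
  finally have "real p < real (2 ^ L)" by simp
  then have "p < 2 ^ L" by (simp only: of_nat_less_iff)
  then have "int p < 2 ^ L" by (metis of_nat_less_iff of_nat_numeral of_nat_power)
  from build_spec[of L 7000, folded p_def, folded g_def, OF this L(1)] obtain t s where
    t: "exec w \<Sigma> f E R (compile build_prog) (init D) t s"
      "int t \<le> int (E (total_length D)) + 5000 * m + 2 * ((500 + int (R (max_length D)) + 50 * int L) * m)"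
      "holds_SCERA w \<Sigma> f E R r D (compile goto_query) (compile fail_query) (compile out_query) 7000 s"
    by auto
  define x y where "x = real (total_length D)" and "y = real (R (max_length D))"
  have "real_of_int (int t) \<le> real_of_int (int (E (total_length D)) + 5000 * m +
      2 * ((500 + int (R (max_length D)) + 50 * int L) * m))"
    using t(2) by (simp only: of_int_le_iff)
  then have "real t \<le> real (E (total_length D)) + 5000 * x + 2 * ((500 + y + 50 * real L) * x)"
    by (simp add: m_def x_def y_def)
  moreover have "real L * x \<le> (1 + g) * x" using L(1) by (rule mult_right_mono) (simp add: x_def)
  \<comment> \<open>Here \<open>R\<close> is at least 1, so the linear terms, about
    \<open>6100 * x\<close> in all, are charged to \<open>y * x\<close>.\<close>
  moreover have "1 * x \<le> y * x" using R_pos by (intro mult_right_mono) (auto simp: x_def y_def)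
  moreover have "0 \<le> g * x" using g by (simp add: x_def)
  ultimately have "real t \<le> 7000 * (real (E (total_length D)) + x * (y + g))"
    by (simp add: algebra_simps)
  then show "\<exists>t s. exec w \<Sigma> f E R (compile build_prog) (init D) t s \<and>
      real t \<le> 7000 * (real (E (total_length D)) + real (total_length D) *
        (real (R (max_length D)) + log 2 (real (max_out_degree f D)))) \<and>
      holds_SCERA w \<Sigma> f E R r D (compile goto_query) (compile fail_query) (compile out_query) 7000 s"
    using t(1,3) unfolding x_def y_def g_def p_def by blast
qed

end
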